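(* Let $q$ be a power of the prime $p$ and $n\ge1$ such that $(q,n)$ is regular; write $n=p^an'$ with $p\nmid n'$. Then the number of elements of $\mathbb{F}_{q^n}$ that are completely normal over $\mathbb{F}_q$ equals \[\prod_{k\in\mathcal{N}}\Big(q^{\mathrm{ord}_k(q)/\tau_k}-1\Big)^{\tau_k\varphi(k)/\mathrm{ord}_k(q)}\,q^{(p^a-1)\varphi(k)}\ \cdot\ \prod_{k\in\mathcal{E}}\Big(q^{2\,\mathrm{ord}_k(q)/\tau_k}-4q^{\mathrm{ord}_k(q)/\tau_k}+3\Big)^{\tau_k\varphi(k)/(2\,\mathrm{ord}_k(q))}\,q^{(p^a-1)\varphi(k)},\] where the second product is $1$ if $\mathcal{E}$ is empty.
   Context: $\varphi$ is Euler's totient function; $\mathrm{rad}(m)$ is the product of primes dividing $m$; $\mathrm{ord}_m(q)$ the multiplicative order of $q$ mod $m$; $(q,n)$ is regular if $\gcd(\mathrm{ord}_{\mathrm{rad}(n')}(q),n)=1$. A divisor $k=2^c\ell$ ($\ell$ odd) of $n'$ is exceptional if $q\equiv3\pmod 4$, $c\ge3$ and $\mathrm{ord}_{2^c}(q)=2$; $\mathcal{E}$ is the set of exceptional and $\mathcal{N}$ the set of non-exceptional divisors of $n'$. For $k\mid n'$ write $\mathrm{ord}_k(q)/\mathrm{ord}_{\mathrm{rad}(k)}(q)=\prod_{r\mid k,\,r\text{ prime}}r^{\alpha(r)}$ and set $\tau_k=\prod_r r^{\lfloor\alpha(r)/2\rfloor}$ ($\tau_1=1$). With $\sigma:v\mapsto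 v^q$, $v\in\mathbb{F}_{q^n}$ is completely normal over $\mathbb{F}_q$ if for every divisor $d$ of $n$ the elements $\sigma^{dj}(v)$, $0\le j<n/d$, form an $\mathbb{F}_{q^d}$-basis of $\mathbb{F}_{q^n}$. *)

theory Defs
  imports
    "HOL-Number_Theory.Number_Theory"
    "HOL-Computational_Algebra.Polynomial"
begin

section \<open>Number-theoretic quantities\<close>

definition rad :: "nat \<Rightarrow> nat" where
  "rad m = \<Prod>(prime_factors m)"

text \<open>
  The multiplicity below is the exponent \<open>\<alpha>(r)\<close> in
  \<open>ord\<^sub>k(q) / ord\<^bsub>rad(k)\<^esub>(q) = \<Prod> r ^ \<alpha>(r)\<close>. For \<open>k\<close> coprime to \<open>q\<close> the quotient is exact and all of
  its prime divisors divide \<open>k\<close>; see \<open>ord_eq_ord_rad_times\<close>.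
\<close>
definition alpha :: "nat \<Rightarrow> nat \<Rightarrow> nat \<Rightarrow> nat" where
  "alpha q k r = multiplicity r (ord k q div ord (rad k) q)"

definition tau :: "nat \<Rightarrow> nat \<Rightarrow> nat" where
  "tau q k = (\<Prod>r\<in>prime_factors k. r ^ (alpha q k r div 2))"

definition exceptional :: "nat \<Rightarrow> nat \<Rightarrow> bool" where
  "exceptional q k \<longleftrightarrow>
     (\<exists>c l. odd l \<and> k = 2 ^ c * l \<and> q mod 4 = 3 \<and> c \<ge> 3 \<and> ord (2 ^ c) q = 2)"

definition exc_divisors :: "nat \<Rightarrow> nat \<Rightarrow> nat set" where
  "exc_divisors q n' = {k. k dvd n' \<and> exceptional q k}"

definition nonexc_divisors :: "nat \<Rightarrow> nat \<Rightarrow> nat set" where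
  "nonexc_divisors q n' = {k. k dvd n' \<and> \<not> exceptional q k}"


section \<open>Completely normal elements\<close>

text \<open>
  The finite field \<open>F\<close> with \<open>q ^ n\<close> elements is the type \<open>'a\<close>. For \<open>d\<close> dividing \<open>n\<close>, its unique
  subfield with \<open>Q = q ^ d\<close> elements is the set of roots of \<open>X ^ Q - X\<close>; see
  \<open>gf_subfield\<close> and \<open>card_gf\<close>.
\<close>
definition gf :: "nat \<Rightarrow> 'a :: field set" where
  "gf Q = {x. x ^ Q = x}"

definition frob :: "nat \<Rightarrow> 'a :: field \<Rightarrow> 'a" where
  "frob q v = v ^ q"

text \<open>
  The family \<open>b 0, \<dots>, b (m - 1)\<close> is a basis of the whole field as a vector space over the
  subfield \<open>K\<close>. Being a statement about the family and not about its range, it entails that the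
  members are distinct.
\<close>
definition is_basis_over :: "'a :: field set \<Rightarrow> nat \<Rightarrow> (nat \<Rightarrow> 'a) \<Rightarrow> bool" where
  "is_basis_over K m b \<longleftrightarrow>
     (\<forall>c. (\<forall>j<m. c j \<in> K) \<and> (\<Sum>j<m. c j * b j) = 0 \<longrightarrow> (\<forall>j<m. c j = 0)) \<and>
     (\<forall>x. \<exists>c. (\<forall>j<m. c j \<in> K) \<and> x = (\<Sum>j<m. c j * b j))"

definition completely_normal :: "nat \<Rightarrow> nat \<Rightarrow> 'a :: field \<Rightarrow> bool" where
  "completely_normal q n v \<longleftrightarrow>
     (\<forall>d. d dvd n \<longrightarrow> is_basis_over (gf (q ^ d)) (n div d) (\<lambda>j. (frob q ^^ (d * j)) v))"


section \<open>Consistency of the definitions\<close>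

lemma gf_subfield:
  fixes x y :: "'a :: finite_field"
  assumes "prime p" "q = p ^ e" "e > 0" "card (UNIV :: 'a set) = q ^ n"
  shows "(0 :: 'a) \<in> gf (q ^ d)" "(1 :: 'a) \<in> gf (q ^ d)"
    and "x \<in> gf (q ^ d) \<Longrightarrow> y \<in> gf (q ^ d) \<Longrightarrow> x + y \<in> gf (q ^ d)"
    and "x \<in> gf (q ^ d) \<Longrightarrow> y \<in> gf (q ^ d) \<Longrightarrow> x * y \<in> gf (q ^ d)"
    and "x \<in> gf (q ^ d) \<Longrightarrow> - x \<in> gf (q ^ d)"
    and "x \<in> gf (q ^ d) \<Longrightarrow> inverse x \<in> gf (q ^ d)"
proof -
  have pc: "prime CHAR('a)"
    by (simp add: CHAR_pos prime_CHAR_semidom)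
  have "CHAR('a) dvd p ^ (e * n)"
    using CHAR_dvd_CARD[where 'a = 'a] assms by (simp add: power_mult)
  then have cp: "CHAR('a) = p"
    using pc assms(1) prime_dvd_power primes_dvd_imp_eq by blast
  have Q: "q ^ d = CHAR('a) ^ (e * d)"
    using assms(2) cp by (simp add: power_mult)
  have add: "(x + y) ^ (q ^ d) = x ^ (q ^ d) + y ^ (q ^ d)" for x y :: 'a
    by (rule freshmans_dream'[OF pc Q])
  have q0: "q ^ d > 0"
    using assms prime_gt_0_nat by simp
  show "(0 :: 'a) \<in> gf (q ^ d)" "(1 :: 'a) \<in> gf (q ^ d)"
    using q0 by (auto simp: gf_def zero_power)
  show "x \<in> gf (q ^ d) \<Longrightarrow> y \<in> gf (q ^ d) \<Longrightarrow> x + y \<in> gf (q ^ d)"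
    by (simp add: gf_def add)
  show "x \<in> gf (q ^ d) \<Longrightarrow> y \<in> gf (q ^ d) \<Longrightarrow> x * y \<in> gf (q ^ d)"
    by (simp add: gf_def power_mult_distrib)
  show "- x \<in> gf (q ^ d)" if "x \<in> gf (q ^ d)"
  proof -
    have "x ^ (q ^ d) + (- x) ^ (q ^ d) = 0"
      using add[of x "- x"] q0 by (simp add: zero_power)
    then show ?thesis
      using that by (simp add: gf_def eq_neg_iff_add_eq_0 add.commute)
  qed
  show "x \<in> gf (q ^ d) \<Longrightarrow> inverse x \<in> gf (q ^ d)"
    by (simp add: gf_def power_inverse)
qed

lemma card_gf:
  assumes "q > 1" "card (UNIV :: 'a :: finite_field set) = q ^ n" "d > 0" "d dvd n"
  shows "card (gf (q ^ d) :: 'a set) = q ^ d"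
proof -
  define Q where "Q = q ^ d"
  obtain s where s: "n = d * s"
    using assms(4) by blast
  have card1: "card (UNIV :: 'a set) > 1"
    using card_mono[of UNIV "{0, 1 :: 'a}"] by simp
  have "s > 0"
    using card1 assms(2) s by (cases s) auto
  have Q1: "Q > 1"
    unfolding Q_def using assms(1,3) by (rule one_less_power)
  have N: "card (UNIV :: 'a set) = Q ^ s"
    using assms(2) s by (simp add: Q_def power_mult)
  define m where "m = (\<Sum>i<s. Q ^ i)"
  have m: "Q ^ s - 1 = (Q - 1) * m"
  proof -
    have "int (Q ^ s) - 1 = (int Q - 1) * int m"
      unfolding m_def using power_diff_1_eq[of "int Q" s] by simp
    then have "int (Q ^ s - 1) = int ((Q - 1) * m)"
      using Q1 by (simp add: of_nat_diff)
    then show ?thesis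
      using of_nat_eq_iff by blast
  qed
  have m0: "m > 0"
    unfolding m_def using \<open>s > 0\<close> Q1 by (intro sum_pos) auto
  define f :: "'a poly" where "f = monom 1 (Q - 1) - 1"
  define g :: "'a poly" where "g = (\<Sum>i<m. monom 1 ((Q - 1) * i))"
  have pf: "poly f x = x ^ (Q - 1) - 1" for x
    by (simp add: f_def poly_monom)
  have pg: "poly g x = (\<Sum>i<m. (x ^ (Q - 1)) ^ i)" for x
    by (simp add: g_def poly_sum poly_monom power_mult)
  have "f \<noteq> 0"
    using pf[of 0] Q1 by (auto simp: zero_power)
  have "poly g 0 = 1"
    unfolding pg using m0 Q1 by (subst sum.remove[of _ 0]) (auto simp: zero_power)
  then have "g \<noteq> 0"
    by auto
  have df: "degree f \<le> Q - 1"
    unfolding f_def by (intro degree_diff_le) (auto simp: degree_monom_le)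
  have dg: "degree g \<le> (Q - 1) * (m - 1)"
    unfolding g_def
  proof (intro degree_sum_le)
    fix i assume "i \<in> {..<m}"
    then have "(Q - 1) * i \<le> (Q - 1) * (m - 1)"
      by (intro mult_left_mono) auto
    then show "degree (monom (1 :: 'a) ((Q - 1) * i)) \<le> (Q - 1) * (m - 1)"
      using degree_monom_le order_trans by blast
  qed auto
  define A where "A = {x. poly f x = 0}"
  define B where "B = {x. poly g x = 0}"
  have "UNIV - {0} \<subseteq> A \<union> B"
  proof
    fix x :: 'a assume "x \<in> UNIV - {0}"
    then have "x \<noteq> 0" by simp
    moreover have "x * x ^ (Q ^ s - 1) = x"
      using finite_field_power_card_eq_same[of x] N Q1
      by (metis One_nat_def power_Suc Suc_pred zero_less_power less_trans zero_less_one)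
    ultimately have "x ^ (Q ^ s - 1) = 1"
      by simp
    then have "(x ^ (Q - 1)) ^ m - 1 = 0"
      using m by (simp add: power_mult)
    then have "poly f x * poly g x = 0"
      unfolding pf pg by (simp add: power_diff_1_eq)
    then show "x \<in> A \<union> B"
      by (auto simp: A_def B_def)
  qed
  then have "card (UNIV - {0 :: 'a}) \<le> card (A \<union> B)"
    by (intro card_mono) auto
  also have "\<dots> \<le> card A + card B"
    by (rule card_Un_le)
  finally have le: "Q ^ s - 1 \<le> card A + card B"
    using N by (simp add: card_Diff_singleton)
  have "card A \<le> Q - 1" "card B \<le> (Q - 1) * (m - 1)"
    using card_poly_roots_bound[OF \<open>f \<noteq> 0\<close>] card_poly_roots_bound[OF \<open>g \<noteq> 0\<close>] df dg
    by (auto simp: A_def B_def)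
  moreover have "(Q - 1) * m = (Q - 1) + (Q - 1) * (m - 1)"
    using m0 by (cases m) auto
  ultimately have cA: "card A = Q - 1"
    using le m by linarith
  have "x ^ Q = x \<longleftrightarrow> x = 0 \<or> x ^ (Q - 1) = 1" for x :: 'a
  proof -
    have "x ^ Q = x * x ^ (Q - 1)"
      using Q1 by (metis power_Suc Suc_pred' less_trans zero_less_one)
    then show ?thesis by auto
  qed
  then have "gf Q = insert 0 A"
    by (auto simp: gf_def A_def pf)
  moreover have "0 \<notin> A"
    using Q1 by (simp add: A_def pf zero_power)
  ultimately show ?thesis
    using cA Q1 by (simp add: Q_def)
qed

lemma pow_one_cong_lift:
  fixes x :: nat
  assumes "[x = 1] (mod m)" "r dvd m"
  shows "[x ^ r = 1] (mod (r * m))"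
proof -
  have "[int x = int 1] (mod int m)"
    using assms(1) by (simp only: cong_int_iff)
  then have m: "int m dvd int x - 1"
    by (simp only: cong_iff_dvd_diff of_nat_1)
  have "int r dvd int m"
    using assms(2) by (simp only: of_nat_dvd_iff)
  then have "[int x = 1] (mod int r)"
    using m dvd_trans unfolding cong_iff_dvd_diff by blast
  then have "[(\<Sum>i<r. int x ^ i) = (\<Sum>i<r. 1 ^ i)] (mod int r)"
    by (intro cong_sum cong_pow)
  then have "[(\<Sum>i<r. int x ^ i) = int r] (mod int r)"
    by (simp only: power_one sum_constant card_lessThan mult_1_right)
  then have "int r dvd (\<Sum>i<r. int x ^ i)"
    using cong_dvd_iff dvd_refl by blast
  with m have "int m * int r dvd (int x - 1) * (\<Sum>i<r. int x ^ i)"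
    by (rule mult_dvd_mono)
  then have "int (r * m) dvd int (x ^ r) - int 1"
    by (simp only: power_diff_1_eq of_nat_mult of_nat_power of_nat_1 mult.commute)
  then have "[int (x ^ r) = int 1] (mod int (r * m))"
    by (simp only: cong_iff_dvd_diff)
  then show ?thesis
    by (simp only: cong_int_iff)
qed

lemma ord_eq_ord_rad_times:
  assumes "k > 0" "coprime k q"
  shows "ord k q = ord (rad k) q * (\<Prod>r\<in>prime_factors k. r ^ alpha q k r)"
proof -
  have rad_dvd: "rad k dvd k"
  proof -
    have "rad k dvd (\<Prod>r\<in>prime_factors k. r ^ multiplicity r k)"
      unfolding rad_def
      by (intro prod_dvd_prod) (auto simp: prime_factors_multiplicity)
    then show ?thesis
      using assms(1) by (simp add: prime_factorization_nat[symmetric])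
  qed
  then have dvd: "ord (rad k) q dvd ord k q"
    using ord[of q k] ord_divides[of q "ord k q" "rad k"] cong_dvd_modulus_nat by blast
  define t where "t = ord k q div ord (rad k) q"
  have eq: "ord k q = ord (rad k) q * t"
    using dvd by (simp add: t_def)
  have t0: "t > 0"
    using eq assms(2) by (metis bot_nat_0.not_eq_extremum mult_0_right ord_gt_0_iff)
  have pow: "[q ^ (ord (rad k) q * rad k ^ i) = 1] (mod (rad k ^ Suc i))" for i
  proof (induction i)
    case 0
    show ?case using ord[of q "rad k"] by simp
  next
    case (Suc i)
    from pow_one_cong_lift[OF this, of "rad k"] show ?case
      by (simp add: power_mult[symmetric] mult_ac)
  qed
  have "k dvd rad k ^ Suc k"
  proof -
    have "k = (\<Prod>r\<in>prime_factors k. r ^ multiplicity r k)"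
      using assms(1) by (simp add: prime_factorization_nat[symmetric])
    also have "\<dots> dvd (\<Prod>r\<in>prime_factors k. r ^ Suc k)"
    proof (intro prod_dvd_prod le_imp_power_dvd)
      fix r assume r: "r \<in> prime_factors k"
      have "r ^ multiplicity r k \<le> k"
        using assms(1) by (intro dvd_imp_le multiplicity_dvd)
      moreover have "r > 1"
        using r by (intro prime_gt_1_nat) (simp add: in_prime_factors_iff)
      moreover have "multiplicity r k < r ^ multiplicity r k"
        using \<open>r > 1\<close> by (intro power_gt_expt) simp
      ultimately show "multiplicity r k \<le> Suc k" by linarith
    qed
    also have "\<dots> = rad k ^ Suc k"
      unfolding rad_def by (rule prod_power_distrib[symmetric])
    finally show ?thesis .
  qed
  then have "ord k q dvd ord (rad k) q * rad k ^ k"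
    using pow[of k] cong_dvd_modulus_nat ord_divides by blast
  moreover have "ord (rad k) q > 0"
    using eq assms(2) by (metis bot_nat_0.not_eq_extremum mult_0 ord_gt_0_iff)
  ultimately have "t dvd rad k ^ k"
    using eq by auto
  have sub: "prime_factors t \<subseteq> prime_factors k"
  proof (intro subsetI)
    fix r assume r: "r \<in> prime_factors t"
    then have "prime r" "r dvd rad k ^ k"
      using \<open>t dvd rad k ^ k\<close> dvd_trans by (auto simp: in_prime_factors_iff)
    then have "r dvd k"
      using prime_dvd_power rad_dvd dvd_trans by blast
    then show "r \<in> prime_factors k"
      using \<open>prime r\<close> assms(1) by (simp add: in_prime_factors_iff)
  qed
  have "t = (\<Prod>r\<in>prime_factors t. r ^ multiplicity r t)"
    using t0 by (simp add: prime_factorization_nat[symmetric])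
  also have "\<dots> = (\<Prod>r\<in>prime_factors k. r ^ multiplicity r t)"
  proof (intro prod.mono_neutral_left finite_set_mset sub ballI)
    fix r assume "r \<in> prime_factors k - prime_factors t"
    then show "r ^ multiplicity r t = 1"
      by (auto simp: prime_factors_multiplicity)
  qed
  also have "\<dots> = (\<Prod>r\<in>prime_factors k. r ^ alpha q k r)"
    by (simp only: alpha_def t_def)
  finally have "t = (\<Prod>r\<in>prime_factors k. r ^ alpha q k r)" .
  with eq show ?thesis
    by (rule subst[rotated])
qed

text \<open>
  The divisions in the counting formula are exact.
\<close>
lemma tau_dvd_ord:
  assumes "k > 0" "coprime k q"
  shows "tau q k dvd ord k q"
proof -
  have "tau q k dvd (\<Prod>r\<in>prime_factors k. r ^ alpha q k r)"
    unfolding tau_def by (intro prod_dvd_prod le_imp_power_dvd) simp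
  then show ?thesis
    using ord_eq_ord_rad_times[OF assms] by (metis dvd_mult)
qed

lemma ord_dvd_tau_totient:
  assumes "coprime k q"
  shows "ord k q dvd tau q k * totient k"
  using order_divides_totient[OF assms] by simp

lemma two_ord_dvd_tau_totient:
  assumes "coprime k q" "exceptional q k"
  shows "2 * ord k q dvd tau q k * totient k"
proof -
  obtain c l where cl: "odd l" "k = 2 ^ c * l" "c \<ge> 3" "ord (2 ^ c) q = 2"
    using assms(2) by (auto simp: exceptional_def)
  have cop: "coprime (2 ^ c) l"
    using cl(1) by simp
  have "coprime l q"
    using assms(1) cl(2) by simp
  then have l: "ord l q dvd totient l"
    by (rule order_divides_totient)
  have "[q ^ (2 * ord l q) = 1] (mod 2 ^ c)" "[q ^ (2 * ord l q) = 1] (mod l)"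
    using cl(4) by (simp_all only: ord_divides) simp_all
  then have "[q ^ (2 * ord l q) = 1] (mod k)"
    unfolding cl(2) using cop by (rule coprime_cong_mult_nat)
  then have "ord k q dvd 2 * ord l q"
    by (simp only: ord_divides)
  then have "2 * ord k q dvd 2 * (2 * ord l q)"
    by (rule mult_dvd_mono[OF dvd_refl])
  then have "2 * ord k q dvd 4 * ord l q"
    by simp
  also have "\<dots> dvd 2 ^ (c - 1) * totient l"
  proof (rule mult_dvd_mono[OF _ l])
    show "(4 :: nat) dvd 2 ^ (c - 1)"
      using cl(3) le_imp_power_dvd[of 2 "c - 1" "2 :: nat"] by simp
  qed
  also have "\<dots> = totient k"
    unfolding cl(2) using cop cl(3) by (simp add: totient_mult_coprime totient_prime_power)
  finally show ?thesis
    by simp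
qed

end

theory Submission
  imports "HOL-Algebra.Algebraic_Closure_Type" Defs
begin

text \<open>
  The proof takes place in the algebraic closure \<open>L\<close> of the given field. A polynomial \<open>P\<close> over the
  subfield with \<open>Q\<close> elements acts on \<open>L\<close> by \<open>v \<mapsto> \<Sum> P\<^sub>i v\<^bsup>Q^i\<^esup>\<close>, with a kernel of size
  \<open>Q\<^bsup>deg P\<^esup>\<close> if \<open>P\<^sub>0 \<noteq> 0\<close>, and \<open>v\<close> is normal over that subfield iff no polynomial \<open>(X\<^sup>N - 1) / f\<close>, with
  \<open>f\<close> an irreducible factor, annihilates it. Every polynomial that occurs is, up to a power, the
  product of the linear factors over a Frobenius-stable set of roots of unity, so that divisibility
  and coprimality become inclusion and disjointness.

  Let \<open>f\<close> be an irreducible factor over \<open>F\<^bsub>q^d\<^esub>\<close> whose roots have order \<open>m\<close>, and let \<open>d\<^sub>1\<close> be the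
  part of \<open>d\<close> composed of primes dividing \<open>m\<close>. Regularity forces \<open>f\<close> to be defined and irreducible
  over the subfield of degree \<open>d\<^sub>1\<close>, so its condition follows from normality over that subfield. Hence
  complete normality is a condition on each component of \<open>v\<close> belonging to a divisor \<open>k\<close> of \<open>n'\<close>,
  ranging over the \<open>d\<close> for which every prime divisor of \<open>k\<close> divides \<open>k / d\<close>. Comparing orders prime by
  prime, the condition for \<open>d = \<tau>\<^sub>k\<close> implies all others unless \<open>k\<close> is exceptional. In the exceptional
  case those for \<open>\<tau>\<^sub>k\<close> and \<open>2\<tau>\<^sub>k\<close> suffice; with \<open>x = q\<^bsup>ord(k,q)/\<tau>\<^esup>\<close> they split the component
  into blocks of size \<open>x\<^sup>2\<close>, in each of which four subspaces of size \<open>x\<close> with pairwise trivial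
  intersection are forbidden, leaving \<open>x\<^sup>2 - 4x + 3\<close> elements.
\<close>

section \<open>Linearized polynomials\<close>

text \<open>Over an algebraically closed field \<open>P\<close> splits into linear factors, and a
  factor occurring twice would make its root a zero of the derivative as well.\<close>

lemma card_roots_separable:
  fixes P :: "'l :: alg_closed_field poly"
  assumes "P \<noteq> 0" and sep: "\<And>z. poly P z = 0 \<Longrightarrow> poly (pderiv P) z \<noteq> 0"
  shows "card {z. poly P z = 0} = degree P"
proof -
  obtain A where A: "size A = degree P" "P = smult (lead_coeff P) (\<Prod>x\<in>#A. [:-x, 1:])"
    using alg_closed_imp_factorization[OF assms(1)] by blast
  have roots: "{z. poly P z = 0} = set_mset A"
  proof -
    have "poly P z = lead_coeff P * (\<Prod>x\<in>#A. z - x)" for z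
      by (subst A(2)) (simp add: poly_prod_mset image_mset.compositionality o_def)
    then show ?thesis
      using assms(1) by (auto simp: prod_mset_zero_iff)
  qed
  have "count A z \<le> 1" for z
  proof (rule ccontr)
    assume "\<not> count A z \<le> 1"
    then have c: "count A z \<ge> 2" by simp
    then have "{#z, z#} \<subseteq># A"
      by (auto intro!: mset_subset_eqI)
    then obtain A' where "A = {#z, z#} + A'"
      by (auto simp: subset_mset.le_iff_add)
    moreover define c where "c = lead_coeff P"
    ultimately have "P = smult c ([:-z, 1:] * ([:-z, 1:] * (\<Prod>x\<in>#A'. [:-x, 1:])))"
      using A(2) by (simp del: mult_pCons_left)
    then have R: "P = [:-z, 1:] * ([:-z, 1:] * smult c (\<Prod>x\<in>#A'. [:-x, 1:]))"
      by (simp only: mult_smult_right)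
    have "poly P z = 0 \<and> poly (pderiv P) z = 0"
      by (subst (1 2) R) (simp only: pderiv_mult poly_add poly_mult poly_pCons poly_0, simp)
    then show False using sep by blast
  qed
  then have "A = mset_set (set_mset A)"
    by (intro multiset_eqI) (metis count_mset_set(1,3) finite_set_mset le_neq_implies_less less_one not_in_iff)
  then have "size A = card (set_mset A)"
    by (metis size_mset_set)
  with roots A(1) show ?thesis by simp
qed

definition act :: "nat \<Rightarrow> 'l::field poly \<Rightarrow> 'l \<Rightarrow> 'l" where
  "act Q P v = (\<Sum>i\<le>degree P. coeff P i * v ^ (Q ^ i))"

text \<open>The same map as an ordinary polynomial in the argument, so that root counting and
  separability apply to the kernel of \<open>act Q P\<close>.\<close>

definition linpoly :: "nat \<Rightarrow> 'l::field poly \<Rightarrow> 'l poly" where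
  "linpoly Q P = (\<Sum>i\<le>degree P. monom (coeff P i) (Q ^ i))"

lemma poly_linpoly: "poly (linpoly Q P) v = act Q P v"
  by (simp add: linpoly_def act_def poly_sum poly_monom)

lemma act_upto:
  assumes "degree P \<le> N"
  shows "act Q P v = (\<Sum>i\<le>N. coeff P i * v ^ (Q ^ i))"
  unfolding act_def using assms
  by (intro sum.mono_neutral_left) (auto simp: coeff_eq_0)

lemma act_0 [simp]: "act Q 0 v = 0"
  by (simp add: act_def)

lemma act_1 [simp]: "act Q 1 v = v"
  by (simp add: act_def)

lemma act_pCons [simp]: "act Q (pCons a P) v = a * v + act Q P (v ^ Q)"
proof -
  have "act Q (pCons a P) v = (\<Sum>i\<le>Suc (degree P). coeff (pCons a P) i * v ^ (Q ^ i))"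
    by (rule act_upto) (rule degree_pCons_le)
  also have "\<dots> = a * v + (\<Sum>i\<le>degree P. coeff P i * (v ^ Q) ^ (Q ^ i))"
    by (subst sum.atMost_Suc_shift) (simp add: power_mult)
  finally show ?thesis by (simp add: act_def)
qed

lemma act_add: "act Q (P + R) v = act Q P v + act Q R v"
proof -
  let ?N = "max (degree P) (degree R)"
  have "degree (P + R) \<le> ?N" by (simp add: degree_add_le_max)
  then show ?thesis
    by (simp add: act_upto[of _ ?N] sum.distrib distrib_right)
qed

lemma act_smult: "act Q (smult c P) v = c * act Q P v"
  by (simp add: act_upto[of "smult c P" "degree P"] degree_smult_le act_def sum_distrib_left mult.assoc)

lemma act_uminus: "act Q (- P) v = - act Q P v"
  using act_smult[of Q "-1" P v] by simp

lemma act_diff: "act Q (P - R) v = act Q P v - act Q R v"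
  using act_add[of Q P "-R" v] by (simp add: act_uminus)

lemma act_monom_mult: "act Q (monom 1 e * R) v = act Q R (v ^ (Q ^ e))"
  by (induction e arbitrary: v) (simp_all add: monom_Suc power_mult)

text \<open>Replacing \<open>X\<close> by its \<open>e\<close>-th power means using the
  \<open>e\<close>-fold iterate of Frobenius. This is what relates conditions over different
  subfields.\<close>

lemma act_pcompose_monom: "act Q (pcompose P (monom 1 e)) v = act (Q ^ e) P v"
  by (induction P arbitrary: v) (simp_all add: pcompose_pCons act_add act_monom_mult)

lemma act_monom: "act Q (monom c e) v = c * v ^ (Q ^ e)"
  by (induction e arbitrary: v) (simp_all add: monom_0 monom_Suc power_mult)

abbreviation frobp :: "nat \<Rightarrow> 'l::field poly \<Rightarrow> 'l poly" where
  "frobp Q \<equiv> map_poly (\<lambda>c. c ^ Q)"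

section \<open>Frobenius in characteristic p and the action of polynomials over a finite
  subfield\<close>

locale char_p =
  fixes p :: nat and ty :: "'l::alg_closed_field itself"
  assumes p: "prime p" and char: "CHAR('l) = p"
begin

definition pw :: "nat \<Rightarrow> bool" where "pw Q \<longleftrightarrow> (\<exists>e>0. Q = p ^ e)"

lemma pw_gt1: "pw Q \<Longrightarrow> Q > 1"
  unfolding pw_def using prime_gt_1_nat[OF p] by (metis one_less_power)

lemma pw_gt0: "pw Q \<Longrightarrow> Q > 0"
  using pw_gt1 by fastforce

lemma pw_power: "pw Q \<Longrightarrow> d > 0 \<Longrightarrow> pw (Q ^ d)"
  unfolding pw_def by (metis nat_0_less_mult_iff power_mult)

lemma pw_coprime: "pw Q \<Longrightarrow> \<not> p dvd m \<Longrightarrow> coprime m Q"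
  unfolding pw_def using p by (metis coprime_commute coprime_power_right_iff prime_imp_coprime)

lemma add_pw: "pw Q \<Longrightarrow> (x + y :: 'l) ^ Q = x ^ Q + y ^ Q"
  unfolding pw_def using freshmans_dream'[where 'a='l] p char by blast

lemma zero_pw: "pw Q \<Longrightarrow> (0 :: 'l) ^ Q = 0"
  using pw_gt0 by (simp add: zero_power)

lemma uminus_pw: "pw Q \<Longrightarrow> (- x :: 'l) ^ Q = - (x ^ Q)"
  by (metis add_pw add.right_inverse add_eq_0_iff zero_pw)

lemma diff_pw: "pw Q \<Longrightarrow> (x - y :: 'l) ^ Q = x ^ Q - y ^ Q"
  using add_pw[of Q x "-y"] uminus_pw[of Q y] by simp

lemma sum_pw: "pw Q \<Longrightarrow> (\<Sum>i\<in>I. f i :: 'l) ^ Q = (\<Sum>i\<in>I. f i ^ Q)"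
  unfolding pw_def using freshmans_dream_sum'[where 'a='l] p char by blast

lemma inj_pw: "pw Q \<Longrightarrow> (x :: 'l) ^ Q = y ^ Q \<longleftrightarrow> x = y"
  using diff_pw[of Q x y] pw_gt0[of Q] by (metis eq_iff_diff_eq_0 power_eq_0_iff)

lemma act_plus: "pw Q \<Longrightarrow> act Q P (u + v :: 'l) = act Q P u + act Q P v"
  by (induction P arbitrary: u v) (simp_all add: algebra_simps add_pw)

lemma act_zero: "pw Q \<Longrightarrow> act Q P (0 :: 'l) = 0"
  by (induction P) (simp_all add: zero_pw)

lemma act_neg: "pw Q \<Longrightarrow> act Q P (- v :: 'l) = - act Q P v"
  by (metis act_plus act_zero add.right_inverse add_eq_0_iff)

lemma act_minus: "pw Q \<Longrightarrow> act Q P (u - v :: 'l) = act Q P u - act Q P v"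
  using act_plus[of Q P u "-v"] act_neg[of Q P v] by simp

lemma frobp_add: "pw Q \<Longrightarrow> frobp Q (P + R :: 'l poly) = frobp Q P + frobp Q R"
  by (intro poly_eqI) (simp add: coeff_map_poly zero_pw add_pw)

lemma frobp_diff: "pw Q \<Longrightarrow> frobp Q (P - R :: 'l poly) = frobp Q P - frobp Q R"
  by (intro poly_eqI) (simp add: coeff_map_poly zero_pw diff_pw)

lemma frobp_mult: "pw Q \<Longrightarrow> frobp Q (P * R :: 'l poly) = frobp Q P * frobp Q R"
  by (intro poly_eqI) (simp add: coeff_map_poly zero_pw coeff_mult sum_pw power_mult_distrib)

lemma frobp_power: "pw Q \<Longrightarrow> frobp Q (P ^ n :: 'l poly) = frobp Q P ^ n"
  by (induction n) (simp_all add: frobp_mult map_poly_1')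

lemma degree_frobp: "pw Q \<Longrightarrow> degree (frobp Q P :: 'l poly) = degree P"
  using pw_gt0 by (intro degree_map_poly) auto

text \<open>Raising all coefficients to the power \<open>Q\<close> turns the division of
  \<open>P\<close> by \<open>D\<close> into another division with remainder of the same polynomials,
  so uniqueness applies. Division therefore stays over the field with \<open>Q\<close>
  elements.\<close>

lemma frobp_mod:
  assumes "pw Q" "frobp Q P = P" "frobp Q D = (D :: 'l poly)"
  shows "frobp Q (P mod D) = P mod D" "frobp Q (P div D) = P div D"
proof -
  let ?A = "frobp Q (P div D)" and ?R = "frobp Q (P mod D)"
  have eq: "P = ?A * D + ?R"
    by (metis assms div_mult_mod_eq frobp_add frobp_mult)
  have R: "?R mod D = ?R"
  proof (cases "D = 0 \<or> P mod D = 0")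
    case False
    then have "degree ?R < degree D"
      using degree_mod_less[of D P] degree_frobp[OF assms(1)] by metis
    then show ?thesis by (rule mod_poly_less)
  qed auto
  have "P mod D = ?R mod D"
    by (subst eq) (rule mod_mult_self3)
  with R show mod: "frobp Q (P mod D) = P mod D" by simp
  show "frobp Q (P div D) = P div D"
  proof (cases "D = 0")
    case False
    have "?A * D = P div D * D"
      using eq mod by (metis add_right_cancel div_mult_mod_eq)
    with False show ?thesis by simp
  qed simp
qed

lemma frobp_iff: "pw Q \<Longrightarrow> frobp Q P = (P :: 'l poly) \<longleftrightarrow> (\<forall>i. coeff P i ^ Q = coeff P i)"
  by (simp add: poly_eq_iff coeff_map_poly zero_pw)

lemma frobp_fixed_power: "pw Q \<Longrightarrow> e > 0 \<Longrightarrow> frobp Q P = (P :: 'l poly) \<Longrightarrow> frobp (Q ^ e) P = P"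
proof -
  assume Q: "pw Q" "e > 0" "frobp Q P = P"
  have "x ^ (Q ^ e) = x" if "x ^ Q = x" for x :: 'l
    by (induction e) (simp_all add: that power_mult)
  then show ?thesis using Q frobp_iff pw_power by blast
qed

lemma act_pow: "pw Q \<Longrightarrow> frobp Q P = (P :: 'l poly) \<Longrightarrow> act Q P v ^ Q = act Q P (v ^ Q)"
  unfolding act_def frobp_iff
  by (simp add: sum_pw power_mult_distrib) (simp add: power_mult[symmetric] mult.commute)

text \<open>Coefficients of \<open>P\<close> are pulled out on the left; only \<open>X\<close>,
  acting as the \<open>Q\<close>-th power, has to be moved past \<open>R\<close>, and this works
  because \<open>R\<close> has coefficients in the field with \<open>Q\<close> elements.\<close>

lemma act_mult:
  assumes "pw Q" "frobp Q R = (R :: 'l poly)"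
  shows "act Q (P * R) v = act Q P (act Q R v)"
proof (induction P arbitrary: v)
  case (pCons a P)
  have "act Q (pCons a P * R) v = a * act Q R v + act Q (P * R) (v ^ Q)"
    by (simp add: act_add act_smult)
  also have "act Q (P * R) (v ^ Q) = act Q P ((act Q R v) ^ Q)"
    using pCons.IH act_pow[OF assms] by simp
  finally show ?case by simp
qed (use assms in simp)

lemma act_commute:
  assumes "pw Q" "frobp Q P = P" "frobp Q R = (R :: 'l poly)"
  shows "act Q P (act Q R v) = act Q R (act Q P v)"
  using assms act_mult by (metis mult.commute)

definition ker :: "nat \<Rightarrow> 'l poly \<Rightarrow> 'l set" where "ker Q P = {v. act Q P v = 0}"

lemma degree_linpoly:
  assumes "pw Q"
  shows "degree (linpoly Q (P :: 'l poly)) \<le> Q ^ degree P" "coeff (linpoly Q P) (Q ^ degree P) = lead_coeff P"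
    "pderiv (linpoly Q P) = [:coeff P 0:]"
proof -
  have Q1: "Q > 1" using assms by (rule pw_gt1)
  show "degree (linpoly Q P) \<le> Q ^ degree P"
    unfolding linpoly_def
  proof (intro degree_sum_le)
    fix i assume "i \<in> {..degree P}"
    then have "Q ^ i \<le> Q ^ degree P" using Q1 by simp
    then show "degree (monom (coeff P i) (Q ^ i)) \<le> Q ^ degree P"
      using degree_monom_le order_trans by blast
  qed simp
  show "coeff (linpoly Q P) (Q ^ degree P) = lead_coeff P"
    using Q1 by (simp add: linpoly_def coeff_sum if_distrib cong: if_cong)
  \<comment> \<open>In characteristic \<open>p\<close> every exponent \<open>Q ^ i\<close> with
    \<open>i > 0\<close> vanishes, so only the linear term contributes to the derivative.\<close>
  have "of_nat (Q ^ i) = (if i = 0 then 1 else 0 :: 'l)" for i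
    using assms char unfolding pw_def by (auto simp: of_nat_eq_0_iff_char_dvd simp del: of_nat_power simp flip: power_mult intro!: dvd_power)
  then have "pderiv (monom (coeff P i) (Q ^ i)) = (if i = 0 then [:coeff P 0:] else 0)" for i
    by (simp add: pderiv_monom monom_0)
  then show "pderiv (linpoly Q P) = [:coeff P 0:]"
    by (simp add: linpoly_def higher_pderiv_sum[of 1, simplified] )
qed

text \<open>The derivative of \<open>linpoly Q P\<close> is the nonzero constant
  \<open>coeff P 0\<close>, hence all roots are simple and their number is the degree.\<close>

lemma card_ker:
  assumes "pw Q" "coeff P 0 \<noteq> 0"
  shows "finite (ker Q P)" "card (ker Q P) = Q ^ degree P"
proof -
  have "P \<noteq> 0" using assms by auto
  have ne: "linpoly Q P \<noteq> 0"
    using degree_linpoly(2)[OF assms(1), of P] \<open>P \<noteq> 0\<close> by auto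
  have deg: "degree (linpoly Q P) = Q ^ degree P"
    using degree_linpoly[OF assms(1), of P] \<open>P \<noteq> 0\<close> by (simp add: le_degree order_antisym)
  have eq: "ker Q P = {v. poly (linpoly Q P) v = 0}"
    by (simp add: ker_def poly_linpoly)
  show "finite (ker Q P)" unfolding eq by (rule poly_roots_finite[OF ne])
  show "card (ker Q P) = Q ^ degree P"
    unfolding eq deg[symmetric] using ne assms(2)
    by (intro card_roots_separable) (simp_all add: degree_linpoly[OF assms(1)])
qed

lemma act_surj:
  assumes "pw Q" "P \<noteq> (0 :: 'l poly)"
  shows "\<exists>v. act Q P v = (w :: 'l)"
proof -
  \<comment> \<open>Subtracting \<open>w\<close> changes only the constant coefficient, and
    \<open>Q ^ degree P\<close> is positive; so the difference is not constant and has a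
    root.\<close>
  have "coeff (linpoly Q P - [:w:]) (Q ^ degree P) = lead_coeff P"
    using degree_linpoly(2)[OF assms(1), of P] pw_gt0[OF assms(1)] by (simp add: coeff_pCons split: nat.split)
  then have "Q ^ degree P \<le> degree (linpoly Q P - [:w:])"
    using assms(2) by (intro le_degree) simp
  then have "degree (linpoly Q P - [:w:]) > 0"
    using pw_gt0[OF assms(1)] by (metis gr0I le_zero_eq power_not_zero not_gr_zero)
  then obtain v where "poly (linpoly Q P - [:w:]) v = 0"
    using alg_closed_imp_poly_has_root by blast
  then show ?thesis by (auto simp: poly_linpoly)
qed

text \<open>By surjectivity every fibre of \<open>act Q P\<close> is a coset of its kernel. This
  later accounts for the factors \<open>q ^ ((p ^ a - 1) * totient k)\<close>.\<close>

lemma card_act_vimage: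
  assumes "pw Q" "coeff P 0 \<noteq> 0" "finite C"
  shows "card {v. act Q P v \<in> (C :: 'l set)} = card C * Q ^ degree P"
proof -
  have P0: "P \<noteq> (0 :: 'l poly)" using assms by auto
  have fib: "finite {v. act Q P v = w} \<and> card {v. act Q P v = w} = Q ^ degree P" for w
  proof -
    obtain u where u: "act Q P u = w" using act_surj[OF assms(1) P0] by blast
    have "{v. act Q P v = w} = (\<lambda>x. x + u) ` ker Q P"
    proof (intro equalityI subsetI)
      fix v assume "v \<in> {v. act Q P v = w}"
      then have "v - u \<in> ker Q P" using u by (simp add: ker_def act_minus[OF assms(1)])
      then show "v \<in> (\<lambda>x. x + u) ` ker Q P" by (metis diff_add_cancel imageI)
    qed (use u in \<open>auto simp: ker_def act_plus[OF assms(1)]\<close>)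
    moreover have "inj_on (\<lambda>x. x + u) (ker Q P)" by simp
    ultimately show ?thesis using card_ker[OF assms(1,2)] by (simp add: card_image)
  qed
  have "{v. act Q P v \<in> C} = (\<Union>w\<in>C. {v. act Q P v = w})" by auto
  also have "card \<dots> = (\<Sum>w\<in>C. card {v. act Q P v = w})"
    using fib assms(3) by (intro card_UN_disjoint) auto
  finally show ?thesis using fib by simp
qed

text \<open>Division with remainder stays over the field with \<open>Q\<close> elements, so a
  nonzero annihilator of least degree divides every other annihilator.\<close>

lemma annihilator_principal:
  assumes Q: "pw Q" and "frobp Q P0 = P0" "P0 \<noteq> 0" "act Q P0 v = (0 :: 'l)"
  obtains g where "frobp Q g = g" "g \<noteq> 0" "act Q g v = 0"
    "\<And>P. frobp Q P = P \<Longrightarrow> act Q P v = 0 \<Longrightarrow> g dvd P"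
proof -
  define S where "S = (\<lambda>g. frobp Q g = g \<and> g \<noteq> 0 \<and> act Q g v = 0)"
  have "S P0" using assms by (simp add: S_def)
  then obtain g where g: "S g" "\<And>h. S h \<Longrightarrow> degree g \<le> degree h"
    using exists_least_iff[of "\<lambda>n. \<exists>h. S h \<and> degree h = n"] by (metis linorder_not_less)
  show thesis
  proof (rule that)
    fix P assume P: "frobp Q P = P" "act Q P v = 0"
    have fg: "frobp Q g = g" "g \<noteq> 0" "act Q g v = 0" using g(1) by (auto simp: S_def)
    have "P mod g = P - (P div g) * g" by (simp add: minus_div_mult_eq_mod)
    then have "act Q (P mod g) v = 0"
      using P(2) fg act_mult[OF Q fg(1)] act_zero[OF Q] by (simp add: act_diff)
    moreover have "frobp Q (P mod g) = P mod g" using frobp_mod(1)[OF Q P(1) fg(1)] .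
    ultimately have "P mod g \<noteq> 0 \<Longrightarrow> degree g \<le> degree (P mod g)"
      using g(2) by (simp add: S_def)
    then have "P mod g = 0" using degree_mod_less[OF fg(2), of P] by linarith
    then show "g dvd P" by auto
  qed (use g(1) in \<open>auto simp: S_def\<close>)
qed

text \<open>The generator of the annihilator of \<open>v\<close> divides both polynomials, so it has
  no root and is a nonzero constant; a nonzero constant kills only 0.\<close>

lemma act_coprime_zero:
  assumes Q: "pw Q" and "frobp Q P = P" "frobp Q R = R" "P \<noteq> 0"
    and no: "\<And>z. poly P z = 0 \<Longrightarrow> poly R z \<noteq> 0"
    and "act Q P v = 0" "act Q R v = (0 :: 'l)"
  shows "v = 0"
proof -
  obtain g where g: "frobp Q g = g" "g \<noteq> 0" "act Q g v = 0"
    "\<And>P. frobp Q P = P \<Longrightarrow> act Q P v = 0 \<Longrightarrow> g dvd P"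
    using annihilator_principal[OF Q assms(2,4,6)] by metis
  then have "g dvd P" "g dvd R" using assms by auto
  then have "poly g z \<noteq> 0" for z using no by (metis dvd_trans poly_eq_0_iff_dvd)
  then have "degree g = 0" using alg_closed_imp_poly_has_root by blast
  then obtain c where "g = [:c:]" by (elim degree_eq_zeroE)
  with g(2,3) show ?thesis by auto
qed

end

section \<open>Stable sets of roots\<close>

definition PP :: "'l::field set \<Rightarrow> 'l poly" where
  "PP A = (\<Prod>a\<in>A. [:-a, 1:])"

lemma PP_empty [simp]: "PP {} = 1"
  by (simp add: PP_def)

lemma poly_PP_eq_0_iff: "finite A \<Longrightarrow> poly (PP A) z = 0 \<longleftrightarrow> z \<in> A"
  by (simp add: PP_def poly_prod)

lemma PP_nonzero: "PP A \<noteq> 0"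
  by (cases "finite A") (simp_all add: PP_def)

lemma degree_PP: "finite A \<Longrightarrow> degree (PP A) = card A"
  unfolding PP_def by (subst degree_prod_eq_sum_degree) auto

lemma lead_coeff_PP: "lead_coeff (PP A) = 1"
  by (simp add: PP_def lead_coeff_prod)

lemma coeff_PP_0: "finite A \<Longrightarrow> 0 \<notin> A \<Longrightarrow> coeff (PP A) 0 \<noteq> 0"
  using poly_PP_eq_0_iff[of A 0] by (simp add: poly_0_coeff_0)

lemma PP_diff: "finite A \<Longrightarrow> B \<subseteq> A \<Longrightarrow> PP A = PP (A - B) * PP B"
  by (simp add: PP_def prod.subset_diff)

lemma PP_dvd:
  assumes "finite A" "\<And>a. a \<in> A \<Longrightarrow> poly P a = 0"
  shows "PP A dvd P"
  using assms
proof (induction A arbitrary: P)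
  case (insert a A)
  then have "poly P a = 0" by simp
  then obtain R where R: "P = [:-a, 1:] * R" using poly_eq_0_iff_dvd by (metis dvdE)
  have "poly R b = 0" if "b \<in> A" for b
  proof -
    have "poly P b = 0" "b \<noteq> a" using insert that by auto
    then show ?thesis by (simp add: R)
  qed
  then have "PP A dvd R" by (rule insert.IH)
  then have "[:-a, 1:] * PP A dvd P" unfolding R by (rule mult_dvd_mono[OF dvd_refl])
  then show ?case using insert.hyps by (simp add: PP_def)
qed simp

lemma PP_unique:
  assumes "finite A" "\<And>a. a \<in> A \<Longrightarrow> poly P a = 0" "lead_coeff P = 1" "degree P = card A"
  shows "P = PP A"
proof -
  obtain R where R: "P = PP A * R" using PP_dvd[OF assms(1,2)] by (auto elim: dvdE)
  have "P \<noteq> 0" using assms(3) by auto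
  with R have "R \<noteq> 0" by auto
  then have "degree P = degree (PP A) + degree R"
    unfolding R using PP_nonzero by (intro degree_mult_eq) auto
  then have "degree R = 0" using assms(4) degree_PP[OF assms(1)] by simp
  then obtain c where c: "R = [:c:]" by (elim degree_eq_zeroE)
  have "lead_coeff P = lead_coeff (PP A) * lead_coeff R" unfolding R by (rule lead_coeff_mult)
  then have "c = 1" using assms(3) c by (simp add: lead_coeff_PP)
  with R c show ?thesis by simp
qed

context char_p
begin

text \<open>Excluding 0 makes the constant coefficient of \<open>PP A\<close> nonzero, which is what
  \<open>card_ker\<close> asks for. Closure under the \<open>Q\<close>-th power puts the
  coefficients of \<open>PP A\<close> into the field with \<open>Q\<close> elements.\<close>

definition stable :: "nat \<Rightarrow> 'l set \<Rightarrow> bool" where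
  "stable Q A \<longleftrightarrow> finite A \<and> 0 \<notin> A \<and> (\<forall>a\<in>A. a ^ Q \<in> A)"

lemma stable_image: "pw Q \<Longrightarrow> stable Q A \<Longrightarrow> (\<lambda>x. x ^ Q) ` A = A"
  unfolding stable_def by (intro endo_inj_surj) (auto simp: inj_on_def inj_pw)

lemma stable_iff: "pw Q \<Longrightarrow> stable Q A \<Longrightarrow> a ^ Q \<in> A \<longleftrightarrow> a \<in> A"
proof
  assume Q: "pw Q" "stable Q A" and "a ^ Q \<in> A"
  then have "a ^ Q \<in> (\<lambda>x. x ^ Q) ` A" using stable_image by simp
  then show "a \<in> A" using inj_pw[OF Q(1)] by auto
qed (simp add: stable_def)

lemma stable_finite: "stable Q A \<Longrightarrow> finite A"
  by (simp add: stable_def)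

lemma stable_Diff: "pw Q \<Longrightarrow> stable Q A \<Longrightarrow> stable Q B \<Longrightarrow> stable Q (A - B)"
  using stable_iff[of Q B] by (auto simp: stable_def)

lemma stable_Un: "stable Q A \<Longrightarrow> stable Q B \<Longrightarrow> stable Q (A \<union> B)"
  by (auto simp: stable_def)

lemma stable_Int: "stable Q A \<Longrightarrow> stable Q B \<Longrightarrow> stable Q (A \<inter> B)"
  by (auto simp: stable_def)

lemma stable_UN: "finite I \<Longrightarrow> (\<And>i. i \<in> I \<Longrightarrow> stable Q (B i)) \<Longrightarrow> stable Q (\<Union>i\<in>I. B i)"
  unfolding stable_def by blast

lemma stable_power: "stable Q A \<Longrightarrow> stable (Q ^ e) A"
proof -
  assume A: "stable Q A"
  have "a ^ (Q ^ e) \<in> A" if "a \<in> A" for a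
    by (induction e) (use A that in \<open>simp_all add: power_mult mult.commute[of Q] stable_def\<close>)
  with A show ?thesis by (simp add: stable_def)
qed

text \<open>Each root moves to its \<open>Q\<close>-th power. The set need not be stable: in the
  exceptional case Frobenius interchanges two root sets that are only stable under
  \<open>Q\<^sup>2\<close>.\<close>

lemma frobp_PP_image:
  assumes "pw Q" "finite (A :: 'l set)"
  shows "frobp Q (PP A) = PP ((\<lambda>x. x ^ Q) ` A)"
proof -
  have "frobp Q (PP A) = (\<Prod>a\<in>A. frobp Q [:-a, 1:])"
    using assms(2) by (induction A) (simp_all add: PP_def frobp_mult[OF assms(1)] map_poly_1' del: mult_pCons_left)
  also have "\<dots> = PP ((\<lambda>x. x ^ Q) ` A)"
    unfolding PP_def using assms(1)
    by (subst prod.reindex) (auto simp: inj_on_def inj_pw map_poly_pCons uminus_pw zero_pw)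
  finally show ?thesis .
qed

lemma frobp_PP: "pw Q \<Longrightarrow> stable Q A \<Longrightarrow> frobp Q (PP A) = PP A"
  by (simp add: frobp_PP_image stable_finite stable_image)

section \<open>Kernels attached to root sets and the Chinese remainder theorem\<close>

definition K :: "nat \<Rightarrow> 'l set \<Rightarrow> 'l set" where "K Q A = {v. act Q (PP A) v = 0}"

lemma card_K:
  assumes "pw Q" "stable Q A"
  shows "finite (K Q A)" "card (K Q A) = Q ^ card A"
  using card_ker[OF assms(1), of "PP A"] assms(2) coeff_PP_0 degree_PP
  unfolding stable_def K_def ker_def by metis+

lemma K_empty: "K Q {} = {0}"
  by (auto simp: K_def)

lemma zero_in_K: "pw Q \<Longrightarrow> 0 \<in> K Q A"
  by (simp add: K_def act_zero)

lemma K_diff: "pw Q \<Longrightarrow> u \<in> K Q A \<Longrightarrow> v \<in> K Q A \<Longrightarrow> u - v \<in> K Q A"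
  by (simp add: K_def act_minus)

lemma act_PP_split:
  assumes "pw Q" "stable Q A" "stable Q B" "B \<subseteq> A"
  shows "act Q (PP A) v = act Q (PP (A - B)) (act Q (PP B) v)"
  using assms by (subst PP_diff[of A B]) (simp_all add: act_mult frobp_PP stable_finite)

lemma act_PP_split':
  assumes "pw Q" "stable Q A" "stable Q B" "B \<subseteq> A"
  shows "act Q (PP A) v = act Q (PP B) (act Q (PP (A - B)) v)"
  using act_PP_split[OF assms] assms by (simp add: act_commute frobp_PP stable_Diff)

lemma act_PP_split_disjoint:
  assumes "pw Q" "stable Q A" "stable Q B" "A \<inter> B = {}"
  shows "act Q (PP (A \<union> B)) v = act Q (PP A) (act Q (PP B) v)"
proof -
  have "A \<union> B - B = A" using assms(4) by auto
  then show ?thesis using act_PP_split[OF assms(1) stable_Un[OF assms(2,3)] assms(3)] by simp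
qed

lemma K_mono: "pw Q \<Longrightarrow> stable Q A \<Longrightarrow> stable Q B \<Longrightarrow> B \<subseteq> A \<Longrightarrow> K Q B \<subseteq> K Q A"
  by (auto simp: K_def act_zero act_PP_split[of Q A B])

lemma act_in_K: "pw Q \<Longrightarrow> stable Q A \<Longrightarrow> stable Q B \<Longrightarrow> B \<subseteq> A \<Longrightarrow> v \<in> K Q A \<Longrightarrow> act Q (PP (A - B)) v \<in> K Q B"
  by (simp add: K_def flip: act_PP_split')

text \<open>Applying \<open>PP (A \<inter> B)\<close> to a common element leaves a vector killed by
  two polynomials without common roots, hence 0.\<close>

lemma K_Int:
  assumes Q: "pw Q" and A: "stable Q A" and B: "stable Q B"
  shows "K Q A \<inter> K Q B = K Q (A \<inter> B)"
proof (intro equalityI subsetI)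
  fix v assume v: "v \<in> K Q A \<inter> K Q B"
  let ?C = "A \<inter> B"
  have C: "stable Q ?C" using A B by (rule stable_Int)
  have z: "act Q (PP (A - ?C)) (act Q (PP ?C) v) = 0" "act Q (PP (B - ?C)) (act Q (PP ?C) v) = 0"
    using act_PP_split[OF Q A C] act_PP_split[OF Q B C] v by (auto simp: K_def)
  have "act Q (PP ?C) v = 0"
  proof (rule act_coprime_zero[OF Q frobp_PP[OF Q stable_Diff[OF Q A C]] frobp_PP[OF Q stable_Diff[OF Q B C]]
      PP_nonzero _ z])
    show "poly (PP (B - ?C)) x \<noteq> 0" if "poly (PP (A - ?C)) x = 0" for x
      using that stable_finite[OF A] stable_finite[OF B] by (auto simp: poly_PP_eq_0_iff)
  qed
  then show "v \<in> K Q ?C" by (simp add: K_def)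
qed (use K_mono[OF Q A stable_Int[OF A B]] K_mono[OF Q B stable_Int[OF A B]] in auto)

lemma K_INT:
  assumes Q: "pw Q" and A: "stable Q A" and "finite I" and B: "\<And>i. i \<in> I \<Longrightarrow> stable Q (B i)"
    and "v \<in> K Q A" "\<And>i. i \<in> I \<Longrightarrow> v \<in> K Q (A - B i)"
  shows "v \<in> K Q (A - (\<Union>i\<in>I. B i))"
  using assms(3-6)
proof (induction I)
  case (insert i I)
  have "A - (\<Union>j\<in>insert i I. B j) = (A - B i) \<inter> (A - (\<Union>j\<in>I. B j))" by auto
  moreover have "stable Q (A - B i)" "stable Q (A - (\<Union>j\<in>I. B j))"
    using Q A insert by (auto intro!: stable_Diff stable_UN)
  moreover have "v \<in> K Q (A - B i)" "v \<in> K Q (A - (\<Union>j\<in>I. B j))"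
    using insert by auto
  ultimately show ?case by (metis IntI K_Int[OF Q])
qed simp

text \<open>Multiplication by the cofactors \<open>PP (A - B i)\<close> identifies
  \<open>K Q A\<close> with the product of the \<open>K Q (B i)\<close>, so independent conditions
  on the parts multiply their counts. These maps are not idempotent projections, but any isomorphism
  suffices for counting.\<close>

lemma crt_count:
  assumes Q: "pw Q" and I: "finite I" and B: "\<And>i. i \<in> I \<Longrightarrow> stable Q (B i)"
    and disj: "\<And>i j. i \<in> I \<Longrightarrow> j \<in> I \<Longrightarrow> i \<noteq> j \<Longrightarrow> B i \<inter> B j = {}"
    and C: "\<And>i. i \<in> I \<Longrightarrow> C i \<subseteq> K Q (B i)"
  defines "A \<equiv> \<Union>i\<in>I. B i"
  shows "card {w \<in> K Q A. \<forall>i\<in>I. act Q (PP (A - B i)) w \<in> C i} = (\<Prod>i\<in>I. card (C i))"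
proof -
  have A: "stable Q A" unfolding A_def using I B by (rule stable_UN)
  have sub: "B i \<subseteq> A" if "i \<in> I" for i using that by (auto simp: A_def)
  define f where "f w = (\<lambda>i\<in>I. act Q (PP (A - B i)) w)" for w
  have "inj_on f (K Q A)"
  proof (rule inj_onI)
    fix u v assume u: "u \<in> K Q A" "v \<in> K Q A" "f u = f v"
    have "u - v \<in> K Q (A - B i)" if "i \<in> I" for i
      using fun_cong[OF u(3), of i] that by (simp add: f_def K_def act_minus[OF Q])
    then have "u - v \<in> K Q (A - (\<Union>i\<in>I. B i))"
      using B by (intro K_INT[OF Q A I] K_diff[OF Q u(1,2)]) auto
    then show "u = v" by (simp add: A_def K_empty)
  qed
  moreover have "f ` K Q A \<subseteq> (\<Pi>\<^sub>E i\<in>I. K Q (B i))"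
    using act_in_K[OF Q A B sub] by (auto simp: f_def)
  \<comment> \<open>Surjectivity follows from injectivity, because both sides have
    \<open>Q ^ card A\<close> elements.\<close>
  moreover have "card (\<Pi>\<^sub>E i\<in>I. K Q (B i)) = card (K Q A)"
  proof -
    have "card A = (\<Sum>i\<in>I. card (B i))"
      unfolding A_def using I disj stable_finite[OF B] by (intro card_UN_disjoint) auto
    then show ?thesis
      using I Q A B by (simp add: card_PiE card_K power_sum)
  qed
  moreover have fin: "finite (\<Pi>\<^sub>E i\<in>I. K Q (B i))"
    using I Q B by (intro finite_PiE) (auto simp: card_K)
  ultimately have bij: "f ` K Q A = (\<Pi>\<^sub>E i\<in>I. K Q (B i))"
    by (intro card_subset_eq) (simp_all add: card_image)
  let ?S = "{w \<in> K Q A. \<forall>i\<in>I. act Q (PP (A - B i)) w \<in> C i}"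
  have "f ` ?S = (\<Pi>\<^sub>E i\<in>I. C i)"
  proof (intro equalityI subsetI)
    fix g assume g: "g \<in> (\<Pi>\<^sub>E i\<in>I. C i)"
    then have "g \<in> (\<Pi>\<^sub>E i\<in>I. K Q (B i))" using C by (auto simp: PiE_iff)
    then have "g \<in> f ` K Q A" by (simp only: bij)
    then obtain w where w: "g = f w" "w \<in> K Q A" by (rule imageE)
    have "act Q (PP (A - B i)) w \<in> C i" if "i \<in> I" for i
      using g that unfolding w(1) by (auto simp: f_def PiE_iff)
    then show "g \<in> f ` ?S" using w by auto
  qed (auto simp: f_def)
  then have "card ?S = card (\<Pi>\<^sub>E i\<in>I. C i)"
    using \<open>inj_on f (K Q A)\<close> by (metis (no_types, lifting) card_image inj_on_subset mem_Collect_eq subsetI)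
  then show ?thesis using I by (simp add: card_PiE)
qed

section \<open>Preimages of root sets under power maps\<close>

definition pre :: "nat \<Rightarrow> 'l set \<Rightarrow> 'l set" where "pre e A = {z. z ^ e \<in> A}"

lemma of_nat_nonzero: "\<not> p dvd e \<Longrightarrow> (of_nat e :: 'l) \<noteq> 0"
  by (simp add: of_nat_eq_0_iff_char_dvd char)

lemma card_nth_roots:
  assumes "\<not> p dvd e" "(a :: 'l) \<noteq> 0"
  shows "finite {z. z ^ e = a}" "card {z. z ^ e = a} = e"
proof -
  have e: "e > 0" using assms(1) by (cases e) auto
  define P where "P = monom 1 e - [:a:]"
  have P: "poly P z = z ^ e - a" for z by (simp add: P_def poly_monom)
  have deg: "degree P = e"
  proof -
    have "coeff P e = 1" using e by (simp add: P_def coeff_pCons split: nat.split)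
    moreover have "degree P \<le> e" unfolding P_def by (intro degree_diff_le) (auto simp: degree_monom_le)
    ultimately show ?thesis by (metis le_degree order_antisym zero_neq_one)
  qed
  then have "P \<noteq> 0" using e by auto
  have eq: "{z. z ^ e = a} = {z. poly P z = 0}" by (simp add: P)
  show "finite {z. z ^ e = a}" unfolding eq by (rule poly_roots_finite[OF \<open>P \<noteq> 0\<close>])
  have "card {z. poly P z = 0} = degree P"
  proof (rule card_roots_separable[OF \<open>P \<noteq> 0\<close>])
    fix z assume "poly P z = 0"
    then have "z \<noteq> 0" using assms(2) e by (auto simp: P)
    then show "poly (pderiv P) z \<noteq> 0"
      using of_nat_nonzero[OF assms(1)] by (simp add: P_def pderiv_diff pderiv_monom poly_monom pderiv_pCons)
  qed
  then show "card {z. z ^ e = a} = e" by (simp add: eq deg)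
qed

lemma card_pre:
  assumes "\<not> p dvd e" "finite A" "0 \<notin> A"
  shows "finite (pre e A)" "card (pre e A) = e * card A"
proof -
  have eq: "pre e A = (\<Union>a\<in>A. {z. z ^ e = a})" by (auto simp: pre_def)
  have ne: "a \<in> A \<Longrightarrow> a \<noteq> 0" for a using assms(3) by auto
  show "finite (pre e A)" unfolding eq using assms card_nth_roots(1) ne by auto
  have "card (\<Union>a\<in>A. {z. z ^ e = a}) = (\<Sum>a\<in>A. card {z. z ^ e = a})"
    using assms card_nth_roots(1) ne by (intro card_UN_disjoint) auto
  also have "\<dots> = (\<Sum>a\<in>A. e)"
    using card_nth_roots(2)[OF assms(1)] ne by (intro sum.cong) auto
  finally show "card (pre e A) = e * card A" by (simp add: eq)
qed

text \<open>The composed polynomial is monic, vanishes on \<open>pre e A\<close> and has degree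
  \<open>e * card A\<close>, which is the number of elements of \<open>pre e A\<close> since
  \<open>p\<close> does not divide \<open>e\<close>.\<close>

lemma PP_pre:
  assumes "\<not> p dvd e" "finite A" "0 \<notin> A"
  shows "PP (pre e A) = pcompose (PP A) (monom 1 e)"
proof (rule PP_unique[symmetric])
  have e: "e > 0" using assms(1) by (cases e) auto
  show "finite (pre e A)" by (rule card_pre[OF assms])
  show "poly (pcompose (PP A) (monom 1 e)) a = 0" if "a \<in> pre e A" for a
    using that assms(2) by (simp add: pre_def poly_pcompose poly_monom poly_PP_eq_0_iff)
  show "lead_coeff (pcompose (PP A) (monom 1 e)) = 1"
    using e by (subst lead_coeff_comp) (simp_all add: degree_monom_eq lead_coeff_PP)
  show "degree (pcompose (PP A) (monom 1 e)) = card (pre e A)"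
    using assms by (simp add: degree_pcompose degree_monom_eq degree_PP card_pre)
qed

text \<open>Enlarging the ground field by the degree \<open>e\<close> amounts to pulling roots back
  along the \<open>e\<close>-th power map. All transfers between subfields below rest on this
  identity.\<close>

lemma act_pre:
  assumes "\<not> p dvd e" "stable Q' A"
  shows "act Q (PP (pre e A)) v = act (Q ^ e) (PP A) v"
  using assms by (simp add: PP_pre stable_def act_pcompose_monom)

lemma K_pre:
  assumes "\<not> p dvd e" "stable Q' A"
  shows "K Q (pre e A) = K (Q ^ e) A"
  using act_pre[OF assms] by (simp add: K_def)

lemma stable_pre:
  assumes "\<not> p dvd e" "stable Q A"
  shows "stable Q (pre e A)"
proof -
  have e: "e > 0" using assms(1) by (cases e) auto
  have "finite (pre e A)" using card_pre assms by (auto simp: stable_def)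
  moreover have "0 \<notin> pre e A" using assms(2) e by (auto simp: pre_def stable_def zero_power)
  moreover have "z ^ Q \<in> pre e A" if "z \<in> pre e A" for z
  proof -
    have "(z ^ e) ^ Q \<in> A" using that assms(2) by (auto simp: pre_def stable_def)
    then show ?thesis by (simp add: pre_def power_mult[symmetric] mult.commute)
  qed
  ultimately show ?thesis by (simp add: stable_def)
qed

lemma pre_Diff: "pre e (A - B) = pre e A - pre e B"
  by (auto simp: pre_def)

lemma pre_mono: "A \<subseteq> B \<Longrightarrow> pre e A \<subseteq> pre e B"
  by (auto simp: pre_def)

end

section \<open>Roots of unity and Frobenius orbits\<close>

context char_p
begin

definition mu :: "nat \<Rightarrow> 'l set" where "mu m = {z. z ^ m = 1}"

text \<open>The roots of unity of exact order \<open>m\<close>, that is, the roots of the cyclotomic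
  polynomial \<Phi>_m when \<open>p\<close> does not divide \<open>m\<close>.\<close>

definition prim :: "nat \<Rightarrow> 'l set" where
  "prim m = {z. z ^ m = 1 \<and> (\<forall>j. z ^ j = 1 \<longrightarrow> m dvd j)}"

lemma prim_pow_eq_1: "z \<in> prim m \<Longrightarrow> z ^ j = 1 \<longleftrightarrow> m dvd j"
  by (auto simp: prim_def power_mult)

lemma prim_nonzero: "m > 0 \<Longrightarrow> z \<in> prim m \<Longrightarrow> z \<noteq> 0"
  by (auto simp: prim_def zero_power)

lemma prim_pow_cong:
  assumes "m > 0" "z \<in> prim m"
  shows "z ^ i = z ^ j \<longleftrightarrow> [i = j] (mod m)"
proof (induction i j rule: linorder_wlog)
  case (le i j)
  have "z ^ j = z ^ i * z ^ (j - i)" using le by (simp add: power_add[symmetric])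
  then have "z ^ i = z ^ j \<longleftrightarrow> z ^ (j - i) = 1"
    using prim_nonzero[OF assms] by auto
  also have "\<dots> \<longleftrightarrow> m dvd j - i" by (rule prim_pow_eq_1[OF assms(2)])
  also have "\<dots> \<longleftrightarrow> [i = j] (mod m)"
    using le by (metis cong_altdef_nat cong_sym_eq)
  finally show ?case .
next
  case (sym i j)
  then show ?case by (metis cong_sym_eq)
qed

lemma prim_ex:
  assumes "N > 0" "z ^ N = 1"
  shows "\<exists>m. m dvd N \<and> z \<in> prim m"
proof -
  define m where "m = (LEAST m. m > 0 \<and> z ^ m = 1)"
  have m: "m > 0 \<and> z ^ m = 1" unfolding m_def by (rule LeastI[of _ N]) (use assms in auto)
  have min: "m \<le> j" if "j > 0" "z ^ j = 1" for j
    unfolding m_def by (rule Least_le) (use that in auto)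
  have dvd: "m dvd j" if "z ^ j = 1" for j
  proof -
    have "z ^ j = (z ^ m) ^ (j div m) * z ^ (j mod m)"
      by (simp add: power_mult[symmetric] power_add[symmetric])
    then have "z ^ (j mod m) = 1" using m that by simp
    then have "j mod m = 0" using min[of "j mod m"] m
      by (metis gr0I mod_less_divisor not_le)
    then show ?thesis by auto
  qed
  then show ?thesis using m assms by (auto simp: prim_def)
qed

lemma prim_disjoint: "k \<noteq> m \<Longrightarrow> prim k \<inter> prim m = {}"
  by (auto simp: prim_def intro: dvd_antisym)

lemma mu_eq_UN: "N > 0 \<Longrightarrow> mu N = (\<Union>k\<in>{k. k dvd N}. prim k)"
  using prim_ex by (auto simp: mu_def prim_pow_eq_1)

lemma card_mu: "\<not> p dvd N \<Longrightarrow> finite (mu N)" "\<not> p dvd N \<Longrightarrow> card (mu N) = N"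
  using card_nth_roots[of N 1] by (auto simp: mu_def)

lemma not_p_dvd_pos: "\<not> p dvd m \<Longrightarrow> m > 0"
  by (cases m) auto

lemma finite_prim: "\<not> p dvd m \<Longrightarrow> finite (prim m)"
  using finite_subset[OF _ card_mu(1), of "prim m" m] by (auto simp: prim_def mu_def)

text \<open>Both the numbers \<open>card (prim k)\<close> and the totients sum to \<open>m\<close>
  over the divisors \<open>k\<close> of \<open>m\<close>; induction cancels the terms of the proper
  divisors.\<close>

lemma card_prim: "\<not> p dvd m \<Longrightarrow> card (prim m) = totient m"
proof (induction m rule: less_induct)
  case (less m)
  have m: "m > 0" using less.prems by (rule not_p_dvd_pos)
  have np: "\<not> p dvd k" if "k dvd m" for k using less.prems that by (meson dvd_trans)
  have "m = (\<Sum>k | k dvd m. card (prim k))"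
    using card_mu(2)[OF less.prems] mu_eq_UN[OF m] m np prim_disjoint finite_prim
    by (subst card_UN_disjoint[symmetric]) auto
  also have "\<dots> = card (prim m) + (\<Sum>k\<in>{k. k dvd m} - {m}. card (prim k))"
    using m by (subst sum.remove[of _ m]) auto
  also have "(\<Sum>k\<in>{k. k dvd m} - {m}. card (prim k)) = (\<Sum>k\<in>{k. k dvd m} - {m}. totient k)"
  proof (intro sum.cong refl less.IH)
    fix k assume "k \<in> {k. k dvd m} - {m}"
    then show "k < m" "\<not> p dvd k" using m np by (auto dest: dvd_imp_le)
  qed
  finally have 1: "m = card (prim m) + (\<Sum>k\<in>{k. k dvd m} - {m}. totient k)" .
  have "m = (\<Sum>k | k dvd m. totient k)" by (rule totient_divisor_sum[symmetric])
  also have "\<dots> = totient m + (\<Sum>k\<in>{k. k dvd m} - {m}. totient k)"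
    using m by (subst sum.remove[of _ m]) auto
  finally show ?case using 1 by linarith
qed

lemma stable_prim:
  assumes "pw Q" "\<not> p dvd m"
  shows "stable Q (prim m)"
proof -
  have m: "m > 0" using assms(2) by (rule not_p_dvd_pos)
  have "z ^ Q \<in> prim m" if z: "z \<in> prim m" for z
    using pw_coprime[OF assms] prim_pow_eq_1[OF z]
    by (auto simp: prim_def power_mult[symmetric] coprime_dvd_mult_right_iff)
  then show ?thesis
    using finite_prim[OF assms(2)] prim_nonzero[OF m] by (auto simp: stable_def)
qed

lemma stable_mu:
  assumes "\<not> p dvd N"
  shows "stable Q (mu N)"
proof -
  have "N > 0" using assms by (rule not_p_dvd_pos)
  then have "0 \<notin> mu N" by (simp add: mu_def zero_power)
  moreover have "z ^ Q \<in> mu N" if "z \<in> mu N" for z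
    using that by (simp add: mu_def) (metis mult.commute power_mult power_one)
  ultimately show ?thesis using card_mu(1)[OF assms] by (simp add: stable_def)
qed

lemma pre_mu: "pre e (mu N) = mu (e * N)"
  by (auto simp: pre_def mu_def power_mult)

text \<open>If \<open>z\<close> has order \<open>N\<close>, then \<open>z ^ e\<close> has order
  \<open>N div gcd N e\<close>. The cofactor of this gcd in \<open>e\<close> is coprime to
  \<open>m\<close>, yet its primes divide \<open>m\<close>; so it is 1 and
  \<open>N = m * e\<close>.\<close>

lemma pre_prim:
  assumes "m > 0" "e > 0" and primes: "\<And>r. prime r \<Longrightarrow> r dvd e \<Longrightarrow> r dvd m"
  shows "pre e (prim m) = prim (m * e)"
proof (intro equalityI subsetI)
  fix z assume z: "z \<in> prim (m * e)"
  show "z \<in> pre e (prim m)"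
    using prim_pow_eq_1[OF z] assms(2) by (simp add: pre_def prim_def power_mult[symmetric] mult.commute)
next
  fix z assume "z \<in> pre e (prim m)"
  then have ze: "z ^ e \<in> prim m" by (simp add: pre_def)
  then have "z ^ (e * m) = 1" by (simp add: power_mult prim_pow_eq_1)
  then obtain N where N: "N dvd e * m" "z \<in> prim N"
    using prim_ex[of "e * m" z] assms by auto
  have iff: "m dvd j \<longleftrightarrow> N dvd e * j" for j
    using prim_pow_eq_1[OF ze, of j] prim_pow_eq_1[OF N(2), of "e * j"] by (simp add: power_mult)
  have "N > 0" using N(1) assms by (auto intro: gr0I)
  define g where "g = gcd N e"
  have g: "g > 0" using assms by (simp add: g_def)
  obtain N' e' where N': "N = g * N'" "e = g * e'" unfolding g_def by (meson dvd_def gcd_dvd1 gcd_dvd2)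
  have cop: "coprime N' e'"
    using N' g assms unfolding g_def by (metis div_gcd_coprime nonzero_mult_div_cancel_left not_gr_zero)
  have "m dvd j \<longleftrightarrow> N' dvd j" for j
    using iff[of j] N' g cop by (simp add: mult.assoc coprime_dvd_mult_right_iff)
  then have "m = N'" by (metis dvd_antisym dvd_refl)
  have "e' = 1"
  proof (rule ccontr)
    assume "e' \<noteq> 1"
    then obtain r where r: "prime r" "r dvd e'" using prime_factor_nat by blast
    then have "r dvd m" using primes N' by auto
    then show False using r cop \<open>m = N'\<close> coprime_common_divisor not_prime_unit by blast
  qed
  then show "z \<in> prim (m * e)" using N N' \<open>m = N'\<close> by (simp add: mult.commute)
qed

section \<open>Frobenius orbits, the root sets of minimal polynomials\<close>

definition orb :: "nat \<Rightarrow> 'l \<Rightarrow> 'l set" where "orb Q z = range (\<lambda>i. z ^ (Q ^ i))"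

lemma self_in_orb: "z \<in> orb Q z"
  unfolding orb_def by (rule image_eqI[of _ _ 0]) auto

lemma orb_sub_stable: "stable Q A \<Longrightarrow> z \<in> A \<Longrightarrow> orb Q z \<subseteq> A"
proof -
  assume A: "stable Q A" "z \<in> A"
  have "z ^ (Q ^ i) \<in> A" for i
    by (induction i) (use A in \<open>simp_all add: power_mult mult.commute[of Q] stable_def\<close>)
  then show ?thesis by (auto simp: orb_def)
qed

lemma orb_pow_closed: "w \<in> orb Q z \<Longrightarrow> w ^ Q \<in> orb Q z"
proof -
  assume "w \<in> orb Q z"
  then obtain i where "w = z ^ (Q ^ i)" by (auto simp: orb_def)
  then have "w ^ Q = z ^ (Q ^ Suc i)" by (simp add: power_mult[symmetric] mult.commute)
  then show ?thesis unfolding orb_def by (rule image_eqI) simp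
qed

lemma orb_power_sub: "orb (Q ^ e) z \<subseteq> orb Q z"
  by (auto simp: orb_def power_mult[symmetric])

lemma pow_in_orb_pow: "w \<in> orb Q z \<Longrightarrow> w ^ e \<in> orb Q (z ^ e)"
  unfolding orb_def by (auto simp: power_mult[symmetric] mult.commute)

text \<open>The power \<open>z ^ (Q ^ i)\<close> depends exactly on \<open>Q ^ i\<close> modulo
  \<open>m\<close>, hence on \<open>i\<close> modulo the order of \<open>Q\<close>.\<close>

lemma card_orb:
  assumes "pw Q" "\<not> p dvd m" "z \<in> prim m"
  shows "card (orb Q z) = ord m Q"
proof -
  have m: "m > 0" using assms(2) by (rule not_p_dvd_pos)
  have cop: "coprime m Q" using pw_coprime assms by blast
  have eq: "z ^ (Q ^ i) = z ^ (Q ^ j) \<longleftrightarrow> [i = j] (mod ord m Q)" for i j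
    using prim_pow_cong[OF m assms(3)] order_divides_expdiff[OF cop] by simp
  have "orb Q z = (\<lambda>i. z ^ (Q ^ i)) ` {..<ord m Q}"
  proof (intro equalityI subsetI)
    fix w assume "w \<in> orb Q z"
    then obtain i where i: "w = z ^ (Q ^ i)" by (auto simp: orb_def)
    have "ord m Q > 0" using cop by simp
    moreover have "w = z ^ (Q ^ (i mod ord m Q))" unfolding i eq by (simp add: cong_def)
    ultimately show "w \<in> (\<lambda>i. z ^ (Q ^ i)) ` {..<ord m Q}" by auto
  qed (auto simp: orb_def)
  moreover have "inj_on (\<lambda>i. z ^ (Q ^ i)) {..<ord m Q}"
    by (rule inj_onI) (simp add: eq cong_less_modulus_unique_nat)
  ultimately show ?thesis by (simp add: card_image)
qed

lemma orb_sub_prim: "pw Q \<Longrightarrow> \<not> p dvd m \<Longrightarrow> z \<in> prim m \<Longrightarrow> orb Q z \<subseteq> prim m"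
  using orb_sub_stable stable_prim by blast

lemma stable_orb: "pw Q \<Longrightarrow> \<not> p dvd m \<Longrightarrow> z \<in> prim m \<Longrightarrow> stable Q (orb Q z)"
  using orb_sub_prim[of Q m z] stable_prim[of Q m] orb_pow_closed
  by (auto simp: stable_def intro: finite_subset)

lemma orb_eq:
  assumes "pw Q" "\<not> p dvd m" "z \<in> prim m" "w \<in> orb Q z"
  shows "orb Q w = orb Q z"
proof (rule card_subset_eq)
  show "finite (orb Q z)" using stable_orb[OF assms(1-3)] by (rule stable_finite)
  show "orb Q w \<subseteq> orb Q z" using orb_sub_stable[OF stable_orb[OF assms(1-3)] assms(4)] .
  have "w \<in> prim m" using orb_sub_prim assms by blast
  then show "card (orb Q w) = card (orb Q z)" using assms card_orb by simp
qed

lemma orb_disjoint: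
  assumes "pw Q" "\<not> p dvd m" "z \<in> prim m" "w \<in> prim m" "orb Q w \<noteq> orb Q z"
  shows "orb Q w \<inter> orb Q z = {}"
  using orb_eq[OF assms(1,2,3)] orb_eq[OF assms(1,2,4)] assms(5) by blast

lemma prim_eq_UN_orb: "pw Q \<Longrightarrow> \<not> p dvd m \<Longrightarrow> prim m = \<Union>(orb Q ` prim m)"
proof (intro equalityI subsetI)
  fix z assume "z \<in> prim m"
  then show "z \<in> \<Union>(orb Q ` prim m)" using self_in_orb by auto
next
  fix w assume "pw Q" "\<not> p dvd m" "w \<in> \<Union>(orb Q ` prim m)"
  then show "w \<in> prim m" using orb_sub_prim[of Q m] by auto
qed

text \<open>No maximal submodule of the kernel of \<open>\<Phi>\<^sub>m\<close> contains \<open>w\<close>, that is, \<open>w\<close> generates it over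
  the field with \<open>Q\<close> elements.\<close>
definition gen :: "nat \<Rightarrow> nat \<Rightarrow> 'l \<Rightarrow> bool" where
  "gen Q m w \<longleftrightarrow> w \<in> K Q (prim m) \<and> (\<forall>z\<in>prim m. act Q (PP (prim m - orb Q z)) w \<noteq> 0)"

lemma K_prim_mult:
  assumes "\<not> p dvd m" "\<not> p dvd e" "\<And>r. prime r \<Longrightarrow> r dvd e \<Longrightarrow> r dvd m" "pw Q"
  shows "K Q (prim (m * e)) = K (Q ^ e) (prim m)"
  using K_pre[OF assms(2) stable_prim[OF assms(4,1)]] pre_prim[of m e] assms not_p_dvd_pos by simp

text \<open>When the order grows by the full factor \<open>e\<close>, each \<open>Q\<close>-orbit in
  \<open>prim (m * e)\<close> is the whole preimage of a \<open>Q\<close>-orbit in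
  \<open>prim m\<close>. The latter contains a \<open>Q ^ e\<close>-orbit, so a failure over
  \<open>Q\<close> is also a failure over \<open>Q ^ e\<close>.\<close>

lemma gen_up:
  assumes Q: "pw Q" and m: "\<not> p dvd m" and e: "\<not> p dvd e"
    and primes: "\<And>r. prime r \<Longrightarrow> r dvd e \<Longrightarrow> r dvd m"
    and ord: "ord (m * e) Q = e * ord m Q" and gen: "gen (Q ^ e) m w"
  shows "gen Q (m * e) w"
proof -
  have e0: "e > 0" "m > 0" using e m by (auto intro: not_p_dvd_pos)
  have me: "\<not> p dvd m * e" using m e p prime_dvd_mult_iff by blast
  have pp: "pre e (prim m) = prim (m * e)" using pre_prim primes e0 by blast
  have Qe: "pw (Q ^ e)" using Q e0 by (simp add: pw_power)
  have "act Q (PP (prim (m * e) - orb Q z)) w \<noteq> 0" if z: "z \<in> prim (m * e)" for z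
  proof
    assume 0: "act Q (PP (prim (m * e) - orb Q z)) w = 0"
    define y where "y = z ^ e"
    have y: "y \<in> prim m" using z pp by (auto simp: pre_def y_def)
    have so: "stable Q (orb Q y)" by (rule stable_orb[OF Q m y])
    have "orb Q z = pre e (orb Q y)"
    proof (rule card_subset_eq)
      show "finite (pre e (orb Q y))" using so card_pre(1)[OF e] by (simp add: stable_def)
      show "orb Q z \<subseteq> pre e (orb Q y)" using pow_in_orb_pow by (auto simp: pre_def y_def)
      show "card (orb Q z) = card (pre e (orb Q y))"
        using so card_pre(2)[OF e] card_orb[OF Q me z] card_orb[OF Q m y] ord
        by (simp add: stable_def)
    qed
    then have "prim (m * e) - orb Q z = pre e (prim m - orb Q y)" by (simp add: pre_Diff pp)
    moreover have st: "stable Q (prim m - orb Q y)" using Q so m by (simp add: stable_Diff stable_prim)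
    ultimately have "w \<in> K (Q ^ e) (prim m - orb Q y)" using 0 act_pre[OF e st] by (simp add: K_def)
    moreover have "K (Q ^ e) (prim m - orb Q y) \<subseteq> K (Q ^ e) (prim m - orb (Q ^ e) y)"
      using orb_power_sub[of Q e y] Qe m y st
      by (intro K_mono) (auto intro!: stable_Diff stable_prim stable_orb stable_power[OF st])
    ultimately show False using gen y by (auto simp: gen_def K_def)
  qed
  then show ?thesis using gen K_prim_mult[OF m e primes Q] by (simp add: gen_def)
qed

text \<open>When the orders agree, the orbits under \<open>Q\<close> and \<open>Q ^ e\<close> in
  \<open>prim m\<close> coincide. The preimage of such an orbit contains the \<open>Q\<close>-orbit
  of any \<open>e\<close>-th root of its elements, so a failure over \<open>Q ^ e\<close> is also a
  failure over \<open>Q\<close>.\<close>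

lemma gen_down:
  assumes Q: "pw Q" and m: "\<not> p dvd m" and e: "\<not> p dvd e"
    and primes: "\<And>r. prime r \<Longrightarrow> r dvd e \<Longrightarrow> r dvd m"
    and ord: "ord m (Q ^ e) = ord m Q" and gen: "gen Q (m * e) w"
  shows "gen (Q ^ e) m w"
proof -
  have e0: "e > 0" "m > 0" using e m by (auto intro: not_p_dvd_pos)
  have me: "\<not> p dvd m * e" using m e p prime_dvd_mult_iff by blast
  have pp: "pre e (prim m) = prim (m * e)" using pre_prim primes e0 by blast
  have Qe: "pw (Q ^ e)" using Q e0 by (simp add: pw_power)
  have "act (Q ^ e) (PP (prim m - orb (Q ^ e) y)) w \<noteq> 0" if y: "y \<in> prim m" for y
  proof
    assume 0: "act (Q ^ e) (PP (prim m - orb (Q ^ e) y)) w = 0"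
    obtain z where z: "z ^ e = y" using nth_root_exists e0 by blast
    then have zp: "z \<in> prim (m * e)" using pp y by (auto simp: pre_def)
    have so: "stable Q (orb Q y)" by (rule stable_orb[OF Q m y])
    have "orb (Q ^ e) y = orb Q y"
      using so orb_power_sub card_orb[OF Q m y] card_orb[OF Qe m y] ord
      by (intro card_subset_eq) (simp_all add: stable_def)
    moreover have st: "stable Q (prim m - orb Q y)" using Q so m by (simp add: stable_Diff stable_prim)
    ultimately have "w \<in> K Q (prim (m * e) - pre e (orb Q y))"
      using 0 act_pre[OF e st] by (simp add: K_def pre_Diff pp)
    moreover have "K Q (prim (m * e) - pre e (orb Q y)) \<subseteq> K Q (prim (m * e) - orb Q z)"
    proof (rule K_mono[OF Q])
      show "prim (m * e) - pre e (orb Q y) \<subseteq> prim (m * e) - orb Q z"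
        using pow_in_orb_pow z by (auto simp: pre_def)
    qed (use Q me zp so e in \<open>auto intro!: stable_Diff stable_prim stable_orb stable_pre\<close>)
    ultimately show False using gen zp by (auto simp: gen_def K_def)
  qed
  then show ?thesis using gen K_prim_mult[OF m e primes Q] by (simp add: gen_def)
qed

text \<open>Split \<open>prim m\<close> into its orbits \<open>B\<close>: generating means that each
  part in \<open>K Q B\<close> is nonzero. Every orbit has \<open>ord m Q\<close> elements, which
  gives both the factor and the number of factors.\<close>

lemma card_gen:
  assumes Q: "pw Q" and m: "\<not> p dvd m"
  shows "card {w. gen Q m w} = (Q ^ ord m Q - 1) ^ (totient m div ord m Q)"
proof -
  let ?I = "orb Q ` prim m"
  have fin: "finite ?I" using finite_prim[OF m] by simp
  have UN: "(\<Union>B\<in>?I. B) = prim m" using prim_eq_UN_orb[OF Q m] by simp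
  have st: "stable Q B" if "B \<in> ?I" for B using that stable_orb[OF Q m] by auto
  have cB: "card B = ord m Q" if "B \<in> ?I" for B using that card_orb[OF Q m] by auto
  have disj: "B \<inter> B' = {}" if "B \<in> ?I" "B' \<in> ?I" "B \<noteq> B'" for B B'
    using that orb_disjoint[OF Q m] by blast
  have "card {w \<in> K Q (\<Union>B\<in>?I. B). \<forall>B\<in>?I. act Q (PP ((\<Union>B\<in>?I. B) - B)) w \<in> K Q B - {0}} =
      (\<Prod>B\<in>?I. card (K Q B - {0}))"
    by (rule crt_count[OF Q fin st disj]) auto
  also have "{w \<in> K Q (\<Union>B\<in>?I. B). \<forall>B\<in>?I. act Q (PP ((\<Union>B\<in>?I. B) - B)) w \<in> K Q B - {0}} = {w. gen Q m w}"
    unfolding UN gen_def using act_in_K[OF Q stable_prim[OF Q m] stable_orb[OF Q m] orb_sub_prim[OF Q m]] by auto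
  also have "(\<Prod>B\<in>?I. card (K Q B - {0})) = (\<Prod>B\<in>?I. Q ^ ord m Q - 1)"
    using st cB by (intro prod.cong) (auto simp: card_K[OF Q] zero_in_K[OF Q])
  also have "\<dots> = (Q ^ ord m Q - 1) ^ card ?I" by simp
  also have "card ?I = totient m div ord m Q"
  proof -
    have "totient m = (\<Sum>B\<in>?I. card B)"
      using card_UN_disjoint[OF fin, of "\<lambda>B. B"] disj stable_finite[OF st] UN card_prim[OF m] by auto
    also have "\<dots> = card ?I * ord m Q" using cB by simp
    finally show ?thesis using pw_coprime[OF Q m] by simp
  qed
  finally show ?thesis .
qed

end

section \<open>Multiplicative orders modulo prime powers\<close>

definition vord :: "nat \<Rightarrow> nat \<Rightarrow> nat \<Rightarrow> nat" where
  "vord q r c = multiplicity r (ord (r ^ c) q)"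

lemma ord_dvd_mono:
  assumes "m dvd (k :: nat)" shows "ord m q dvd ord k q"
  using assms ord[of q k] ord_divides[of q "ord k q" m] cong_dvd_modulus_nat by blast

text \<open>A power of \<open>q\<close> that is 1 modulo \<open>r ^ c\<close> becomes 1 modulo
  \<open>r ^ Suc c\<close> after raising it to the power \<open>r\<close>, so the quotient of the
  two orders divides the prime \<open>r\<close>.\<close>

lemma ord_prime_power_Suc:
  assumes "prime (r :: nat)" "coprime r q" "c \<ge> 1"
  shows "ord (r ^ Suc c) q = ord (r ^ c) q \<or> ord (r ^ Suc c) q = r * ord (r ^ c) q"
proof -
  have "ord (r ^ c) q dvd ord (r ^ Suc c) q" by (rule ord_dvd_mono) simp
  then obtain u where u: "ord (r ^ Suc c) q = ord (r ^ c) q * u" by blast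
  have "[(q ^ ord (r ^ c) q) ^ r = 1] (mod (r * r ^ c))"
    using assms by (intro pow_one_cong_lift ord) (simp add: dvd_power)
  then have "ord (r ^ Suc c) q dvd ord (r ^ c) q * r"
    by (simp add: power_mult[symmetric] ord_divides')
  moreover have "ord (r ^ c) q \<noteq> 0" using assms by (metis coprime_power_left_iff ord_eq_0)
  ultimately have "u dvd r" unfolding u using dvd_times_left_cancel_iff by blast
  then have "u = 1 \<or> u = r" using assms(1) by (simp add: prime_nat_iff)
  then show ?thesis using u by auto
qed

text \<open>The binomial expansion around 1 to first order.\<close>

lemma sum_powers_cong:
  fixes x :: int
  shows "[x ^ i = 1 + int i * (x - 1)] (mod (x - 1)^2)"
proof (induction i)
  case (Suc i)
  have "[x * x ^ i = x * (1 + int i * (x - 1))] (mod (x - 1)^2)"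
    by (intro cong_mult cong_refl Suc.IH)
  also have "x * (1 + int i * (x - 1)) = 1 + int (Suc i) * (x - 1) + int i * (x - 1)^2"
    by (simp add: algebra_simps power2_eq_square)
  also have "[\<dots> = 1 + int (Suc i) * (x - 1)] (mod (x - 1)^2)"
    by (simp add: cong_def)
  finally show ?case by simp
qed simp

text \<open>In \<open>x ^ r - 1 = (x - 1) * S\<close> the geometric sum \<open>S\<close> is
  congruent to \<open>r\<close> modulo the square of \<open>r\<close>, so exactly one factor
  \<open>r\<close> is gained. For \<open>r = 2\<close> the sum is \<open>x + 1\<close>, which is 2
  modulo 4 only if 4 divides \<open>x - 1\<close>; hence the bound on \<open>c\<close>.\<close>

lemma not_lift_pow:
  fixes x :: int and r :: nat
  assumes r: "prime r" and c: "c \<ge> 1" "odd r \<or> c \<ge> 2"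
    and x: "int r ^ c dvd x - 1" "\<not> int r ^ Suc c dvd x - 1"
  shows "\<not> int r ^ Suc (Suc c) dvd x ^ r - 1"
proof
  assume dvd: "int r ^ Suc (Suc c) dvd x ^ r - 1"
  define S where "S = (\<Sum>i<r. x ^ i)"
  have r0: "int r \<noteq> 0" using r by (auto simp: prime_gt_0_nat)
  have pr: "prime (int r)" using r by simp
  obtain u where u: "x - 1 = int r ^ c * u" using x(1) by blast
  have nu: "\<not> int r dvd u" using x(2) u r0 by (auto simp: mult.commute)
  have rx: "int r dvd x - 1" using u c(1) by (metis dvd_mult2 dvd_power less_le_trans zero_less_one)
  have S: "[S = int r] (mod (int r)^2)"
  proof (cases "odd r")
    case True
    have "[S = (\<Sum>i<r. 1 + int i * (x - 1))] (mod (x - 1)^2)"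
      unfolding S_def by (intro cong_sum sum_powers_cong)
    moreover have "(int r)^2 dvd (x - 1)^2" using rx by (rule dvd_power_same)
    ultimately have 1: "[S = (\<Sum>i<r. 1 + int i * (x - 1))] (mod (int r)^2)"
      using cong_dvd_modulus by blast
    \<comment> \<open>As \<open>r\<close> is odd, it divides the triangular sum; the second factor
      \<open>r\<close> comes from \<open>x - 1\<close>.\<close>
    have "2 * (\<Sum>i<r. int i) = int r * (int r - 1)"
    proof -
      have "2 * (\<Sum>i<m. int i) = int m * (int m - 1)" for m by (induction m) (simp_all add: algebra_simps)
      then show ?thesis .
    qed
    then have "int r dvd 2 * (\<Sum>i<r. int i)" by simp
    moreover have "coprime (int r) 2" using True by simp
    ultimately have "int r dvd (\<Sum>i<r. int i)" by (simp add: coprime_dvd_mult_right_iff)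
    then have "(int r)^2 dvd (\<Sum>i<r. int i) * (x - 1)"
      using rx by (simp add: power2_eq_square mult_dvd_mono)
    moreover have "(\<Sum>i<r. 1 + int i * (x - 1)) = int r + (\<Sum>i<r. int i) * (x - 1)"
      by (simp add: sum.distrib sum_distrib_right)
    ultimately have "[(\<Sum>i<r. 1 + int i * (x - 1)) = int r] (mod (int r)^2)"
      by (simp add: cong_iff_dvd_diff)
    with 1 show ?thesis using cong_trans by blast
  next
    case False
    then have r2: "r = 2" using r by (metis prime_odd_nat prime_ge_2_nat le_neq_implies_less)
    then have "S = x - 1 + 2" by (simp add: S_def numeral_2_eq_2)
    moreover have "(int r)^2 dvd x - 1"
      using False c(2) x(1) by (meson dvd_trans le_imp_power_dvd)
    ultimately show ?thesis using r2 by (simp add: cong_iff_dvd_diff)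
  qed
  have "int r dvd S"
    using S by (meson cong_dvd_iff cong_dvd_modulus dvd_refl dvd_power pos2)
  then obtain s where s: "S = int r * s" by blast
  have ns: "\<not> int r dvd s"
  proof
    assume "int r dvd s"
    then have "(int r)^2 dvd S" using s by (simp add: power2_eq_square)
    then have "(int r)^2 dvd int r" using S cong_dvd_iff by blast
    then have "int r * int r dvd int r * 1" by (simp add: power2_eq_square)
    then have "int r dvd 1" using r0 by (simp only: dvd_mult_cancel_left) simp
    then show False using pr not_prime_unit by blast
  qed
  have "x ^ r - 1 = (x - 1) * S" unfolding S_def by (rule power_diff_1_eq)
  also have "\<dots> = int r ^ Suc c * (u * s)" using u s by (simp add: algebra_simps)
  finally have "int r ^ Suc c * int r dvd int r ^ Suc c * (u * s)"
    using dvd by (simp add: mult_ac)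
  then have "int r dvd u * s" using r0 by simp
  then show False using nu ns pr prime_dvd_mult_iff by blast
qed

text \<open>Growth at \<open>c\<close> says that \<open>q ^ ord (r ^ c) q\<close> is 1 modulo
  \<open>r ^ c\<close> but not modulo \<open>r ^ Suc c\<close>. By \<open>not_lift_pow\<close> its
  \<open>r\<close>-th power then fails to be 1 at the next level, so the order grows again.\<close>

lemma ord_prime_power_persist:
  assumes r: "prime (r :: nat)" "coprime r q" and c: "c \<ge> 1" "odd r \<or> c \<ge> 2"
    and eq: "ord (r ^ Suc c) q = r * ord (r ^ c) q"
  shows "ord (r ^ Suc (Suc c)) q = r * ord (r ^ Suc c) q"
proof -
  have iff: "[q ^ j = 1] (mod r ^ i) \<longleftrightarrow> int r ^ i dvd int q ^ j - 1" for i j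
    by (metis cong_iff_dvd_diff cong_int_iff of_nat_1 of_nat_power)
  define o' where "o' = ord (r ^ c) q"
  have o': "o' > 0" using r by (simp add: o'_def)
  have r1: "r > 1" using r(1) prime_gt_1_nat by blast
  have "int r ^ c dvd int q ^ o' - 1" unfolding iff[symmetric] o'_def by (rule ord)
  moreover have "\<not> int r ^ Suc c dvd int q ^ o' - 1"
    unfolding iff[symmetric] ord_divides eq using o' r1 by (auto simp: o'_def dest!: dvd_imp_le)
  ultimately have "\<not> int r ^ Suc (Suc c) dvd (int q ^ o') ^ r - 1"
    by (rule not_lift_pow[OF r(1) c])
  then have "\<not> ord (r ^ Suc (Suc c)) q dvd ord (r ^ Suc c) q"
    unfolding ord_divides[symmetric] iff by (simp add: eq o'_def power_mult[symmetric] mult.commute del: power_Suc)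
  then show ?thesis
    using ord_prime_power_Suc[OF r, of "Suc c"] by auto
qed

lemma vord_1: "prime r \<Longrightarrow> coprime r q \<Longrightarrow> vord q r 1 = 0"
proof -
  assume r: "prime r" "coprime r q"
  have "ord r q dvd r - 1"
    using order_divides_totient[OF r(2)] r(1) by (simp add: totient_prime)
  then have "ord r q < r" using r(1) prime_gt_1_nat[OF r(1)] by (auto dest!: dvd_imp_le)
  then have "\<not> r dvd ord r q" using r(2) by (auto dest: dvd_imp_le)
  then show ?thesis by (simp add: vord_def not_dvd_imp_multiplicity_0)
qed

lemma vord_Suc:
  assumes "prime r" "coprime r q" "c \<ge> 1"
  shows "vord q r (Suc c) = vord q r c \<or> vord q r (Suc c) = Suc (vord q r c)"
    "vord q r (Suc c) = Suc (vord q r c) \<longleftrightarrow> ord (r ^ Suc c) q = r * ord (r ^ c) q"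
proof -
  have r: "r \<noteq> 0" "\<not> is_unit r" using assms(1) by auto
  have "ord (r ^ c) q \<noteq> 0" using assms by (metis coprime_power_left_iff ord_eq_0)
  then have 1: "multiplicity r (r * ord (r ^ c) q) = Suc (vord q r c)"
    using r by (simp add: vord_def multiplicity_times_same)
  show "vord q r (Suc c) = vord q r c \<or> vord q r (Suc c) = Suc (vord q r c)"
    "vord q r (Suc c) = Suc (vord q r c) \<longleftrightarrow> ord (r ^ Suc c) q = r * ord (r ^ c) q"
    using ord_prime_power_Suc[OF assms] 1 unfolding vord_def by auto
qed

text \<open>The flag \<open>P\<close> stands for an odd prime; for \<open>r = 2\<close> growth is only guaranteed to persist
  from the exponent 2 on.\<close>
locale ord_growth =
  fixes A :: "nat \<Rightarrow> nat" and P :: bool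
  assumes A1: "A 1 = 0"
    and step_cases: "c \<ge> 1 \<Longrightarrow> A (Suc c) = A c \<or> A (Suc c) = Suc (A c)"
    and persist: "c \<ge> 1 \<Longrightarrow> P \<or> c \<ge> 2 \<Longrightarrow> A (Suc c) = Suc (A c) \<Longrightarrow> A (Suc (Suc c)) = Suc (A (Suc c))"
begin

text \<open>A value above \<open>b\<close> must have been reached by a step of growth, and growth
  persists. The condition on \<open>b\<close> rules out that the only such step is the one from 1 to
  2 for the prime 2, from which growth may stop.\<close>

lemma grow:
  assumes b: "P \<or> A 2 = 0 \<or> b \<ge> 1" and "c \<ge> 1" "A c > b"
  shows "A (Suc c) = Suc (A c)"
  using assms(2,3)
proof (induction c rule: dec_induct)
  case base
  then show ?case using A1 by simp
next
  case (step c)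
  have "A (Suc c) \<noteq> A c" using step.IH step.prems by auto
  then have s: "A (Suc c) = Suc (A c)" using step_cases[of c] step.hyps by auto
  have "P \<or> c \<ge> 2"
  proof (rule ccontr)
    assume n: "\<not> (P \<or> c \<ge> 2)"
    then have "c = 1" using step.hyps by auto
    then show False using s A1 b n step.prems by (auto simp: numeral_2_eq_2)
  qed
  then show ?case using persist s step.hyps by auto
qed

lemma mono: "1 \<le> i \<Longrightarrow> i \<le> j \<Longrightarrow> A i \<le> A j"
proof (induction j)
  case (Suc j)
  then show ?case using step_cases[of j] by (cases "i = Suc j") auto
qed simp

lemma less: "c \<ge> 1 \<Longrightarrow> A c < c"
proof (induction c rule: dec_induct)
  case (step c)
  then show ?case using step_cases[of c] by auto
qed (use A1 in simp)

text \<open>Read backwards, \<open>grow\<close> says that lowering the argument by one lowers the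
  value by exactly one as long as the value exceeds \<open>b\<close>.\<close>

lemma descend:
  assumes b: "P \<or> A 2 = 0 \<or> b \<ge> 1" and c: "c \<ge> 1" and "b + j \<le> A c"
  shows "A (c - j) = A c - j"
  using assms(3)
proof (induction j)
  case (Suc j)
  then have IH: "A (c - j) = A c - j" by simp
  have gt: "A (c - j) > b" using IH Suc.prems by simp
  have "c - j \<ge> 2"
    using less[OF c] Suc.prems A1 gt by linarith
  then obtain i where i: "c - j = Suc i" "i \<ge> 1"
    by (metis Suc_le_D Suc_le_mono One_nat_def numeral_2_eq_2)
  have "A (Suc i) = Suc (A i)"
    using step_cases[OF i(2)] grow[OF b i(2)] gt i(1) by auto
  then show ?case using IH i by (metis Suc_diff_Suc diff_Suc_1 diff_Suc_eq_diff_pred diff_commute)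
qed simp

text \<open>Here \<open>c\<close>, \<open>T\<close> and \<open>\<delta>\<close> are the exponents of a prime in \<open>k\<close>, in the degree \<open>\<tau>\<^sub>k\<close> or
  \<open>2\<tau>\<^sub>k\<close> of the decisive condition, and in the degree \<open>d\<close> of a condition to be deduced from it; the
  subtractions are meant to truncate.\<close>
definition good :: "nat \<Rightarrow> nat \<Rightarrow> nat \<Rightarrow> bool" where
  "good c T \<delta> \<longleftrightarrow>
    (\<delta> < T \<longrightarrow> A (c - \<delta>) - \<delta> = (T - \<delta>) + (A (c - T) - \<delta>)) \<and>
    (T < \<delta> \<longrightarrow> A (c - \<delta>) \<le> T)"

lemma Suc_half: "a \<ge> 1 \<Longrightarrow> Suc (a div 2) \<le> a" "odd a \<Longrightarrow> a \<noteq> 1 \<Longrightarrow> Suc (Suc (a div 2)) \<le> a" for a :: nat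
  by presburger+

lemma descend_half: "c \<ge> 1 \<Longrightarrow> A (c - A c div 2) = A c - A c div 2"
  \<comment> \<open>If \<open>A c\<close> is at least 2, subtracting its half leaves at least 1, so
    \<open>b = 1\<close> is allowed for every prime; otherwise the half is 0.\<close>
  using descend[of 1 c "A c div 2"] by (cases "A c \<le> 1") (auto simp: le_Suc_eq)

text \<open>For \<open>\<delta> < T\<close> both values descend one by one and the identity is
  arithmetic. For \<open>\<delta> > T\<close> it suffices to bound \<open>A (c - Suc T)\<close>: an
  even \<open>A c\<close> already gives the value \<open>T\<close> one step earlier, an odd one
  needs one more descent, which can fail in the excluded case only.\<close>

lemma good_half:
  assumes c: "c \<ge> 1" and \<delta>: "\<delta> < c" and ne: "\<not> (\<not> P \<and> A 2 \<noteq> 0 \<and> A c = 1 \<and> c \<ge> 3)"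
  shows "good c (A c div 2) \<delta>"
proof -
  let ?T = "A c div 2"
  have T: "A (c - ?T) = A c - ?T" using descend_half[OF c] .
  have "A (c - \<delta>) - \<delta> = (?T - \<delta>) + (A (c - ?T) - \<delta>)" if "\<delta> < ?T"
  proof -
    have "A (c - \<delta>) = A c - \<delta>" using that by (intro descend[of 1] c) auto
    moreover have "a - x - x = (t - x) + (a - t - x)" if "x < t" "2 * t \<le> a" for a t x :: nat
      using that by auto
    ultimately show ?thesis using T that by simp
  qed
  moreover have "A (c - \<delta>) \<le> ?T" if d: "?T < \<delta>"
  proof -
    have le: "A (c - \<delta>) \<le> A (c - Suc ?T)" using d \<delta> by (intro mono) auto
    have le': "A (c - Suc ?T) \<le> A (c - ?T)" using d \<delta> by (intro mono) auto
    show ?thesis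
    proof (cases "P \<or> A 2 = 0")
      case True
      then have "A (c - Suc ?T) = A c - Suc ?T" if "A c \<ge> 1"
        using that by (intro descend[of 0] c) (auto simp: Suc_half)
      then show ?thesis using le le' T by (cases "A c \<ge> 1") (linarith | simp)+
    next
      case False
      show ?thesis
      proof (cases "even (A c)")
        case True
        then have "A c - ?T = ?T" by presburger
        then show ?thesis using le le' T by simp
      next
        case odd: False
        show ?thesis
        \<comment> \<open>For value 1 the excluded case leaves \<open>c = 2\<close>, where
          \<open>c - \<delta>\<close> is 1 and \<open>A 1 = 0\<close>.\<close>
        proof (cases "A c = 1")
          case True
          then have "c = 2" using ne False less[OF c] by auto
          moreover from this have "\<delta> = 1" using d \<delta> True by auto
          ultimately show ?thesis using A1 by simp
        next
          case n1: False
          have "A (c - Suc ?T) = A c - Suc ?T"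
            using odd n1 by (intro descend[of 1] c) (auto simp: Suc_half)
          then show ?thesis using le by linarith
        qed
      qed
    qed
  qed
  ultimately show ?thesis by (simp add: good_def)
qed

text \<open>At the prime 2 of an exceptional \<open>k\<close>, the exponent \<open>T = 0\<close>
  serves the odd degrees and \<open>T = 1\<close> the even ones. This is why two decisive conditions
  appear.\<close>

lemma good_exceptional:
  assumes "c \<ge> 1" "A c = 1" "\<delta> < c" "T = 0 \<and> \<delta> = 0 \<or> T = 1 \<and> \<delta> \<ge> 1"
  shows "good c T \<delta>"
  using assms mono[of "c - \<delta>" c] by (auto simp: good_def)

end

lemma ord_growth_vord:
  assumes "prime r" "coprime r q"
  shows "ord_growth (vord q r) (odd r)"
proof
  show "vord q r 1 = 0" by (rule vord_1[OF assms])
  fix c :: nat assume c: "c \<ge> 1"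
  show "vord q r (Suc c) = vord q r c \<or> vord q r (Suc c) = Suc (vord q r c)"
    by (rule vord_Suc(1)[OF assms c])
  assume "odd r \<or> c \<ge> 2" "vord q r (Suc c) = Suc (vord q r c)"
  then show "vord q r (Suc (Suc c)) = Suc (vord q r (Suc c))"
    using vord_Suc(2)[OF assms c] vord_Suc(2)[OF assms, of "Suc c"] ord_prime_power_persist[OF assms c] by simp
qed

section \<open>Orders modulo divisors of k, prime by prime\<close>

locale regular_pair =
  fixes q k :: nat
  assumes k0: "k > 0" and cop: "coprime k q" and reg: "coprime (ord (rad k) q) k"
begin

definition admissible :: "nat \<Rightarrow> bool" where
  "admissible d \<longleftrightarrow> d dvd k \<and> (\<forall>r. prime r \<longrightarrow> r dvd k \<longrightarrow> r dvd k div d)"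

lemma coprime_prime: "prime r \<Longrightarrow> r dvd k \<Longrightarrow> coprime r q"
  using cop coprime_divisors dvd_refl by blast

lemma growth: "prime r \<Longrightarrow> r dvd k \<Longrightarrow> ord_growth (vord q r) (odd r)"
  using ord_growth_vord coprime_prime by blast

lemma not_dvd_ord_rad: "prime r \<Longrightarrow> r dvd k \<Longrightarrow> \<not> r dvd ord (rad k) q"
  using reg coprime_common_divisor not_prime_unit by blast

lemma rad_dvd_rad: "m dvd k \<Longrightarrow> rad m dvd rad k"
  using k0 unfolding rad_def by (intro prod_dvd_prod_subset dvd_prime_factors) auto

lemma ord_nonzero: "m dvd k \<Longrightarrow> ord m (q ^ d) \<noteq> 0"
  using cop by (meson coprime_divisors coprime_power_right_iff dvd_refl ord_eq_0)

text \<open>Write \<open>m\<close> as a power of \<open>r\<close> times \<open>m'\<close>. The order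
  modulo \<open>m'\<close> involves only primes of \<open>m'\<close> and of
  \<open>ord (rad m') q\<close>, and regularity keeps \<open>r\<close> out of the latter. So
  \<open>r\<close> enters the lcm of the two orders only through the power of
  \<open>r\<close>.\<close>

lemma multiplicity_ord:
  assumes m: "m dvd k" and r: "prime r" "r dvd k"
  shows "multiplicity r (ord m q) = vord q r (multiplicity r m)"
proof -
  have m0: "m > 0" using m k0 by (auto intro: gr0I)
  obtain m' where m': "m = r ^ multiplicity r m * m'" "\<not> r dvd m'"
    using multiplicity_decompose'[of m r] m0 not_prime_unit[of r] r by (metis gr_implies_not0)
  have cop': "coprime (r ^ multiplicity r m) m'"
    using m'(2) r(1) by (simp add: prime_imp_coprime)
  have m'k: "m' dvd k" using m m' by (metis dvd_mult_right)
  have nz: "ord m' q \<noteq> 0" "ord (r ^ multiplicity r m) q \<noteq> 0"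
    using ord_nonzero[of _ 1] m'k m multiplicity_dvd[of r m] dvd_trans by (metis power_one_right)+
  have "\<not> r dvd ord m' q"
  proof
    assume "r dvd ord m' q"
    also have "ord m' q = ord (rad m') q * (\<Prod>r\<in>prime_factors m'. r ^ alpha q m' r)"
      using m'k k0 cop by (intro ord_eq_ord_rad_times) (auto intro: gr0I coprime_divisors[OF _ dvd_refl])
    finally have "r dvd ord (rad m') q \<or> r dvd (\<Prod>r\<in>prime_factors m'. r ^ alpha q m' r)"
      using r(1) by (simp add: prime_dvd_mult_iff)
    then show False
    proof
      assume "r dvd ord (rad m') q"
      then have "r dvd ord (rad k) q" using ord_dvd_mono[OF rad_dvd_rad[OF m'k]] dvd_trans by blast
      then show False using not_dvd_ord_rad r by blast
    next
      assume "r dvd (\<Prod>r\<in>prime_factors m'. r ^ alpha q m' r)"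
      then obtain s where s: "s \<in> prime_factors m'" "r dvd s ^ alpha q m' s"
        using r(1) by (auto simp: prime_dvd_prod_iff)
      then have "prime s" "r dvd s" "s dvd m'"
        using r(1) prime_dvd_power by (auto simp: in_prime_factors_iff)
      then have "r = s" using r(1) primes_dvd_imp_eq by blast
      then show False using m'(2) \<open>s dvd m'\<close> by simp
    qed
  qed
  then have z: "multiplicity r (ord m' q) = 0" by (simp add: not_dvd_imp_multiplicity_0)
  have "ord m q = lcm (ord (r ^ multiplicity r m) q) (ord m' q)"
    by (subst m'(1)) (rule ord_modulus_mult_coprime[OF cop'])
  then show ?thesis using z multiplicity_lcm[OF nz(2,1), of r] r(1) by (simp add: vord_def)
qed

text \<open>The order modulo \<open>m\<close> differs from the order modulo
  \<open>rad m = rad k\<close> by primes of \<open>k\<close> only, so other primes see no dependence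
  on \<open>m\<close>.\<close>

lemma multiplicity_ord_other:
  assumes m: "m dvd k" "\<And>r. prime r \<Longrightarrow> r dvd k \<Longrightarrow> r dvd m" and r: "prime r" "\<not> r dvd k"
  shows "multiplicity r (ord m q) = multiplicity r (ord (rad k) q)"
proof -
  have m0: "m > 0" using m k0 by (auto intro: gr0I)
  have pf: "prime_factors m = prime_factors k"
    using m m0 k0 by (auto simp: in_prime_factors_iff dest: dvd_trans)
  have "ord m q = ord (rad m) q * (\<Prod>r\<in>prime_factors m. r ^ alpha q m r)"
    using m0 m cop by (intro ord_eq_ord_rad_times) (auto intro: coprime_divisors[OF _ dvd_refl])
  moreover have "rad m = rad k" by (simp add: rad_def pf)
  moreover have "\<not> r dvd (\<Prod>r\<in>prime_factors m. r ^ alpha q m r)"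
  proof
    assume "r dvd (\<Prod>r\<in>prime_factors m. r ^ alpha q m r)"
    then obtain s where s: "s \<in> prime_factors m" "r dvd s ^ alpha q m s"
      using r(1) by (auto simp: prime_dvd_prod_iff)
    then have "prime s" "r dvd s" "s dvd m"
      using r(1) prime_dvd_power by (auto simp: in_prime_factors_iff)
    then show False using r m primes_dvd_imp_eq dvd_trans by metis
  qed
  ultimately show ?thesis
    using r(1) by (metis mult.commute multiplicity_prime_elem_times_other prime_imp_prime_elem)
qed

lemma multiplicity_ord_power:
  assumes m: "m dvd k" and "d dvd k" and r: "prime r"
  shows "multiplicity r (ord m (q ^ d)) = multiplicity r (ord m q) - multiplicity r d"
proof -
  have nz: "ord m q \<noteq> 0" "ord m (q ^ d) \<noteq> 0" "d \<noteq> 0" using ord_nonzero[OF m, of 1] ord_nonzero[OF m] assms(2) k0 by auto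
  have "multiplicity r (ord m (q ^ d) * gcd d (ord m q)) = multiplicity r (ord m q)"
    by (simp only: ord_power_aux)
  then have "multiplicity r (ord m (q ^ d)) + min (multiplicity r d) (multiplicity r (ord m q)) = multiplicity r (ord m q)"
    using nz r by (simp add: prime_elem_multiplicity_mult_distrib multiplicity_gcd)
  then show ?thesis by linarith
qed

lemma admissible_multiplicity:
  assumes "admissible d" "prime r" "r dvd k"
  shows "multiplicity r (k div d) = multiplicity r k - multiplicity r d" "multiplicity r d < multiplicity r k"
proof -
  obtain e where e: "k = d * e" using assms(1) by (auto simp: admissible_def)
  have "d > 0" "e > 0" using e k0 by auto
  have "k div d = e" using e \<open>d > 0\<close> by simp
  then have "r dvd e" using assms unfolding admissible_def by blast
  then have "multiplicity r e > 0" using \<open>e > 0\<close> assms(2)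
    by (simp add: prime_multiplicity_gt_zero_iff)
  moreover have "multiplicity r k = multiplicity r d + multiplicity r e"
    using e \<open>d > 0\<close> \<open>e > 0\<close> assms(2) by (simp add: prime_elem_multiplicity_mult_distrib)
  ultimately show "multiplicity r (k div d) = multiplicity r k - multiplicity r d" "multiplicity r d < multiplicity r k"
    using e \<open>d > 0\<close> by auto
qed

lemma admissibleI:
  assumes "d dvd k" "\<And>r. prime r \<Longrightarrow> r dvd k \<Longrightarrow> multiplicity r d < multiplicity r k"
  shows "admissible d"
proof -
  obtain e where e: "k = d * e" using assms(1) by auto
  have "d > 0" "e > 0" using e k0 by auto
  have "r dvd e" if "prime r" "r dvd k" for r
  proof -
    have "multiplicity r k = multiplicity r d + multiplicity r e"
      using e \<open>d > 0\<close> \<open>e > 0\<close> that by (simp add: prime_elem_multiplicity_mult_distrib)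
    then have "multiplicity r e > 0" using assms(2)[OF that] by simp
    then show ?thesis by (metis not_dvd_imp_multiplicity_0 less_irrefl)
  qed
  moreover have "k div d = e" using e \<open>d > 0\<close> by simp
  ultimately show ?thesis using assms(1) unfolding admissible_def by simp
qed

lemma admissible_lcm:
  assumes "admissible d" "admissible T"
  shows "admissible (lcm d T)"
proof (rule admissibleI)
  show "lcm d T dvd k" using assms by (simp add: admissible_def)
  have "d \<noteq> 0" "T \<noteq> 0" using assms k0 by (auto simp: admissible_def)
  then show "multiplicity r (lcm d T) < multiplicity r k" if "prime r" "r dvd k" for r
    using admissible_multiplicity(2)[OF assms(1) that] admissible_multiplicity(2)[OF assms(2) that]
    using that by (simp add: multiplicity_lcm)
qed

lemma multiplicity_ord_adm:
  assumes "admissible l" "d dvd k" "prime r" "r dvd k"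
  shows "multiplicity r (ord (k div l) (q ^ d)) = vord q r (multiplicity r k - multiplicity r l) - multiplicity r d"
  using assms multiplicity_ord_power[of "k div l" d r] multiplicity_ord[of "k div l" r] admissible_multiplicity(1)
  by (auto simp: admissible_def)

lemma multiplicity_ord_adm_other:
  assumes "admissible l" "d dvd k" "prime r" "\<not> r dvd k"
  shows "multiplicity r (ord (k div l) (q ^ d)) = multiplicity r (ord (rad k) q)"
proof -
  have "multiplicity r d = 0" using assms by (metis dvd_trans not_dvd_imp_multiplicity_0)
  then show ?thesis
    using assms multiplicity_ord_power[of "k div l" d r] multiplicity_ord_other[of "k div l" r]
    by (auto simp: admissible_def)
qed

definition vgood :: "nat \<Rightarrow> nat \<Rightarrow> bool" where
  "vgood T d \<longleftrightarrow> (\<forall>r. prime r \<longrightarrow> r dvd k \<longrightarrow>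
     ord_growth.good (vord q r) (multiplicity r k) (multiplicity r T) (multiplicity r d))"

text \<open>These are the order conditions for \<open>gen_down\<close> from \<open>T\<close> to the
  lcm and for \<open>gen_up\<close> from the lcm to \<open>d\<close>. At each prime of
  \<open>k\<close> the first uses the second half of \<open>good\<close>, where both truncated
  differences vanish, and the second uses the first half.\<close>

lemma ord_path:
  assumes d: "admissible d" and T: "admissible T" and good: "vgood T d"
  defines "l \<equiv> lcm d T"
  shows "ord (k div l) (q ^ l) = ord (k div l) (q ^ T)"
    and "ord (k div d) (q ^ d) = (l div d) * ord (k div l) (q ^ d)"
proof -
  have l: "admissible l" unfolding l_def using d T by (rule admissible_lcm)
  have dk: "d dvd k" "T dvd k" "l dvd k" "k div d dvd k" "k div l dvd k" using d T l by (auto simp: admissible_def)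
  have nz: "d \<noteq> 0" "T \<noteq> 0" "l \<noteq> 0" using dk k0 by auto
  have ml: "multiplicity r l = max (multiplicity r d) (multiplicity r T)" if "prime r" for r
    unfolding l_def using nz that by (simp add: multiplicity_lcm)
  have gd: "(multiplicity r d < multiplicity r T \<longrightarrow>
      vord q r (multiplicity r k - multiplicity r d) - multiplicity r d =
      (multiplicity r T - multiplicity r d) + (vord q r (multiplicity r k - multiplicity r T) - multiplicity r d)) \<and>
    (multiplicity r T < multiplicity r d \<longrightarrow> vord q r (multiplicity r k - multiplicity r d) \<le> multiplicity r T)"
    if "prime r" "r dvd k" for r
    using good that unfolding vgood_def ord_growth.good_def[OF growth[OF that], symmetric] by blast
  show "ord (k div l) (q ^ l) = ord (k div l) (q ^ T)"
  proof (rule multiplicity_eq_nat)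
    fix r :: nat assume r: "prime r"
    show "multiplicity r (ord (k div l) (q ^ l)) = multiplicity r (ord (k div l) (q ^ T))"
    proof (cases "r dvd k")
      case True
      show ?thesis
        using gd[OF r True] by (auto simp: multiplicity_ord_adm[OF l _ r True] dk ml[OF r] max_def)
    qed (simp add: multiplicity_ord_adm_other[OF l _ r] dk)
  qed (use ord_nonzero dk in auto)
  obtain e where e: "l = d * e" unfolding l_def by (meson dvd_def dvd_lcm1)
  have e0: "e \<noteq> 0" using e nz by auto
  have "ord (k div d) (q ^ d) = e * ord (k div l) (q ^ d)"
  proof (rule multiplicity_eq_nat)
    fix r :: nat assume r: "prime r"
    have mm: "multiplicity r l = multiplicity r d + multiplicity r e"
      using e nz e0 r by (simp add: prime_elem_multiplicity_mult_distrib)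
    have me: "multiplicity r (e * ord (k div l) (q ^ d)) = multiplicity r e + multiplicity r (ord (k div l) (q ^ d))"
      using e0 ord_nonzero[OF dk(5)] r by (simp add: prime_elem_multiplicity_mult_distrib)
    show "multiplicity r (ord (k div d) (q ^ d)) = multiplicity r (e * ord (k div l) (q ^ d))"
    proof (cases "r dvd k")
      case True
      show ?thesis
        using gd[OF r True] mm unfolding me
        by (auto simp: multiplicity_ord_adm[OF l _ r True] multiplicity_ord_adm[OF d _ r True] dk ml[OF r] max_def split: if_splits)
    next
      case False
      have "multiplicity r e = 0"
        using False e dk(3) by (metis dvd_mult_right dvd_trans not_dvd_imp_multiplicity_0)
      then show ?thesis
        unfolding me using False by (simp add: multiplicity_ord_adm_other[OF l _ r] multiplicity_ord_adm_other[OF d _ r] dk)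
    qed
  qed (use ord_nonzero dk e0 in auto)
  then show "ord (k div d) (q ^ d) = (l div d) * ord (k div l) (q ^ d)"
    using e nz by simp
qed

text \<open>Regularity removes \<open>r\<close> from \<open>ord (rad k) q\<close>, so
  \<open>alpha q k r\<close> is the full valuation of \<open>ord k q\<close>.\<close>

lemma multiplicity_tau:
  assumes "prime r" "r dvd k"
  shows "multiplicity r (tau q k) = vord q r (multiplicity r k) div 2"
proof -
  have rk: "r \<in> prime_factors k" using assms k0 by (simp add: in_prime_factors_iff)
  have "ord (rad k) q dvd ord k q"
    using ord_eq_ord_rad_times[OF k0 cop] by simp
  then obtain t where t: "ord k q = ord (rad k) q * t" by blast
  have nz: "ord k q \<noteq> 0" using ord_nonzero[of k 1] by simp
  then have "alpha q k r = multiplicity r t" using t by (simp add: alpha_def)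
  also have "\<dots> = multiplicity r (ord k q)"
    using t assms(1) not_dvd_ord_rad[OF assms]
    by (simp add: multiplicity_prime_elem_times_other)
  also have "\<dots> = vord q r (multiplicity r k)" using multiplicity_ord assms by simp
  finally have "alpha q k r = vord q r (multiplicity r k)" .
  moreover have "multiplicity r (tau q k) = alpha q k r div 2"
    unfolding tau_def using rk by (subst multiplicity_prod_prime_powers) (auto simp: in_prime_factors_iff assms)
  ultimately show ?thesis by simp
qed

lemma multiplicity_tau_other:
  assumes "prime r" "\<not> r dvd k"
  shows "multiplicity r (tau q k) = 0"
  unfolding tau_def using assms by (subst multiplicity_prod_prime_powers) (auto simp: in_prime_factors_iff)

lemma tau_nonzero: "tau q k \<noteq> 0"
  by (auto simp: tau_def in_prime_factors_iff)

lemma multiplicity_pos: "prime r \<Longrightarrow> r dvd k \<Longrightarrow> multiplicity r k \<ge> 1"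
  using k0 by (metis One_nat_def Suc_leI bot_nat_0.not_eq_extremum prime_multiplicity_gt_zero_iff prime_imp_prime_elem)

lemma tau_admissible: "admissible (tau q k)"
proof (rule admissibleI)
  have lt: "multiplicity r (tau q k) < multiplicity r k" if "prime r" "r dvd k" for r
    using multiplicity_tau[OF that] ord_growth.less[OF growth[OF that] multiplicity_pos[OF that]] by simp
  then show "\<And>r. prime r \<Longrightarrow> r dvd k \<Longrightarrow> multiplicity r (tau q k) < multiplicity r k" .
  show "tau q k dvd k"
  proof (rule multiplicity_le_imp_dvd[OF tau_nonzero])
    fix r :: nat assume "prime r"
    then show "multiplicity r (tau q k) \<le> multiplicity r k"
      using lt[of r] multiplicity_tau_other[of r] by (cases "r dvd k") auto
  qed
qed

text \<open>Dividing the modulus by \<open>tau q k\<close> and raising \<open>q\<close> to that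
  power each remove one factor \<open>tau q k\<close> from the order: the first by
  \<open>descend_half\<close>, the second by the order formula for powers.\<close>

lemma ord_tau: "ord (k div tau q k) (q ^ tau q k) * (tau q k)^2 = ord k q"
proof (rule multiplicity_eq_nat)
  have tk: "tau q k dvd k" using tau_admissible by (simp add: admissible_def)
  have nz: "ord (k div tau q k) (q ^ tau q k) \<noteq> 0"
  proof (rule ord_nonzero)
    show "k div tau q k dvd k" using tk by (metis dvd_div_mult_self dvd_triv_left)
  qed
  show "ord (k div tau q k) (q ^ tau q k) * (tau q k)^2 > 0" "ord k q > 0"
    using nz tau_nonzero ord_nonzero[of k 1] by auto
  fix r :: nat assume r: "prime r"
  have "multiplicity r (ord (k div tau q k) (q ^ tau q k) * (tau q k)^2) =
      multiplicity r (ord (k div tau q k) (q ^ tau q k)) + 2 * multiplicity r (tau q k)"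
    using nz tau_nonzero r by (simp add: prime_elem_multiplicity_mult_distrib prime_elem_multiplicity_power_distrib)
  also have "\<dots> = multiplicity r (ord k q)"
  proof (cases "r dvd k")
    case True
    have "vord q r (multiplicity r k - vord q r (multiplicity r k) div 2) = vord q r (multiplicity r k) - vord q r (multiplicity r k) div 2"
      by (rule ord_growth.descend_half[OF growth[OF r True] multiplicity_pos[OF r True]])
    then show ?thesis
      using multiplicity_ord[OF dvd_refl r True]
      by (simp add: multiplicity_ord_adm[OF tau_admissible tk r True] multiplicity_tau[OF r True])
  next
    case False
    then show ?thesis
      using multiplicity_ord_other[OF dvd_refl _ r False]
      by (simp add: multiplicity_ord_adm_other[OF tau_admissible tk r False] multiplicity_tau_other[OF r False])
  qed
  finally show "multiplicity r (ord (k div tau q k) (q ^ tau q k) * (tau q k)^2) = multiplicity r (ord k q)" .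
qed

text \<open>This is the case excluded in \<open>good_half\<close> for \<open>r = 2\<close>:
  \<open>q mod 4 = 3\<close> means order 2 modulo 4, and the order modulo a power of 2 is itself a
  power of 2, so it equals 2 exactly when its valuation is 1.\<close>

lemma exceptional_iff:
  "exceptional q k \<longleftrightarrow> even k \<and> vord q 2 2 \<noteq> 0 \<and> vord q 2 (multiplicity 2 k) = 1 \<and> multiplicity 2 k \<ge> 3"
proof (cases "even k")
  case False
  then have "\<not> exceptional q k" by (auto simp: exceptional_def)
  then show ?thesis using False by simp
next
  case True
  then have q: "odd q" using coprime_prime[of 2] by simp
  obtain l where l: "k = 2 ^ multiplicity 2 k * l" "odd l"
    using multiplicity_decompose'[of k 2] k0 by auto
  let ?c = "multiplicity 2 k"
  have uniq: "c = ?c" if "odd l'" "k = 2 ^ c * l'" for c l'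
    using that by (intro multiplicity_decomposeI[symmetric]) auto
  have q4: "q mod 4 = 3 \<longleftrightarrow> vord q 2 2 \<noteq> 0"
  proof (cases "q mod 4 = 3")
    case True
    then have "ord 4 q = ord (4::nat) (3::nat)" by (intro ord_cong) (auto simp: cong_def)
    then show ?thesis using True by (simp add: vord_def)
  next
    case False
    then have "[q = 1] (mod 4)" using q unfolding cong_def by presburger
    then have "ord 4 q = 1" by (simp add: ord_eq_Suc_0_iff)
    then show ?thesis using False by (simp add: vord_def)
  qed
  have o2: "ord (2 ^ ?c) q = 2 \<longleftrightarrow> vord q 2 ?c = 1" if "?c \<ge> 3"
  proof -
    have "ord (2 ^ ?c) q dvd totient (2 ^ ?c)"
      using q by (intro order_divides_totient) simp
    also have "\<dots> = 2 ^ (?c - 1)" using that by (simp add: totient_prime_power)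
    finally obtain i where i: "ord (2 ^ ?c) q = 2 ^ i" by (metis divides_primepow_nat two_is_prime_nat)
    then have "vord q 2 ?c = i" by (simp add: vord_def)
    then show ?thesis using i by (cases i) auto
  qed
  show ?thesis
  proof
    assume "exceptional q k"
    then obtain c l' where "odd l'" "k = 2 ^ c * l'" "q mod 4 = 3" "c \<ge> 3" "ord (2 ^ c) q = 2"
      by (auto simp: exceptional_def)
    then show "even k \<and> vord q 2 2 \<noteq> 0 \<and> vord q 2 ?c = 1 \<and> ?c \<ge> 3"
      using uniq[of l' c] q4 o2 True by auto
  next
    assume "even k \<and> vord q 2 2 \<noteq> 0 \<and> vord q 2 ?c = 1 \<and> ?c \<ge> 3"
    then show "exceptional q k" using l q4 o2 unfolding exceptional_def by blast
  qed
qed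

lemma vgood_tau:
  assumes d: "admissible d" and ne: "\<not> exceptional q k \<or> odd d"
  shows "vgood (tau q k) d"
  unfolding vgood_def
proof (intro allI impI)
  fix r assume r: "prime r" "r dvd k"
  interpret ord_growth "vord q r" "odd r" using growth[OF r] .
  show "good (multiplicity r k) (multiplicity r (tau q k)) (multiplicity r d)"
    unfolding multiplicity_tau[OF r]
  proof (cases "r = 2 \<and> exceptional q k")
    case True
    then have "multiplicity r d = 0" using ne by (simp add: not_dvd_imp_multiplicity_0)
    then show "good (multiplicity r k) (vord q r (multiplicity r k) div 2) (multiplicity r d)"
      using True exceptional_iff by (intro good_exceptional) auto
  next
    case False
    then have "\<not> (\<not> odd r \<and> vord q r 2 \<noteq> 0 \<and> vord q r (multiplicity r k) = 1 \<and> multiplicity r k \<ge> 3)"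
      using exceptional_iff r primes_dvd_imp_eq two_is_prime_nat by blast
    then show "good (multiplicity r k) (vord q r (multiplicity r k) div 2) (multiplicity r d)"
      using multiplicity_pos[OF r] admissible_multiplicity(2)[OF d r] by (intro good_half)
  qed
qed

lemma exceptional_odd_tau:
  assumes "exceptional q k" shows "odd (tau q k)"
proof -
  have "multiplicity 2 (tau q k) = 0"
    using multiplicity_tau[of 2] exceptional_iff assms by simp
  then show ?thesis using tau_nonzero by (simp add: multiplicity_eq_zero_iff)
qed

lemma multiplicity_two_tau:
  assumes "exceptional q k" "prime r"
  shows "multiplicity r (2 * tau q k) = (if r = 2 then 1 else multiplicity r (tau q k))"
proof (cases "r = 2")
  case True
  then show ?thesis using exceptional_odd_tau[OF assms(1)] tau_nonzero
    by (simp add: multiplicity_times_same not_dvd_imp_multiplicity_0)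
next
  case False
  then have "\<not> r dvd 2" using assms(2) primes_dvd_imp_eq two_is_prime_nat by blast
  then show ?thesis using assms(2) False by (simp add: multiplicity_prime_elem_times_other)
qed

lemma two_tau_admissible:
  assumes "exceptional q k" shows "admissible (2 * tau q k)"
proof (rule admissibleI)
  have ek: "even k" "multiplicity 2 k \<ge> 3" using exceptional_iff assms by auto
  show "2 * tau q k dvd k"
    using ek exceptional_odd_tau[OF assms] tau_admissible
    by (intro divides_mult) (auto simp: admissible_def)
  show "multiplicity r (2 * tau q k) < multiplicity r k" if "prime r" "r dvd k" for r
    using ek admissible_multiplicity(2)[OF tau_admissible that] by (simp add: multiplicity_two_tau[OF assms that(1)])
qed

text \<open>The extra factor 2 only raises the exponent at the prime 2 from 0 to 1, as even degrees
  require; odd primes are handled as for \<open>tau q k\<close>.\<close>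

lemma vgood_two_tau:
  assumes ex: "exceptional q k" and d: "admissible d" "even d"
  shows "vgood (2 * tau q k) d"
  unfolding vgood_def
proof (intro allI impI)
  fix r assume r: "prime r" "r dvd k"
  interpret ord_growth "vord q r" "odd r" using growth[OF r] .
  show "good (multiplicity r k) (multiplicity r (2 * tau q k)) (multiplicity r d)"
  proof (cases "r = 2")
    case True
    have "d \<noteq> 0" using d k0 by (auto simp: admissible_def)
    then have "multiplicity r d \<ge> 1"
      using d(2) True by (metis Suc_leI One_nat_def multiplicity_eq_zero_iff not_gr_zero not_prime_unit two_is_prime_nat)
    then show ?thesis
      using True ex exceptional_iff admissible_multiplicity(2)[OF d(1) r] multiplicity_two_tau[OF ex r(1)]
      by (intro good_exceptional) auto
  next
    case False
    then have "odd r" using r(1) primes_dvd_imp_eq two_is_prime_nat by blast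
    then show ?thesis
      using False multiplicity_pos[OF r] admissible_multiplicity(2)[OF d(1) r] multiplicity_two_tau[OF ex r(1)] multiplicity_tau[OF r]
      by (simp add: good_half)
  qed
qed

end

section \<open>Complete generators of the components\<close>

context regular_pair
begin

text \<open>By monotonicity \<open>vord q 2\<close> is 1 at both \<open>multiplicity 2 k - 1\<close>
  and \<open>multiplicity 2 k\<close>. So halving the modulus keeps the order, while squaring the
  base as well halves it.\<close>

lemma exceptional_ord:
  assumes ex: "exceptional q k"
  shows "ord (k div (2 * tau q k)) (q ^ tau q k) = ord (k div tau q k) (q ^ tau q k)"
    and "ord (k div tau q k) (q ^ tau q k) = 2 * ord (k div (2 * tau q k)) (q ^ (2 * tau q k))"
proof -
  note adm = tau_admissible two_tau_admissible[OF ex]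
  have dk: "tau q k dvd k" "2 * tau q k dvd k" using adm by (auto simp: admissible_def)
  then have dk': "k div tau q k dvd k" "k div (2 * tau q k) dvd k" by (metis dvd_div_mult_self dvd_triv_left)+
  note nz = ord_nonzero[OF dk'(1)] ord_nonzero[OF dk'(2)]
  have e: "even k" "vord q 2 2 \<noteq> 0" "vord q 2 (multiplicity 2 k) = 1" "multiplicity 2 k \<ge> 3"
    using ex exceptional_iff by auto
  interpret two: ord_growth "vord q 2" "odd (2 :: nat)"
    using growth[OF two_is_prime_nat e(1)] .
  have "vord q 2 2 \<le> vord q 2 (multiplicity 2 k - 1)" "vord q 2 (multiplicity 2 k - 1) \<le> vord q 2 (multiplicity 2 k)"
    using e(4) by (auto intro!: two.mono)
  then have v: "vord q 2 (multiplicity 2 k - 1) = 1" using e by linarith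
  have mt: "multiplicity 2 (tau q k) = 0"
    using exceptional_odd_tau[OF ex] by (simp add: not_dvd_imp_multiplicity_0)
  note mo = multiplicity_ord_adm[OF adm(1)] multiplicity_ord_adm[OF adm(2)]
    multiplicity_ord_adm_other[OF adm(1)] multiplicity_ord_adm_other[OF adm(2)]
  show "ord (k div (2 * tau q k)) (q ^ tau q k) = ord (k div tau q k) (q ^ tau q k)"
  proof (rule multiplicity_eq_nat)
    fix r :: nat assume r: "prime r"
    show "multiplicity r (ord (k div (2 * tau q k)) (q ^ tau q k)) = multiplicity r (ord (k div tau q k) (q ^ tau q k))"
      using r dk e v mt by (cases "r dvd k") (auto simp: mo multiplicity_two_tau[OF ex r])
  qed (use nz in auto)
  show "ord (k div tau q k) (q ^ tau q k) = 2 * ord (k div (2 * tau q k)) (q ^ (2 * tau q k))"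
  proof (rule multiplicity_eq_nat)
    fix r :: nat assume r: "prime r"
    have "multiplicity r 2 = (if r = 2 then 1 else 0)"
      using r by (simp add: prime_multiplicity_other)
    then have m2: "multiplicity r (2 * ord (k div (2 * tau q k)) (q ^ (2 * tau q k))) =
        (if r = 2 then 1 else 0) + multiplicity r (ord (k div (2 * tau q k)) (q ^ (2 * tau q k)))"
      using r nz by (simp add: prime_elem_multiplicity_mult_distrib)
    show "multiplicity r (ord (k div tau q k) (q ^ tau q k)) = multiplicity r (2 * ord (k div (2 * tau q k)) (q ^ (2 * tau q k)))"
      unfolding m2 using r dk e v mt by (cases "r dvd k") (auto simp: mo multiplicity_two_tau[OF ex r])
  qed (use nz in auto)
qed

end

text \<open>Multiplication by \<open>X\<close> exchanges the two parts, which drives the induction.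
  The coefficient formulas show that both parts are defined over the same subfield as
  \<open>f\<close>.\<close>

lemma poly_even_odd_parts:
  fixes f :: "'a :: comm_ring_1 poly"
  obtains a b where "f = pcompose a (monom 1 2) + monom 1 1 * pcompose b (monom 1 2)"
    "\<And>i. coeff a i = coeff f (2 * i)" "\<And>i. coeff b i = coeff f (2 * i + 1)"
proof -
  have "\<exists>a b. f = pcompose a (monom 1 2) + monom 1 1 * pcompose b (monom 1 2) \<and>
    (\<forall>i. coeff a i = coeff f (2 * i)) \<and> (\<forall>i. coeff b i = coeff f (2 * i + 1))"
  proof (induction f)
    case 0
    then show ?case by (intro exI[of _ 0]) simp
  next
    case (pCons c f)
    then obtain a b where ab: "f = pcompose a (monom 1 2) + monom 1 1 * pcompose b (monom 1 2)"
      "\<forall>i. coeff a i = coeff f (2 * i)" "\<forall>i. coeff b i = coeff f (2 * i + 1)" by blast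
    have "pCons c f = [:c:] + monom 1 1 * f" by (simp add: monom_Suc monom_0)
    also have "\<dots> = pcompose (pCons c b) (monom 1 2) + monom 1 1 * pcompose a (monom 1 2)"
      by (subst ab(1)) (simp add: pcompose_pCons algebra_simps monom_Suc monom_0 numeral_2_eq_2)
    finally have "pCons c f = pcompose (pCons c b) (monom 1 2) + monom 1 1 * pcompose a (monom 1 2)" .
    moreover have "coeff (pCons c b) i = coeff (pCons c f) (2 * i)" for i
      using ab(3) by (cases i) simp_all
    moreover have "coeff a i = coeff (pCons c f) (2 * i + 1)" for i
      using ab(2) by simp
    ultimately show ?case by blast
  qed
  then show thesis using that by blast
qed

text \<open>Four lines through a point of a plane of order \<open>N\<close>: each new one adds
  \<open>N - 1\<close> points to the union, which ends with \<open>4 * N - 3\<close>.\<close>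

lemma card_Diff_four_lines:
  fixes K0 A1 A2 A3 A4 :: "'b set" and N :: nat
  assumes "finite K0" "card K0 = N\<^sup>2" "A1 \<subseteq> K0" "A2 \<subseteq> K0" "A3 \<subseteq> K0" "A4 \<subseteq> K0"
    and "card A1 = N" "card A2 = N" "card A3 = N" "card A4 = N"
    and "A1 \<inter> A2 = {z}" "A1 \<inter> A3 = {z}" "A1 \<inter> A4 = {z}" "A2 \<inter> A3 = {z}" "A2 \<inter> A4 = {z}" "A3 \<inter> A4 = {z}"
  shows "int (card (K0 - (A1 \<union> A2 \<union> A3 \<union> A4))) = (int N)\<^sup>2 - 4 * int N + 3"
proof -
  have fin: "finite A1" "finite A2" "finite A3" "finite A4"
    by (rule finite_subset[OF assms(3) assms(1)] finite_subset[OF assms(4) assms(1)] finite_subset[OF assms(5) assms(1)] finite_subset[OF assms(6) assms(1)])+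
  have "(A1 \<union> A2) \<inter> A3 = {z}" "(A1 \<union> A2 \<union> A3) \<inter> A4 = {z}"
    by (simp_all add: Int_Un_distrib2 assms(11-16))
  then have "card (A1 \<union> A2) + 1 = 2 * N" "card (A1 \<union> A2 \<union> A3) + 1 = card (A1 \<union> A2) + N"
    "card (A1 \<union> A2 \<union> A3 \<union> A4) + 1 = card (A1 \<union> A2 \<union> A3) + N"
    using card_Un_Int[of A1 A2] card_Un_Int[of "A1 \<union> A2" A3] card_Un_Int[of "A1 \<union> A2 \<union> A3" A4] fin assms(7-11)
    by auto
  then have u: "int (card (A1 \<union> A2 \<union> A3 \<union> A4)) = 4 * int N - 3" by linarith
  have "A1 \<union> A2 \<union> A3 \<union> A4 \<subseteq> K0" using assms by blast
  then have "int (card (K0 - (A1 \<union> A2 \<union> A3 \<union> A4))) = int (card K0) - int (card (A1 \<union> A2 \<union> A3 \<union> A4))"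
    using assms(1) fin card_Diff_subset[of "A1 \<union> A2 \<union> A3 \<union> A4" K0] card_mono[of K0 "A1 \<union> A2 \<union> A3 \<union> A4"]
    by (simp add: of_nat_diff)
  then show ?thesis using u assms(2) by simp
qed

context char_p
begin

text \<open>Elements of order \<open>m * e\<close> are counted as \<open>e\<close>-th roots of the
  elements of order \<open>m\<close>.\<close>

lemma totient_mult_same_primes:
  assumes "\<not> p dvd m" "\<not> p dvd e" "\<And>r. prime r \<Longrightarrow> r dvd e \<Longrightarrow> r dvd m"
  shows "totient (m * e) = e * totient m"
proof -
  have "\<not> p dvd m * e" using assms p prime_dvd_mult_iff by blast
  moreover have "0 \<notin> prim m" using prim_nonzero assms(1) not_p_dvd_pos by blast
  ultimately show ?thesis
    using card_pre(2)[OF assms(2) finite_prim[OF assms(1)]] pre_prim[of m e] assms not_p_dvd_pos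
    by (simp add: card_prim)
qed

text \<open>The condition at \<open>T\<close> passes down to the lcm of \<open>d\<close> and
  \<open>T\<close> and from there up to \<open>d\<close>.\<close>

lemma gen_path:
  assumes q: "pw q" and k: "\<not> p dvd k" and rp: "regular_pair q k"
    and d: "regular_pair.admissible k d" and T: "regular_pair.admissible k T"
    and good: "regular_pair.vgood q k T d" and gen: "gen (q ^ T) (k div T) w"
  shows "gen (q ^ d) (k div d) w"
proof -
  interpret regular_pair q k by (rule rp)
  define l where "l = lcm d T"
  have l: "admissible l" unfolding l_def using d T by (rule admissible_lcm)
  have dk: "d dvd k" "T dvd k" "l dvd k" using d T l by (auto simp: admissible_def)
  obtain m where m: "k = l * m" using dk by blast
  obtain e where e: "l = d * e" unfolding l_def by (meson dvd_def dvd_lcm1)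
  obtain e' where e': "l = T * e'" unfolding l_def by (meson dvd_def dvd_lcm2)
  have pos: "d > 0" "T > 0" "e > 0" "e' > 0" "l > 0" "m > 0" using m e e' k0 by (auto intro: gr0I)
  have "k = T * e' * m" using m e' by simp
  with k m e have np: "\<not> p dvd m" "\<not> p dvd e" "\<not> p dvd e'" by (metis dvd_mult dvd_mult2)+
  have "k = d * (m * e)" "k = T * (m * e')" using m e e' by simp_all
  then have div: "k div l = m" "k div d = m * e" "k div T = m * e'" "l div d = e"
    using pos m e by (metis nonzero_mult_div_cancel_left less_numeral_extra(3))+
  have pr: "r dvd m" if "prime r" "r dvd k" for r
    using l that div(1) by (simp add: admissible_def)
  have Q: "pw (q ^ T)" "pw (q ^ d)" using q pos pw_power by auto
  note path = ord_path[OF d T good, folded l_def, unfolded div]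
  have ll: "(q ^ T) ^ e' = q ^ l" "(q ^ d) ^ e = q ^ l" by (simp_all add: e[symmetric] e'[symmetric] flip: power_mult)
  have "gen ((q ^ T) ^ e') m w"
    using gen path(1) div by (intro gen_down[OF Q(1) np(1,3)] pr) (auto simp: m e' ll)
  then have "gen ((q ^ d) ^ e) m w" by (simp add: ll)
  then have "gen (q ^ d) (m * e) w"
    using path(2) by (intro gen_up[OF Q(2) np(1,2)] pr) (auto simp: m e)
  then show ?thesis by (simp add: div)
qed

definition compgen :: "nat \<Rightarrow> nat \<Rightarrow> 'l \<Rightarrow> bool" where
  "compgen q k w \<longleftrightarrow> (\<forall>d. regular_pair.admissible k d \<longrightarrow> gen (q ^ d) (k div d) w)"

lemma card_compgen_nonexceptional:
  assumes q: "pw q" and k: "\<not> p dvd k" and rp: "regular_pair q k" and ne: "\<not> exceptional q k"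
  shows "card {w. compgen q k w} = (q ^ (ord k q div tau q k) - 1) ^ (tau q k * totient k div ord k q)"
proof -
  interpret regular_pair q k by (rule rp)
  define T where "T = tau q k"
  have T: "admissible T" unfolding T_def by (rule tau_admissible)
  obtain m where m: "k = T * m" using T by (auto simp: admissible_def)
  have pos: "T > 0" "m > 0" using m k0 by (auto intro: gr0I)
  have div: "k div T = m" using m pos by simp
  have np: "\<not> p dvd m" "\<not> p dvd T" using k m by auto
  have Q: "pw (q ^ T)" using q pos pw_power by auto
  have pr: "r dvd m" if "prime r" "r dvd k" for r
    using T that div by (simp add: admissible_def)
  have "{w. compgen q k w} = {w. gen (q ^ T) m w}"
    using gen_path[OF q k rp _ T vgood_tau[folded T_def]] T ne div unfolding compgen_def by auto
  then have c: "card {w. compgen q k w} = ((q ^ T) ^ ord m (q ^ T) - 1) ^ (totient m div ord m (q ^ T))"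
    by (simp add: card_gen[OF Q np(1)])
  \<comment> \<open>One factor \<open>T\<close> belongs to the base \<open>q ^ T\<close>, the other
    cancels against \<open>totient k = T * totient m\<close>.\<close>
  have o: "ord k q = ord m (q ^ T) * T\<^sup>2" using ord_tau by (simp add: T_def[symmetric] div)
  have 1: "ord k q div T = T * ord m (q ^ T)" using pos by (simp add: o power2_eq_square)
  have "totient k = T * totient m"
    using totient_mult_same_primes[OF np] pr m by (simp add: mult.commute)
  then have "T * totient k div ord k q = totient m div ord m (q ^ T)"
    using pos unfolding o power2_eq_square by (simp add: div_mult_mult1 mult.assoc[symmetric] mult.commute[of _ "T * T"])
  then show ?thesis using c 1 by (simp add: T_def power_mult)
qed

text \<open>Frobenius commutes with a linearized map up to twisting its coefficients. The exponent
  \<open>Q'\<close> is independent of \<open>Q\<close>, as needed for the action of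
  \<open>Q\<^sup>2\<close>.\<close>

lemma act_frobp: "pw Q \<Longrightarrow> act Q' (frobp Q (P :: 'l poly)) (v ^ Q) = (act Q' P v) ^ Q"
  by (simp add: act_def degree_frobp coeff_map_poly zero_pw sum_pw power_mult_distrib mult.commute flip: power_mult)

lemma frobp_pcompose:
  assumes Q: "pw Q" and "frobp Q c = (c :: 'l poly)"
  shows "frobp Q (pcompose c (monom 1 e)) = pcompose c (monom 1 e)"
  using assms(2)
proof (induction c)
  case (pCons x c)
  then have x: "x ^ Q = x" "frobp Q c = c" using Q by (auto simp: map_poly_pCons zero_pw)
  have "frobp Q (monom 1 e :: 'l poly) = monom 1 e"
    using Q by (simp add: frobp_iff zero_pw coeff_monom)
  then show ?case using Q pCons.IH[OF x(2)] x(1)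
    by (simp add: pcompose_pCons frobp_add frobp_mult map_poly_pCons zero_pw)
qed simp

text \<open>Writing \<open>f = a(X\<^sup>2) + X b(X\<^sup>2)\<close> for the minimal polynomial \<open>f\<close> of \<open>z\<close>, Frobenius swaps the
  kernels of \<open>U\<close> and \<open>V\<close>, so both parts of \<open>f\<close> annihilate \<open>w\<close>; hence \<open>w\<close> is also annihilated
  by \<open>f(-X)\<close>, which is coprime to \<open>f\<close>.\<close>
lemma transversal:
  assumes Q: "pw Q" and m: "\<not> p dvd m" and z: "z \<in> prim m"
    and neg: "\<And>y. y \<in> orb Q z \<Longrightarrow> - y \<notin> orb Q z"
    and U: "stable (Q\<^sup>2) U" and V: "stable (Q\<^sup>2) V" "V = (\<lambda>x. x ^ Q) ` U" "U \<inter> V = {}"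
    and w: "w \<in> K Q (orb Q z)" "w \<in> K (Q\<^sup>2) U"
  shows "w = 0"
proof -
  define f where "f = PP (orb Q z)"
  have so: "stable Q (orb Q z)" using stable_orb[OF Q m z] .
  have ff: "frobp Q f = f" unfolding f_def by (rule frobp_PP[OF Q so])
  have Q2: "pw (Q\<^sup>2)" using Q by (simp add: pw_power)
  obtain a b where ab: "f = pcompose a (monom 1 2) + monom 1 1 * pcompose b (monom 1 2)"
    "\<And>i. coeff a i = coeff f (2 * i)" "\<And>i. coeff b i = coeff f (2 * i + 1)"
    using poly_even_odd_parts[of f] by blast
  have fab: "frobp Q a = a" "frobp Q b = b" using ff ab(2,3) by (simp_all add: frobp_iff[OF Q])
  have fab2: "frobp (Q\<^sup>2) a = a" "frobp (Q\<^sup>2) b = b" using fab frobp_fixed_power[OF Q] by auto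
  define g where "g = pcompose a (monom 1 2) - monom 1 1 * pcompose b (monom 1 2)"
  have fg: "frobp Q g = g"
  proof -
    note frobp_pcompose[OF Q]
    moreover have "frobp Q (monom 1 1 :: 'l poly) = monom 1 1"
      using Q by (simp add: frobp_iff zero_pw coeff_monom)
    ultimately show ?thesis unfolding g_def using Q fab by (simp add: frobp_diff frobp_mult)
  qed
  have actf: "act Q f w = act (Q\<^sup>2) a w + act (Q\<^sup>2) b (w ^ Q)"
    unfolding ab(1) by (simp add: act_add act_monom_mult act_pcompose_monom)
  have actg: "act Q g w = act (Q\<^sup>2) a w - act (Q\<^sup>2) b (w ^ Q)"
    unfolding g_def by (simp add: act_diff act_monom_mult act_pcompose_monom)
  have inU: "act (Q\<^sup>2) a w \<in> K (Q\<^sup>2) U"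
    using w(2) act_commute[OF Q2 frobp_PP[OF Q2 U] fab2(1)] by (simp add: K_def act_zero[OF Q2])
  have "w ^ Q \<in> K (Q\<^sup>2) V"
    using w(2) act_frobp[OF Q, of "Q\<^sup>2" "PP U" w] frobp_PP_image[OF Q stable_finite[OF U]] V(2)
    by (simp add: K_def zero_pw[OF Q])
  then have inV: "act (Q\<^sup>2) b (w ^ Q) \<in> K (Q\<^sup>2) V"
    using act_commute[OF Q2 frobp_PP[OF Q2 V(1)] fab2(2)] by (simp add: K_def act_zero[OF Q2])
  have fw: "act Q f w = 0" using w(1) by (simp add: K_def f_def)
  then have "act (Q\<^sup>2) a w = 0 - act (Q\<^sup>2) b (w ^ Q)" using actf by (simp add: eq_neg_iff_add_eq_0)
  then have "act (Q\<^sup>2) a w \<in> K (Q\<^sup>2) V" using inV K_diff[OF Q2 zero_in_K[OF Q2]] by metis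
  with inU have "act (Q\<^sup>2) a w \<in> K (Q\<^sup>2) (U \<inter> V)" using K_Int[OF Q2 U V(1)] by auto
  then have a0: "act (Q\<^sup>2) a w = 0" using V(3) by (simp add: K_empty)
  then have gw: "act Q g w = 0" using fw actf actg by simp
  have pg: "poly g x = poly f (- x)" for x
    unfolding g_def by (subst ab(1)) (simp add: poly_pcompose poly_monom)
  have "poly g x \<noteq> 0" if "poly f x = 0" for x
    using that neg stable_finite[OF so] unfolding pg f_def by (auto simp: poly_PP_eq_0_iff)
  then show ?thesis
    by (intro act_coprime_zero[OF Q ff fg _ _ fw gw]) (auto simp: f_def PP_nonzero)
qed

section \<open>Counting the blocks of an exceptional component\<close>

context
  fixes Q m h :: nat
  assumes Q: "pw Q" and m: "\<not> p dvd m" and mh: "m = h * 2" and h2: "even h"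
    and oh: "ord h Q = ord m Q" and o2: "ord m Q = 2 * ord h (Q\<^sup>2)"
begin

lemma h_not_dvd: "\<not> p dvd h" "\<not> p dvd 2"
  using m mh by auto

lemma pw_sq: "pw (Q\<^sup>2)"
  using Q by (simp add: pw_power)

lemma pre_prim_two: "pre 2 (prim h) = prim m"
  unfolding mh
proof (rule pre_prim)
  show "r dvd h" if "prime r" "r dvd 2" for r
    using that h2 primes_dvd_imp_eq two_is_prime_nat by blast
qed (use h_not_dvd not_p_dvd_pos in auto)

text \<open>If \<open>- y\<close> is \<open>y ^ (Q ^ i)\<close>, then \<open>y\<^sup>2\<close>, of
  order \<open>h\<close>, is fixed by this power of Frobenius. Since the orders of \<open>Q\<close>
  modulo \<open>h\<close> and \<open>m\<close> agree, \<open>y\<close> is fixed too, so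
  \<open>- y = y\<close>, which is impossible as \<open>p\<close> is odd.\<close>

lemma neg_not_in_orb:
  assumes "z \<in> prim m" "y \<in> orb Q z"
  shows "- y \<notin> orb Q z"
proof
  assume "- y \<in> orb Q z"
  then have "- y \<in> orb Q y" using orb_eq[OF Q m assms] by simp
  then obtain i where i: "- y = y ^ (Q ^ i)" by (auto simp: orb_def)
  have y: "y \<in> prim m" using assms orb_sub_prim[OF Q m] by blast
  have cop: "coprime m Q" "coprime h Q" using pw_coprime[OF Q] m h_not_dvd by auto
  have y2: "y\<^sup>2 \<in> prim h" using y pre_prim_two by (auto simp: pre_def)
  have "(y\<^sup>2) ^ (Q ^ i) = (- y)\<^sup>2" unfolding i by (simp add: mult.commute flip: power_mult)
  then have "(y\<^sup>2) ^ (Q ^ i) = (y\<^sup>2) ^ (Q ^ 0)" by simp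
  then have "[Q ^ i = Q ^ 0] (mod h)" using prim_pow_cong[OF _ y2] h_not_dvd not_p_dvd_pos by blast
  then have "[i = 0] (mod ord h Q)" using order_divides_expdiff[OF cop(2)] by blast
  then have "[Q ^ i = Q ^ 0] (mod m)" by (simp only: order_divides_expdiff[OF cop(1)] oh)
  then have "y ^ (Q ^ i) = y ^ (Q ^ 0)" using prim_pow_cong[OF _ y] m not_p_dvd_pos by blast
  then have "- y = y" using i by simp
  then have "of_nat 2 * y = 0" by (simp add: neg_eq_iff_add_eq_0 flip: mult_2)
  moreover have "y \<noteq> 0" using y prim_nonzero m not_p_dvd_pos by blast
  ultimately show False using of_nat_nonzero[OF h_not_dvd(2)] by simp
qed

text \<open>The preimage of \<open>Y\<close> under squaring consists of the \<open>Q\<close>-orbits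
  of the two square roots of \<open>y\<close>, while \<open>Y\<close> consists of two
  \<open>Q\<^sup>2\<close>-orbits swapped by Frobenius. This gives two pairs of forbidden subspaces;
  disjoint root sets separate each pair, and \<open>transversal\<close> separates members of
  different pairs.\<close>

lemma card_block:
  assumes y: "y \<in> prim h"
  defines "Y \<equiv> orb Q y"
  defines "C \<equiv> {w \<in> K Q (pre 2 Y). (\<forall>z\<in>pre 2 Y. act Q (PP (pre 2 Y - orb Q z)) w \<noteq> 0) \<and>
    (\<forall>x\<in>Y. act (Q\<^sup>2) (PP (Y - orb (Q\<^sup>2) x)) w \<noteq> 0)}"
  shows "int (card C) = (int (Q ^ ord m Q))\<^sup>2 - 4 * int (Q ^ ord m Q) + 3"
proof -
  let ?X = "Q ^ ord m Q"
  have sY: "stable Q Y" unfolding Y_def by (rule stable_orb[OF Q h_not_dvd(1) y])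
  have sY2: "stable (Q\<^sup>2) Y" by (rule stable_power[OF sY])
  have sB: "stable Q (pre 2 Y)" by (rule stable_pre[OF h_not_dvd(2) sY])
  have cY: "card Y = ord m Q" unfolding Y_def using card_orb[OF Q h_not_dvd(1) y] oh by simp
  have cB: "card (pre 2 Y) = 2 * ord m Q"
    using sY card_pre(2)[OF h_not_dvd(2)] cY by (simp add: stable_def)
  obtain z where z: "z\<^sup>2 = y" using nth_root_exists[of 2 y] by auto
  have zm: "z \<in> prim m" "- z \<in> prim m" using z y pre_prim_two[symmetric] by (auto simp: pre_def)
  have YB: "orb Q u \<subseteq> pre 2 Y" if "u\<^sup>2 = y" for u
    using pow_in_orb_pow[of _ Q u 2] that by (auto simp: pre_def Y_def)
  define Z1 Z2 where "Z1 = orb Q z" and "Z2 = orb Q (- z)"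
  have sZ: "stable Q Z1" "stable Q Z2" unfolding Z1_def Z2_def using stable_orb[OF Q m] zm by auto
  have cZ: "card Z1 = ord m Q" "card Z2 = ord m Q"
    unfolding Z1_def Z2_def using card_orb[OF Q m] zm by auto
  have "orb Q (- z) \<noteq> orb Q z"
    using neg_not_in_orb[OF zm(1) self_in_orb] self_in_orb[of "- z" Q] by auto
  then have dZ: "Z1 \<inter> Z2 = {}" unfolding Z1_def Z2_def using orb_disjoint[OF Q m zm(1,2)] by blast
  have uZ: "Z1 \<union> Z2 = pre 2 Y"
  proof (rule card_subset_eq[OF stable_finite[OF sB]])
    show "Z1 \<union> Z2 \<subseteq> pre 2 Y" unfolding Z1_def Z2_def using YB z by auto
    show "card (Z1 \<union> Z2) = card (pre 2 Y)"
      using card_Un_disjoint[OF stable_finite[OF sZ(1)] stable_finite[OF sZ(2)] dZ] cZ cB by simp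
  qed
  have yQ: "y ^ Q \<in> prim h" using stable_prim[OF Q h_not_dvd(1)] y by (simp add: stable_def)
  define Y1 Y2 where "Y1 = orb (Q\<^sup>2) y" and "Y2 = orb (Q\<^sup>2) (y ^ Q)"
  have s2: "stable (Q\<^sup>2) Y1" "stable (Q\<^sup>2) Y2"
    unfolding Y1_def Y2_def using stable_orb[OF pw_sq h_not_dvd(1)] y yQ by auto
  have c2: "card Y1 = ord h (Q\<^sup>2)" "card Y2 = ord h (Q\<^sup>2)"
    unfolding Y1_def Y2_def using card_orb[OF pw_sq h_not_dvd(1)] y yQ by auto
  have im: "Y2 = (\<lambda>x. x ^ Q) ` Y1" "Y1 = (\<lambda>x. x ^ Q) ` Y2"
  proof -
    have img: "(\<lambda>x. x ^ Q) ` orb (Q\<^sup>2) u = orb (Q\<^sup>2) (u ^ Q)" for u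
      unfolding orb_def by (auto simp: image_image mult.commute simp flip: power_mult)
    have "(y ^ Q) ^ Q \<in> orb (Q\<^sup>2) y"
      unfolding orb_def by (rule image_eqI[of _ _ 1]) (auto simp: power2_eq_square power_mult)
    then have "orb (Q\<^sup>2) ((y ^ Q) ^ Q) = orb (Q\<^sup>2) y" by (rule orb_eq[OF pw_sq h_not_dvd(1) y])
    then show "Y2 = (\<lambda>x. x ^ Q) ` Y1" "Y1 = (\<lambda>x. x ^ Q) ` Y2"
      unfolding Y1_def Y2_def using img by auto
  qed
  \<comment> \<open>If the two orbits coincided, the common orbit would be closed under
    \<open>Q\<close> and contain all of \<open>Y\<close>, although it has only half as many
    elements.\<close>
  have "orb (Q\<^sup>2) (y ^ Q) \<noteq> orb (Q\<^sup>2) y"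
  proof
    assume "orb (Q\<^sup>2) (y ^ Q) = orb (Q\<^sup>2) y"
    then have "stable Q Y1" using im s2 by (auto simp: stable_def Y1_def Y2_def)
    then have "Y \<subseteq> Y1" unfolding Y_def using orb_sub_stable self_in_orb Y1_def by blast
    then have "ord m Q \<le> ord h (Q\<^sup>2)" using card_mono[OF stable_finite[OF s2(1)]] cY c2 by metis
    moreover have "ord h (Q\<^sup>2) > 0" using pw_coprime[OF pw_sq h_not_dvd(1)] by simp
    ultimately show False using o2 by simp
  qed
  then have d2: "Y1 \<inter> Y2 = {}" unfolding Y1_def Y2_def using orb_disjoint[OF pw_sq h_not_dvd(1) y yQ] by blast
  have u2: "Y1 \<union> Y2 = Y"
  proof (rule card_subset_eq[OF stable_finite[OF sY]])
    have "y \<in> Y" "y ^ Q \<in> Y" using sY self_in_orb by (auto simp: stable_def Y_def)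
    then show "Y1 \<union> Y2 \<subseteq> Y" unfolding Y1_def Y2_def using orb_sub_stable[OF sY2] by auto
    show "card (Y1 \<union> Y2) = card Y"
      using card_Un_disjoint[OF stable_finite[OF s2(1)] stable_finite[OF s2(2)] d2] c2 cY o2 by simp
  qed
  have KB: "K Q (pre 2 Y) = K (Q\<^sup>2) Y" by (rule K_pre[OF h_not_dvd(2) sY])
  have orbZ: "orb Q u = Z1 \<or> orb Q u = Z2" if "u \<in> pre 2 Y" for u
  proof -
    have "u \<in> Z1 \<or> u \<in> Z2" using that uZ by auto
    then show ?thesis using orb_eq[OF Q m zm(1), of u] orb_eq[OF Q m zm(2), of u] unfolding Z1_def Z2_def by blast
  qed
  have orbY: "orb (Q\<^sup>2) u = Y1 \<or> orb (Q\<^sup>2) u = Y2" if "u \<in> Y" for u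
  proof -
    have "u \<in> Y1 \<or> u \<in> Y2" using that u2 by auto
    then show ?thesis using orb_eq[OF pw_sq h_not_dvd(1) y, of u] orb_eq[OF pw_sq h_not_dvd(1) yQ, of u]
      unfolding Y1_def Y2_def by blast
  qed
  have memb: "z \<in> pre 2 Y" "- z \<in> pre 2 Y" "y \<in> Y" "y ^ Q \<in> Y"
    using uZ u2 self_in_orb by (auto simp: Z1_def Z2_def Y1_def Y2_def)
  have diffs: "pre 2 Y - Z1 = Z2" "pre 2 Y - Z2 = Z1" "Y - Y1 = Y2" "Y - Y2 = Y1"
    using uZ dZ u2 d2 by auto
  \<comment> \<open>The complement of each orbit in the block is its partner, so the conditions
    defining \<open>C\<close> say that \<open>w\<close> avoids the four kernels.\<close>
  have "C = K Q (pre 2 Y) - (K Q Z1 \<union> K Q Z2 \<union> K (Q\<^sup>2) Y1 \<union> K (Q\<^sup>2) Y2)"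
  proof (intro equalityI subsetI)
    fix w assume "w \<in> C"
    then show "w \<in> K Q (pre 2 Y) - (K Q Z1 \<union> K Q Z2 \<union> K (Q\<^sup>2) Y1 \<union> K (Q\<^sup>2) Y2)"
      unfolding C_def using memb diffs by (auto simp: K_def Z1_def Z2_def Y1_def Y2_def)
  next
    fix w assume "w \<in> K Q (pre 2 Y) - (K Q Z1 \<union> K Q Z2 \<union> K (Q\<^sup>2) Y1 \<union> K (Q\<^sup>2) Y2)"
    then show "w \<in> C"
      unfolding C_def using orbZ orbY diffs by (auto simp: K_def) metis+
  qed
  moreover have "int (card (K Q (pre 2 Y) - (K Q Z1 \<union> K Q Z2 \<union> K (Q\<^sup>2) Y1 \<union> K (Q\<^sup>2) Y2))) =
      (int ?X)\<^sup>2 - 4 * int ?X + 3"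
  proof (rule card_Diff_four_lines[where z = 0])
    show "finite (K Q (pre 2 Y))" "card (K Q (pre 2 Y)) = ?X\<^sup>2"
      using card_K[OF Q sB] cB by (simp_all add: mult.commute flip: power_mult)
    show "K Q Z1 \<subseteq> K Q (pre 2 Y)" "K Q Z2 \<subseteq> K Q (pre 2 Y)"
      using K_mono[OF Q sB sZ(1)] K_mono[OF Q sB sZ(2)] uZ by auto
    show "K (Q\<^sup>2) Y1 \<subseteq> K Q (pre 2 Y)" "K (Q\<^sup>2) Y2 \<subseteq> K Q (pre 2 Y)"
      unfolding KB using K_mono[OF pw_sq sY2 s2(1)] K_mono[OF pw_sq sY2 s2(2)] u2 by auto
    show "card (K Q Z1) = ?X" "card (K Q Z2) = ?X"
      using card_K(2)[OF Q sZ(1)] card_K(2)[OF Q sZ(2)] cZ by auto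
    show "card (K (Q\<^sup>2) Y1) = ?X" "card (K (Q\<^sup>2) Y2) = ?X"
      using card_K(2)[OF pw_sq s2(1)] card_K(2)[OF pw_sq s2(2)] c2 o2 by (simp_all flip: power_mult)
    show "K Q Z1 \<inter> K Q Z2 = {0}" using K_Int[OF Q sZ] dZ by (simp add: K_empty)
    show "K (Q\<^sup>2) Y1 \<inter> K (Q\<^sup>2) Y2 = {0}" using K_Int[OF pw_sq s2] d2 by (simp add: K_empty)
    have tr: "K Q (orb Q u) \<inter> K (Q\<^sup>2) U = {0}"
      if "u \<in> prim m" "(U, V) \<in> {(Y1, Y2), (Y2, Y1)}" for u U V
    proof -
      have "w = 0" if "w \<in> K Q (orb Q u)" "w \<in> K (Q\<^sup>2) U" for w
      proof (rule transversal[OF Q m \<open>u \<in> prim m\<close> neg_not_in_orb[OF \<open>u \<in> prim m\<close>] _ _ _ _ that])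
        have UV: "U = Y1 \<and> V = Y2 \<or> U = Y2 \<and> V = Y1" using \<open>(U, V) \<in> _\<close> by auto
        then show "stable (Q\<^sup>2) U" "stable (Q\<^sup>2) V" using s2 by auto
        show "U \<inter> V = {}" using UV d2 by blast
        show "V = (\<lambda>x. x ^ Q) ` U" using UV im by metis
      qed
      then show ?thesis using zero_in_K[OF Q] zero_in_K[OF pw_sq] by blast
    qed
    show "K Q Z1 \<inter> K (Q\<^sup>2) Y1 = {0}" "K Q Z1 \<inter> K (Q\<^sup>2) Y2 = {0}"
      "K Q Z2 \<inter> K (Q\<^sup>2) Y1 = {0}" "K Q Z2 \<inter> K (Q\<^sup>2) Y2 = {0}"
      unfolding Z1_def Z2_def using tr[OF zm(1), of Y1 Y2] tr[OF zm(1), of Y2 Y1] tr[OF zm(2), of Y1 Y2] tr[OF zm(2), of Y2 Y1]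
      by auto
  qed
  ultimately show ?thesis by simp
qed

text \<open>Both conditions decompose along the \<open>Q\<close>-orbits \<open>Y\<close> of
  \<open>prim h\<close> through one and the same cofactor map, so \<open>crt_count\<close>
  multiplies the counts of the blocks.\<close>

lemma card_gen_gen:
  "int (card {w. gen Q m w \<and> gen (Q\<^sup>2) h w}) =
    ((int (Q ^ ord m Q))\<^sup>2 - 4 * int (Q ^ ord m Q) + 3) ^ (totient h div ord m Q)"
proof -
  let ?I = "orb Q ` prim h"
  let ?C = "\<lambda>Y. {w \<in> K Q (pre 2 Y). (\<forall>z\<in>pre 2 Y. act Q (PP (pre 2 Y - orb Q z)) w \<noteq> 0) \<and>
    (\<forall>x\<in>Y. act (Q\<^sup>2) (PP (Y - orb (Q\<^sup>2) x)) w \<noteq> 0)}"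
  note h = h_not_dvd(1)
  have fin: "finite ?I" using finite_prim[OF h] by simp
  have stY: "stable Q Y" if "Y \<in> ?I" for Y using that stable_orb[OF Q h] by auto
  have st: "stable Q (pre 2 Y)" if "Y \<in> ?I" for Y using stable_pre[OF h_not_dvd(2) stY[OF that]] .
  have disjY: "Y \<inter> Y' = {}" if "Y \<in> ?I" "Y' \<in> ?I" "Y \<noteq> Y'" for Y Y'
    using that orb_disjoint[OF Q h] by blast
  have disj: "pre 2 Y \<inter> pre 2 Y' = {}" if "Y \<in> ?I" "Y' \<in> ?I" "Y \<noteq> Y'" for Y Y'
    using disjY[OF that] by (auto simp: pre_def)
  have "(\<Union>Y\<in>?I. pre 2 Y) = pre 2 (\<Union>?I)" by (auto simp: pre_def)
  then have UN: "(\<Union>Y\<in>?I. pre 2 Y) = prim m"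
    using prim_eq_UN_orb[OF Q h] pre_prim_two by simp
  have "card {w \<in> K Q (\<Union>Y\<in>?I. pre 2 Y). \<forall>Y\<in>?I. act Q (PP ((\<Union>Y\<in>?I. pre 2 Y) - pre 2 Y)) w \<in> ?C Y} =
      (\<Prod>Y\<in>?I. card (?C Y))"
    by (rule crt_count[OF Q fin st disj]) auto
  also have "{w \<in> K Q (\<Union>Y\<in>?I. pre 2 Y). \<forall>Y\<in>?I. act Q (PP ((\<Union>Y\<in>?I. pre 2 Y) - pre 2 Y)) w \<in> ?C Y} =
      {w. gen Q m w \<and> gen (Q\<^sup>2) h w}"
  proof -
    have sm: "stable Q (prim m)" using stable_prim[OF Q m] .
    have sh: "stable Q (prim h)" using stable_prim[OF Q h] .
    have sub: "Y \<subseteq> prim h" "pre 2 Y \<subseteq> prim m" if "Y \<in> ?I" for Y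
      using that orb_sub_prim[OF Q h] pre_mono[of Y "prim h" 2] pre_prim_two by auto
    have Kmh: "K Q (prim m) = K (Q\<^sup>2) (prim h)" using K_pre[OF h_not_dvd(2) sh] pre_prim_two by simp
    have 1: "act Q (PP (prim m - orb Q z)) w = act Q (PP (pre 2 Y - orb Q z)) (act Q (PP (prim m - pre 2 Y)) w)"
      if "Y \<in> ?I" "z \<in> pre 2 Y" for Y z w
    proof -
      have so: "stable Q (orb Q z)" "orb Q z \<subseteq> pre 2 Y"
        using stable_orb[OF Q m, of z] sub[OF that(1)] that orb_sub_stable[OF st[OF that(1)]] by auto
      have "prim m - orb Q z = (pre 2 Y - orb Q z) \<union> (prim m - pre 2 Y)" using sub[OF that(1)] so by auto
      then show ?thesis
        using act_PP_split_disjoint[OF Q stable_Diff[OF Q st[OF that(1)] so(1)] stable_Diff[OF Q sm st[OF that(1)]], of w]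
        by auto
    qed
    \<comment> \<open>By \<open>act_pre\<close> the cofactor of \<open>Y\<close> over
      \<open>Q\<^sup>2\<close> acts as that of \<open>pre 2 Y\<close> over \<open>Q\<close>; thus
      the second condition also sees only the image in the block.\<close>
    have 2: "act (Q\<^sup>2) (PP (prim h - orb (Q\<^sup>2) x)) w = act (Q\<^sup>2) (PP (Y - orb (Q\<^sup>2) x)) (act Q (PP (prim m - pre 2 Y)) w)"
      if "Y \<in> ?I" "x \<in> Y" for Y x w
    proof -
      have so: "stable (Q\<^sup>2) (orb (Q\<^sup>2) x)" "orb (Q\<^sup>2) x \<subseteq> Y"
        using stable_orb[OF pw_sq h, of x] sub[OF that(1)] that orb_sub_stable[OF stable_power[OF stY[OF that(1)]]] by auto
      have sd: "stable Q (prim h - Y)" using stable_Diff[OF Q sh stY[OF that(1)]] .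
      have "prim h - orb (Q\<^sup>2) x = (Y - orb (Q\<^sup>2) x) \<union> (prim h - Y)" using sub[OF that(1)] so by auto
      then have "act (Q\<^sup>2) (PP (prim h - orb (Q\<^sup>2) x)) w = act (Q\<^sup>2) (PP (Y - orb (Q\<^sup>2) x)) (act (Q\<^sup>2) (PP (prim h - Y)) w)"
        using act_PP_split_disjoint[OF pw_sq stable_Diff[OF pw_sq stable_power[OF stY[OF that(1)]] so(1)] stable_power[OF sd], of w]
        by auto
      also have "act (Q\<^sup>2) (PP (prim h - Y)) w = act Q (PP (prim m - pre 2 Y)) w"
        using act_pre[OF h_not_dvd(2) sd, of Q w] by (simp add: pre_Diff pre_prim_two)
      finally show ?thesis .
    qed
    have inK: "act Q (PP (prim m - pre 2 Y)) w \<in> K Q (pre 2 Y)" if "Y \<in> ?I" "w \<in> K Q (prim m)" for Y w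
      using act_in_K[OF Q sm st[OF that(1)] sub(2)[OF that(1)] that(2)] .
    have exY: "\<exists>Y\<in>?I. z \<in> pre 2 Y" if "z \<in> prim m" for z using that UN by auto
    have exX: "\<exists>Y\<in>?I. x \<in> Y" if "x \<in> prim h" for x using that self_in_orb by blast
    show ?thesis unfolding UN
    proof (intro equalityI subsetI)
      fix w assume w: "w \<in> {w \<in> K Q (prim m). \<forall>Y\<in>?I. act Q (PP (prim m - pre 2 Y)) w \<in> ?C Y}"
      have "act Q (PP (prim m - orb Q z)) w \<noteq> 0" if "z \<in> prim m" for z
      proof -
        obtain Y where Y: "Y \<in> ?I" "z \<in> pre 2 Y" using exY[OF \<open>z \<in> prim m\<close>] by blast
        have "act Q (PP (prim m - pre 2 Y)) w \<in> ?C Y" using w Y(1) by blast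
        then show ?thesis unfolding 1[OF Y] using Y(2) by blast
      qed
      moreover have "act (Q\<^sup>2) (PP (prim h - orb (Q\<^sup>2) x)) w \<noteq> 0" if "x \<in> prim h" for x
      proof -
        obtain Y where Y: "Y \<in> ?I" "x \<in> Y" using exX[OF \<open>x \<in> prim h\<close>] by blast
        have "act Q (PP (prim m - pre 2 Y)) w \<in> ?C Y" using w Y(1) by blast
        then show ?thesis unfolding 2[OF Y] using Y(2) by blast
      qed
      ultimately show "w \<in> {w. gen Q m w \<and> gen (Q\<^sup>2) h w}" using w Kmh by (auto simp: gen_def)
    next
      fix w assume "w \<in> {w. gen Q m w \<and> gen (Q\<^sup>2) h w}"
      then have g: "w \<in> K Q (prim m)" "\<And>z. z \<in> prim m \<Longrightarrow> act Q (PP (prim m - orb Q z)) w \<noteq> 0"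
        "\<And>x. x \<in> prim h \<Longrightarrow> act (Q\<^sup>2) (PP (prim h - orb (Q\<^sup>2) x)) w \<noteq> 0" by (auto simp: gen_def)
      have "act Q (PP (prim m - pre 2 Y)) w \<in> ?C Y" if Y: "Y \<in> ?I" for Y
        using inK[OF Y g(1)] 1[OF Y, of _ w] 2[OF Y, of _ w] g(2,3) sub[OF Y] by (auto simp del: image_iff) (metis subsetD)+
      then show "w \<in> {w \<in> K Q (prim m). \<forall>Y\<in>?I. act Q (PP (prim m - pre 2 Y)) w \<in> ?C Y}"
        using g(1) by blast
    qed
  qed
  finally have "int (card {w. gen Q m w \<and> gen (Q\<^sup>2) h w}) = (\<Prod>Y\<in>?I. int (card (?C Y)))" by simp
  also have "\<dots> = (\<Prod>Y\<in>?I. (int (Q ^ ord m Q))\<^sup>2 - 4 * int (Q ^ ord m Q) + 3)"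
    using card_block by (intro prod.cong) auto
  also have "\<dots> = ((int (Q ^ ord m Q))\<^sup>2 - 4 * int (Q ^ ord m Q) + 3) ^ card ?I" by simp
  also have "card ?I = totient h div ord m Q"
  proof -
    have "totient h = (\<Sum>B\<in>?I. card B)"
      using card_UN_disjoint[OF fin, of "\<lambda>B. B"] disjY stable_finite[OF stY] prim_eq_UN_orb[OF Q h] card_prim[OF h] by auto
    also have "\<dots> = (\<Sum>B\<in>?I. ord m Q)"
      using card_orb[OF Q h] oh by (intro sum.cong) auto
    also have "\<dots> = card ?I * ord m Q" by simp
    finally show ?thesis using pw_coprime[OF Q m] by simp
  qed
  finally show ?thesis .
qed

end

lemma card_compgen_exceptional:
  assumes q: "pw q" and k: "\<not> p dvd k" and rp: "regular_pair q k" and ex: "exceptional q k"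
  shows "int (card {w. compgen q k w}) =
    (int q ^ (2 * ord k q div tau q k) - 4 * int q ^ (ord k q div tau q k) + 3) ^ (tau q k * totient k div (2 * ord k q))"
proof -
  interpret regular_pair q k by (rule rp)
  define T where "T = tau q k"
  have T: "admissible T" unfolding T_def by (rule tau_admissible)
  have T2: "admissible (2 * T)" unfolding T_def by (rule two_tau_admissible[OF ex])
  obtain h where h: "k = 2 * T * h" using T2 by (auto simp: admissible_def)
  define m where "m = h * 2"
  have km: "k = T * m" using h by (simp add: m_def)
  have pos: "T > 0" "m > 0" "h > 0" using h k0 by (auto simp: m_def intro: gr0I)
  have div: "k div T = m" "k div (2 * T) = h" using h km pos by auto
  have np: "\<not> p dvd m" "\<not> p dvd T" using k km by auto
  have Q: "pw (q ^ T)" using q pos pw_power by auto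
  have pr: "r dvd m" if "prime r" "r dvd k" for r
    using T that div by (simp add: admissible_def)
  have evk: "even k" using ex exceptional_iff by simp
  then have h2: "even h" using T2 div by (auto simp: admissible_def)
  have sq: "q ^ (2 * T) = (q ^ T)\<^sup>2" by (simp add: mult.commute flip: power_mult)
  \<comment> \<open>These are the two order hypotheses of the block count for the base
    \<open>q ^ T\<close> and the moduli \<open>m\<close> and \<open>h\<close>.\<close>
  note oo = exceptional_ord[OF ex, folded T_def, unfolded div sq]
  have "compgen q k w \<longleftrightarrow> gen (q ^ T) m w \<and> gen ((q ^ T)\<^sup>2) h w" for w
  proof
    assume "compgen q k w"
    then have "gen (q ^ T) (k div T) w" "gen (q ^ (2 * T)) (k div (2 * T)) w"
      using T T2 unfolding compgen_def by blast+
    then show "gen (q ^ T) m w \<and> gen ((q ^ T)\<^sup>2) h w" by (simp add: div sq)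
  next
    assume g: "gen (q ^ T) m w \<and> gen ((q ^ T)\<^sup>2) h w"
    show "compgen q k w" unfolding compgen_def
    proof (intro allI impI)
      fix d assume d: "admissible d"
      show "gen (q ^ d) (k div d) w"
      proof (cases "even d")
        case True
        show ?thesis
          using gen_path[OF q k rp d T2 vgood_two_tau[OF ex d True, folded T_def]] g by (simp add: div sq)
      next
        case False
        show ?thesis
          using gen_path[OF q k rp d T vgood_tau[OF d, folded T_def]] g False by (simp add: div)
      qed
    qed
  qed
  then have c: "int (card {w. compgen q k w}) =
    ((int ((q ^ T) ^ ord m (q ^ T)))\<^sup>2 - 4 * int ((q ^ T) ^ ord m (q ^ T)) + 3) ^ (totient h div ord m (q ^ T))"
    using card_gen_gen[OF Q np(1) m_def h2 oo] by simp
  have o: "ord k q = ord m (q ^ T) * T\<^sup>2" using ord_tau by (simp add: T_def[symmetric] div)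
  have 1: "ord k q div T = T * ord m (q ^ T)" "2 * ord k q div T = T * ord m (q ^ T) * 2"
    using pos by (simp_all add: o power2_eq_square)
  have "totient k = T * totient m"
    using totient_mult_same_primes[OF np] pr km by (simp add: mult.commute)
  also have "totient m = 2 * totient h"
    using np h2 unfolding m_def
    by (intro totient_mult_same_primes) (use primes_dvd_imp_eq two_is_prime_nat in auto)
  finally have "T * totient k = (2 * T\<^sup>2) * totient h" by (simp add: power2_eq_square)
  moreover have "2 * ord k q = (2 * T\<^sup>2) * ord m (q ^ T)" by (simp add: o)
  ultimately have "T * totient k div (2 * ord k q) = totient h div ord m (q ^ T)"
    using pos by (simp only: div_mult_mult1) simp
  then show ?thesis using c 1 by (simp add: T_def power_mult)
qed

end

section \<open>Reduction to the components\<close>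

lemma coprime_part_decomposition:
  fixes d m :: nat
  assumes "d > 0"
  obtains d1 d2 where "d = d1 * d2" "coprime d2 m" "\<And>r. prime r \<Longrightarrow> r dvd d1 \<Longrightarrow> r dvd m"
proof -
  have "\<exists>d1 d2. d = d1 * d2 \<and> coprime d2 m \<and> (\<forall>r. prime r \<longrightarrow> r dvd d1 \<longrightarrow> r dvd m)"
    using assms
  proof (induction d rule: less_induct)
    case (less d)
    show ?case
    proof (cases "coprime d m")
      case True
      then show ?thesis by (intro exI[of _ 1] exI[of _ d]) auto
    next
      case False
      then obtain r where r: "prime r" "r dvd d" "r dvd m"
        by (metis coprime_iff_gcd_eq_1 gcd_nat.bounded_iff prime_factor_nat)
      then obtain d0 where d0: "d = r * d0" by blast
      then have "d0 < d" "d0 > 0" using less.prems prime_gt_1_nat[OF r(1)] by auto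
      then obtain d1 d2 where "d0 = d1 * d2" "coprime d2 m" "\<forall>s. prime s \<longrightarrow> s dvd d1 \<longrightarrow> s dvd m"
        using less.IH by blast
      then show ?thesis using r d0 primes_dvd_imp_eq
        by (intro exI[of _ "r * d1"] exI[of _ d2]) (auto simp: prime_dvd_mult_iff)
    qed
  qed
  then show thesis using that by blast
qed

lemma pcompose_power: "pcompose (P ^ j) R = pcompose P R ^ j" for P :: "'a :: comm_semiring_1 poly"
  by (induction j) (simp_all add: pcompose_1 pcompose_mult)

lemma act_binomial: "act Q (monom 1 N - 1) v = v ^ (Q ^ N) - v"
  by (simp add: act_diff act_monom)

lemma degree_binomial: "N > 0 \<Longrightarrow> degree (monom 1 N - 1 :: 'a :: field poly) = N" "N > 0 \<Longrightarrow> lead_coeff (monom 1 N - 1 :: 'a poly) = 1"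
proof -
  assume N: "N > 0"
  have c: "coeff (monom 1 N - 1 :: 'a poly) N = 1" using N by simp
  moreover have "degree (monom 1 N - 1 :: 'a poly) \<le> N" by (intro degree_diff_le) (auto simp: degree_monom_le)
  ultimately show d: "degree (monom 1 N - 1 :: 'a poly) = N" by (metis le_degree order_antisym zero_neq_one)
  show "lead_coeff (monom 1 N - 1 :: 'a poly) = 1" using c d by simp
qed

context char_p
begin

lemma PP_mu:
  assumes "\<not> p dvd N"
  shows "PP (mu N) = monom 1 N - 1"
proof (rule PP_unique[symmetric])
  have "N > 0" using assms by (rule not_p_dvd_pos)
  then show "lead_coeff (monom 1 N - 1 :: 'l poly) = 1" "degree (monom 1 N - 1 :: 'l poly) = card (mu N)"
    using degree_binomial[of N] card_mu[OF assms] by auto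
qed (use card_mu[OF assms] in \<open>auto simp: mu_def poly_monom\<close>)

lemma PP_mu_power:
  assumes "\<not> p dvd N"
  shows "PP (mu N) ^ (p ^ j) = monom 1 (N * p ^ j) - 1"
proof -
  have "prime CHAR('l poly)" "p ^ j = CHAR('l poly) ^ j" using p char by simp_all
  then have "((monom 1 N - 1) + 1) ^ (p ^ j) = (monom 1 N - 1 :: 'l poly) ^ (p ^ j) + 1 ^ (p ^ j)"
    by (rule freshmans_dream')
  then show ?thesis by (simp add: PP_mu[OF assms] monom_power algebra_simps)
qed

lemma frobp_binomial: "pw Q \<Longrightarrow> frobp Q (monom 1 N - 1 :: 'l poly) = monom 1 N - 1"
  by (auto simp: frobp_iff diff_pw coeff_monom zero_pw coeff_1)

lemma poly_frobp_root: "pw Q \<Longrightarrow> frobp Q P = P \<Longrightarrow> poly P z = (0 :: 'l) \<Longrightarrow> poly P (z ^ Q) = 0"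
proof -
  assume Q: "pw Q" "frobp Q P = P" "poly P z = 0"
  have "poly (frobp Q P) (z ^ Q) = poly P z ^ Q" for P :: "'l poly"
    by (induction P) (simp_all add: map_poly_pCons zero_pw[OF Q(1)] add_pw[OF Q(1)] power_mult_distrib)
  then show ?thesis using Q zero_pw by metis
qed

lemma PP_orb_dvd:
  assumes "pw Q" "frobp Q P = P" "poly P z = 0" "finite (orb Q z)"
  shows "PP (orb Q z) dvd P"
proof (rule PP_dvd[OF assms(4)])
  have "poly P (z ^ (Q ^ i)) = 0" for i
    by (induction i) (use assms poly_frobp_root in \<open>simp_all add: power_mult mult.commute[of Q]\<close>)
  then show "poly P x = 0" if "x \<in> orb Q z" for x using that by (auto simp: orb_def)
qed

text \<open>Frobenius is injective, so a factor \<open>p\<close> could be cancelled from the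
  order.\<close>

lemma prim_imp_not_p_dvd:
  assumes "z \<in> prim m" "m > 0"
  shows "\<not> p dvd m"
proof
  assume "p dvd m"
  then obtain m' where "m = p * m'" by blast
  then have m': "m = m' * p" by simp
  have "pw p" unfolding pw_def by (intro exI[of _ 1]) simp
  moreover have "(z ^ m') ^ p = 1 ^ p" using prim_pow_eq_1[OF assms(1), of m] m' by (simp add: power_mult)
  ultimately have "z ^ m' = 1" using inj_pw by blast
  then have "m dvd m'" using prim_pow_eq_1[OF assms(1)] by blast
  then show False using m' assms(2) prime_gt_1_nat[OF p] by (auto dest!: dvd_imp_le)
qed

text \<open>Linear independence of the first \<open>N\<close> conjugates of \<open>v\<close>, with a
  tuple of coefficients read as a polynomial. Spanning is recovered by counting.\<close>

definition normal_over :: "nat \<Rightarrow> nat \<Rightarrow> 'l \<Rightarrow> bool" where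
  "normal_over Q N v \<longleftrightarrow> (\<forall>P. frobp Q P = P \<longrightarrow> degree P < N \<longrightarrow> act Q P v = 0 \<longrightarrow> P = 0)"

text \<open>A nonzero annihilator of degree below \<open>N\<close> may be replaced by \<open>(X\<^sup>N - 1) / f\<close> with \<open>f\<close> the
  minimal polynomial of a root of unity.\<close>
lemma not_normal_over:
  assumes Q: "pw Q" and N: "N > 0" and v: "v ^ (Q ^ N) = v" and nn: "\<not> normal_over Q N v"
  obtains m z where "m dvd N" "\<not> p dvd m" "z \<in> prim m"
    "act Q ((monom 1 N - 1) div PP (orb Q z)) v = 0"
proof -
  define B where "B = (monom 1 N - 1 :: 'l poly)"
  have B: "frobp Q B = B" "act Q B v = 0" "degree B = N"
    using frobp_binomial[OF Q] v act_binomial[of Q N v] degree_binomial(1)[OF N] by (auto simp: B_def)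
  then have B0: "B \<noteq> 0" using N by auto
  obtain P where P: "frobp Q P = P" "degree P < N" "act Q P v = 0" "P \<noteq> 0"
    using nn by (auto simp: normal_over_def)
  obtain g where g: "frobp Q g = g" "g \<noteq> 0" "act Q g v = 0"
    "\<And>P. frobp Q P = P \<Longrightarrow> act Q P v = 0 \<Longrightarrow> g dvd P"
    using annihilator_principal[OF Q P(1,4,3)] by metis
  have dg: "degree g < N" using g(4)[OF P(1,3)] P dvd_imp_degree_le by (metis le_less_trans)
  define R where "R = B div g"
  have R: "B = R * g" using g(4)[OF B(1,2)] by (simp add: R_def)
  have fR: "frobp Q R = R" unfolding R_def by (rule frobp_mod(2)[OF Q B(1) g(1)])
  have "R \<noteq> 0" using R B0 by auto
  then have "degree R > 0" using R g(2) dg B(3) degree_mult_eq[of R g] by simp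
  then obtain z where z: "poly R z = 0" using alg_closed_imp_poly_has_root by blast
  then have "poly B z = 0" using R by simp
  then have "z ^ N = 1" by (simp add: B_def poly_monom)
  then obtain m where m: "m dvd N" "z \<in> prim m" using prim_ex N by blast
  then have np: "\<not> p dvd m" using prim_imp_not_p_dvd N by (auto intro: gr0I)
  have so: "stable Q (orb Q z)" using stable_orb[OF Q np m(2)] .
  have "PP (orb Q z) dvd R" using PP_orb_dvd[OF Q fR z stable_finite[OF so]] .
  then obtain T where T: "R = PP (orb Q z) * T" by blast
  have "B div PP (orb Q z) = T * g"
    unfolding R T by (simp add: mult.assoc PP_nonzero)
  then have "act Q (B div PP (orb Q z)) v = act Q T (act Q g v)"
    using act_mult[OF Q g(1)] by simp
  then have "act Q (B div PP (orb Q z)) v = 0" using g(3) act_zero[OF Q] by simp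
  then show thesis using that m np by (simp add: B_def)
qed

section \<open>Components of an element fixed by the n-th power of Frobenius\<close>

context
  fixes q n n' a :: nat
  assumes q: "pw q" and n: "n = p ^ a * n'" and n': "\<not> p dvd n'"
    and regular: "coprime (ord (rad n') q) n"
begin

text \<open>Since \<open>X ^ n - 1\<close> is the \<open>p ^ a\<close>-th power of the separable
  polynomial \<open>PP (mu n')\<close>, all but one of its factors are applied, and the result lies
  in \<open>K q (mu n')\<close>.\<close>

definition semisimple_part :: "'l \<Rightarrow> 'l" where "semisimple_part v = act q (PP (mu n') ^ (p ^ a - 1)) v"

definition component :: "nat \<Rightarrow> 'l \<Rightarrow> 'l" where "component k v = act q (PP (mu n' - prim k)) (semisimple_part v)"

lemma np_dvd: "k dvd n' \<Longrightarrow> \<not> p dvd k"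
  using n' dvd_trans by blast

lemma n'_pos: "n' > 0"
  using n' by (rule not_p_dvd_pos)

lemma n_pos: "n > 0"
  using n n'_pos p prime_gt_0_nat by simp

lemma pa_pos: "p ^ a > 0"
  using p prime_gt_0_nat by simp

lemma prim_sub_mu: "m dvd N \<Longrightarrow> prim m \<subseteq> mu N"
  by (auto simp: mu_def prim_pow_eq_1)

lemma regular_pair_divisor:
  assumes k: "k dvd n'"
  shows "regular_pair q k"
proof
  show "k > 0" using k n'_pos by (auto intro: gr0I)
  show "coprime k q" using pw_coprime[OF q np_dvd[OF k]] .
  have "rad k dvd rad n'"
    using k n'_pos unfolding rad_def by (intro prod_dvd_prod_subset dvd_prime_factors) auto
  then have "ord (rad k) q dvd ord (rad n') q" by (rule ord_dvd_mono)
  then show "coprime (ord (rad k) q) k"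
    using regular k n by (meson coprime_divisors dvd_mult)
qed

text \<open>A common prime would divide \<open>m\<close>, against coprimality with
  \<open>d2\<close>, or \<open>ord (rad m) q\<close>, against regularity.\<close>

lemma ord_coprime_part:
  assumes m: "m dvd n'" and d2: "d2 dvd n" "coprime d2 m"
  shows "coprime d2 (ord m q)"
proof (rule ccontr)
  assume "\<not> coprime d2 (ord m q)"
  then obtain r where r: "prime r" "r dvd d2" "r dvd ord m q"
    by (metis coprime_iff_gcd_eq_1 gcd_nat.bounded_iff prime_factor_nat)
  interpret regular_pair q m by (rule regular_pair_divisor[OF m])
  have "r dvd ord (rad m) q \<or> r dvd (\<Prod>s\<in>prime_factors m. s ^ alpha q m s)"
    using r(1,3) ord_eq_ord_rad_times[OF k0 cop] by (simp add: prime_dvd_mult_iff)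
  then show False
  proof
    assume "r dvd ord (rad m) q"
    moreover have "rad m dvd rad n'"
      using m n'_pos unfolding rad_def by (intro prod_dvd_prod_subset dvd_prime_factors) auto
    ultimately have "r dvd ord (rad n') q" using ord_dvd_mono dvd_trans by blast
    moreover have "r dvd n" using r d2 dvd_trans by blast
    ultimately show False
      using regular r(1) coprime_common_divisor[of "ord (rad n') q" n r] not_prime_unit[of r] by blast
  next
    assume "r dvd (\<Prod>s\<in>prime_factors m. s ^ alpha q m s)"
    then obtain s where s: "s \<in> prime_factors m" "r dvd s ^ alpha q m s"
      using r(1) by (auto simp: prime_dvd_prod_iff)
    then have "prime s" "r dvd s" "s dvd m"
      using r(1) prime_dvd_power by (auto simp: in_prime_factors_iff)
    then have "r dvd m" by (meson dvd_trans)
    then show False using r d2 coprime_common_divisor[of d2 m r] not_prime_unit[of r] by blast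
  qed
qed

text \<open>With \<open>M = n' div d\<close>, the cofactor of the orbit in
  \<open>PP (mu M) ^ (p ^ a)\<close> is the product of \<open>PP (mu M) ^ (p ^ a - 1)\<close>,
  \<open>PP (mu M - prim m)\<close> and the part inside \<open>prim m\<close>. Over
  \<open>q ^ d\<close> the first two act as the maps defining
  \<open>component (m * d)\<close>.\<close>

lemma act_component:
  assumes d: "d dvd n'" and m: "m dvd n' div d" and primes: "\<And>r. prime r \<Longrightarrow> r dvd d \<Longrightarrow> r dvd m"
    and z: "z \<in> prim m"
  shows "act (q ^ d) ((monom 1 (n div d) - 1) div PP (orb (q ^ d) z)) v =
    act (q ^ d) (PP (prim m - orb (q ^ d) z)) (component (m * d) v)"
proof -
  define M where "M = n' div d"
  have M: "n' = d * M" using d by (simp add: M_def)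
  have "M dvd n'" using M by simp
  moreover from this have "m dvd n'" using m unfolding M_def[symmetric] by (rule dvd_trans[rotated])
  ultimately have np: "\<not> p dvd d" "\<not> p dvd M" "\<not> p dvd m"
    using d np_dvd by blast+
  have pos: "d > 0" "M > 0" "m > 0" using np not_p_dvd_pos by blast+
  have Q: "pw (q ^ d)" using q pos pw_power by blast
  let ?Q = "q ^ d" and ?O = "orb (q ^ d) z" and ?j = "p ^ a - 1"
  have nd: "n div d = M * p ^ a" using n M pos by simp
  have so: "stable ?Q ?O" using stable_orb[OF Q np(3) z] .
  have sm: "stable ?Q (prim m)" "stable q (prim m)" using stable_prim Q q np by auto
  have sM: "stable ?Q (mu M)" "stable q (mu M)" using stable_mu np by auto
  have sub: "?O \<subseteq> prim m" "prim m \<subseteq> mu M"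
    using orb_sub_prim[OF Q np(3) z] prim_sub_mu m by (auto simp: M_def)
  have fM: "finite (mu M)" using card_mu np by blast
  have "monom 1 (n div d) - 1 = PP (mu M) ^ (p ^ a)" using PP_mu_power[OF np(2)] nd by simp
  also have "\<dots> = PP (mu M) ^ ?j * PP (mu M)"
    using pa_pos by (metis Suc_diff_1 power_Suc2)
  finally have 1: "monom 1 (n div d) - 1 = PP (mu M) ^ ?j * PP (mu M)" .
  have 2: "PP (mu M) = PP (mu M - ?O) * PP ?O" using PP_diff[OF fM, of ?O] sub by auto
  have "monom 1 (n div d) - 1 = (PP (mu M) ^ ?j * PP (mu M - ?O)) * PP ?O"
    by (simp only: 1 2[symmetric] mult.assoc)
  then have "(monom 1 (n div d) - 1) div PP ?O = PP (mu M) ^ ?j * PP (mu M - ?O)"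
    by (simp add: PP_nonzero)
  also have "PP (mu M - ?O) = PP (prim m - ?O) * PP (mu M - prim m)"
  proof -
    have "(mu M - ?O) - (mu M - prim m) = prim m - ?O" using sub by auto
    then show ?thesis using PP_diff[of "mu M - ?O" "mu M - prim m"] fM sub by auto
  qed
  finally have eq: "(monom 1 (n div d) - 1) div PP ?O =
      PP (prim m - ?O) * (PP (mu M - prim m) * PP (mu M) ^ ?j)"
    by (simp add: mult_ac)
  have f1: "frobp ?Q (PP (mu M) ^ ?j) = PP (mu M) ^ ?j"
    by (simp add: frobp_power[OF Q] frobp_PP[OF Q sM(1)])
  have f2: "frobp ?Q (PP (mu M - prim m)) = PP (mu M - prim m)"
    by (rule frobp_PP[OF Q stable_Diff[OF Q sM(1) sm(1)]])
  have "act ?Q ((monom 1 (n div d) - 1) div PP ?O) v =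
      act ?Q (PP (prim m - ?O)) (act ?Q (PP (mu M - prim m)) (act ?Q (PP (mu M) ^ ?j) v))"
    unfolding eq using f1 f2 by (simp add: act_mult[OF Q] frobp_mult[OF Q])
  also have "act ?Q (PP (mu M) ^ ?j) v = semisimple_part v"
  proof -
    have "PP (mu n') = pcompose (PP (mu M)) (monom 1 d)"
      using PP_pre[OF np(1) fM] sM by (simp add: pre_mu M stable_def)
    then show ?thesis
      by (simp add: semisimple_part_def pcompose_power[symmetric] act_pcompose_monom)
  qed
  also have "act ?Q (PP (mu M - prim m)) (semisimple_part v) = component (m * d) v"
  proof -
    have "pre d (mu M - prim m) = mu n' - prim (m * d)"
      using pre_prim[OF pos(3,1) primes] by (simp add: pre_Diff pre_mu M)
    then show ?thesis
      using act_pre[OF np(1) stable_Diff[OF q sM(2) sm(2)], of q "semisimple_part v"] by (simp add: component_def)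
  qed
  finally show ?thesis .
qed

lemma act_binomial_n: "act q (PP (mu n') ^ (p ^ a)) v = v ^ (q ^ n) - v"
  using PP_mu_power[OF n', of a] act_binomial[of q n v] by (simp add: n mult.commute)

lemma semisimple_part_in_K: "semisimple_part v \<in> K q (mu n') \<longleftrightarrow> v ^ (q ^ n) = v"
proof -
  have "act q (PP (mu n')) (semisimple_part v) = act q (PP (mu n') * PP (mu n') ^ (p ^ a - 1)) v"
    unfolding semisimple_part_def using frobp_PP[OF q stable_mu[OF n']] by (simp add: act_mult[OF q] frobp_power[OF q])
  also have "PP (mu n') * PP (mu n') ^ (p ^ a - 1) = PP (mu n') ^ (p ^ a)"
    using pa_pos by (metis Suc_diff_1 power_Suc)
  finally show ?thesis by (simp add: K_def act_binomial_n)
qed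

lemma component_in_K: "v ^ (q ^ n) = v \<Longrightarrow> k dvd n' \<Longrightarrow> component k v \<in> K q (prim k)"
  unfolding component_def using semisimple_part_in_K
  by (intro act_in_K[OF q stable_mu[OF n'] stable_prim[OF q]] prim_sub_mu) (auto simp: np_dvd)

text \<open>A failing condition yields, by \<open>act_component\<close>, an annihilator of
  \<open>v\<close> of the form \<open>(X^(n div d) - 1) / f\<close>. It is nonzero of degree below
  \<open>n div d\<close>, against normality.\<close>

lemma normal_imp_compgen:
  assumes v: "v ^ (q ^ n) = v" and nrm: "\<And>d. d dvd n \<Longrightarrow> normal_over (q ^ d) (n div d) v" and k: "k dvd n'"
  shows "compgen q k (component k v)"
  unfolding compgen_def
proof (intro allI impI)
  interpret regular_pair q k by (rule regular_pair_divisor[OF k])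
  fix d assume d: "admissible d"
  define m where "m = k div d"
  have km: "k = m * d" using d by (simp add: m_def admissible_def)
  have pos: "d > 0" "m > 0" using km k0 by auto
  have np: "\<not> p dvd m" "\<not> p dvd d" using np_dvd[OF k] km by auto
  have dn': "d dvd n'" and mn': "m dvd n' div d" using k km pos by (auto simp: dvd_div_iff_mult)
  have dn: "d dvd n" using dn' n by simp
  have pr: "r dvd m" if "prime r" "r dvd d" for r
  proof -
    have "r dvd k" using that km by simp
    then show ?thesis using d that(1) unfolding admissible_def m_def by blast
  qed
  have Q: "pw (q ^ d)" using q pos pw_power by blast
  have "act (q ^ d) (PP (prim m - orb (q ^ d) z)) (component k v) \<noteq> 0" if z: "z \<in> prim m" for z
  proof
    assume 0: "act (q ^ d) (PP (prim m - orb (q ^ d) z)) (component k v) = 0"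
    let ?B = "monom 1 (n div d) - 1 :: 'l poly" and ?f = "PP (orb (q ^ d) z)"
    have N: "n div d > 0" using dn n_pos by (metis dvd_div_eq_0_iff not_gr_zero)
    have so: "stable (q ^ d) (orb (q ^ d) z)" by (rule stable_orb[OF Q np(1) z])
    have B: "frobp (q ^ d) ?B = ?B" "degree ?B = n div d"
      using frobp_binomial[OF Q] degree_binomial(1)[OF N] by auto
    have "m dvd n div d" using mn' dn' n pos by (auto simp: div_mult_swap[symmetric])
    then have "poly ?B z = 0" using prim_pow_eq_1[OF z] by (simp add: poly_monom)
    then have "?f dvd ?B" using PP_orb_dvd[OF Q B(1) _ stable_finite[OF so]] by blast
    then have eq: "?B = ?f * (?B div ?f)" by simp
    have B0: "?B \<noteq> 0" using B N by auto
    then have D0: "?B div ?f \<noteq> 0" using eq by (metis mult_zero_right)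
    have "z \<in> orb (q ^ d) z" by (rule self_in_orb)
    then have "card (orb (q ^ d) z) > 0" using stable_finite[OF so] by (auto simp: card_gt_0_iff)
    moreover have "degree ?B = card (orb (q ^ d) z) + degree (?B div ?f)"
      by (subst eq) (simp add: degree_mult_eq PP_nonzero D0 degree_PP stable_finite[OF so])
    ultimately have "degree (?B div ?f) < n div d" using B(2) by linarith
    moreover have "frobp (q ^ d) (?B div ?f) = ?B div ?f"
      by (rule frobp_mod(2)[OF Q B(1) frobp_PP[OF Q so]])
    moreover have "act (q ^ d) (?B div ?f) v = 0"
      using act_component[OF dn' mn' pr z, of v] 0 km by simp
    ultimately show False using nrm[OF dn] D0 unfolding normal_over_def by blast
  qed
  moreover have "component k v \<in> K (q ^ d) (prim m)"
    using component_in_K[OF v k] K_prim_mult[OF np pr q] km by simp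
  ultimately show "gen (q ^ d) (k div d) (component k v)" by (simp add: gen_def m_def)
qed

text \<open>A failure over \<open>q ^ d\<close> is moved to the subfield of degree
  \<open>d1\<close>, the part of \<open>d\<close> made of primes of \<open>m\<close>. There it
  contradicts the condition on the component of index \<open>m * d1\<close>, for which
  \<open>d1\<close> is admissible.\<close>

lemma compgen_imp_normal:
  assumes v: "v ^ (q ^ n) = v" and cg: "\<And>k. k dvd n' \<Longrightarrow> compgen q k (component k v)" and d: "d dvd n"
  shows "normal_over (q ^ d) (n div d) v"
proof (rule ccontr)
  assume nn: "\<not> normal_over (q ^ d) (n div d) v"
  have d0: "d > 0" using d n_pos by (auto intro: gr0I)
  have N: "n div d > 0" using d n_pos by (metis dvd_div_eq_0_iff not_gr_zero)
  have Q: "pw (q ^ d)" using q d0 pw_power by blast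
  have vd: "v ^ ((q ^ d) ^ (n div d)) = v" using v d by (simp flip: power_mult)
  obtain m z where m: "m dvd n div d" "\<not> p dvd m" and z: "z \<in> prim m"
    and zero: "act (q ^ d) ((monom 1 (n div d) - 1) div PP (orb (q ^ d) z)) v = 0"
    using not_normal_over[OF Q N vd nn] by blast
  obtain d1 d2 where d12: "d = d1 * d2" "coprime d2 m" "\<And>r. prime r \<Longrightarrow> r dvd d1 \<Longrightarrow> r dvd m"
    using coprime_part_decomposition[OF d0] by metis
  have pos: "d1 > 0" "d2 > 0" "m > 0" using d0 d12 m not_p_dvd_pos by auto
  have Q1: "pw (q ^ d1)" using q pos pw_power by blast
  have md: "m * d dvd n" using m d by (metis dvd_div_mult_self mult_dvd_mono dvd_refl)
  have pd1: "\<not> p dvd d1" using d12(3) p m(2) by blast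
  have "m * d1 dvd p ^ a * n'" using md d12 n by (metis dvd_mult_left mult.assoc)
  moreover have "coprime (m * d1) (p ^ a)"
    using prime_imp_coprime[OF p m(2)] prime_imp_coprime[OF p pd1] by (simp add: coprime_commute)
  ultimately have k: "m * d1 dvd n'" by (simp add: coprime_dvd_mult_right_iff)
  have mn': "m dvd n'" and d1n': "d1 dvd n'" using k dvd_mult_left dvd_mult_right by blast+
  have mM: "m dvd n' div d1" using k d1n' pos by (simp add: dvd_div_iff_mult)
  \<comment> \<open>Regularity makes \<open>d2\<close> coprime to the order of \<open>q\<close>, so
    the further power does not split the orbit.\<close>
  have "ord m (q ^ d) = ord m (q ^ d1)"
  proof -
    have "d2 dvd n" using d d12 dvd_mult_right dvd_trans by blast
    then have c: "coprime d2 (ord m q)" using ord_coprime_part[OF mn' _ d12(2)] by blast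
    have "ord m (q ^ d1) * gcd d1 (ord m q) = ord m q" by (rule ord_power_aux)
    then have "coprime d2 (ord m (q ^ d1))" using c by (metis coprime_mult_right_iff)
    then have "ord m ((q ^ d1) ^ d2) = ord m (q ^ d1)"
      using ord_power_aux[of m "q ^ d1" d2] by simp
    then show ?thesis by (simp add: d12(1) power_mult)
  qed
  then have orbs: "orb (q ^ d) z = orb (q ^ d1) z"
    using card_orb[OF Q m(2) z] card_orb[OF Q1 m(2) z] orb_power_sub[of "q ^ d1" d2 z]
      stable_finite[OF stable_orb[OF Q1 m(2) z]]
    by (intro card_subset_eq) (simp_all add: d12(1) power_mult)
  let ?f = "PP (orb (q ^ d1) z)" and ?B = "\<lambda>i. monom 1 (n div i) - 1 :: 'l poly"
  define G where "G = ?B d div ?f"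
  have so: "stable (q ^ d1) (orb (q ^ d1) z)" by (rule stable_orb[OF Q1 m(2) z])
  have fG: "frobp (q ^ d1) G = G"
    unfolding G_def by (rule frobp_mod(2)[OF Q1 frobp_binomial[OF Q1] frobp_PP[OF Q1 so]])
  have "poly (?B d) z = 0" using prim_pow_eq_1[OF z] m by (simp add: poly_monom)
  then have "?f dvd ?B d" using PP_orb_dvd[OF Q1 frobp_binomial[OF Q1] _ stable_finite[OF so]] by blast
  then have BG: "?B d = G * ?f" by (simp add: G_def)
  have nd: "n div d1 = d2 * (n div d)" using d d12 pos by (metis div_mult2_eq div_mult_swap dvd_div_mult_self mult.commute dvd_mult_imp_div)
  have B1: "?B d1 = pcompose G (monom 1 d2) * pcompose ?f (monom 1 d2)"
  proof -
    have "?B d1 = pcompose (?B d) (monom 1 d2)"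
    proof -
      have "pcompose (monom 1 N) (monom 1 d2) = (monom 1 (d2 * N) :: 'l poly)" for N
        by (induction N) (simp_all add: monom_0 monom_Suc pcompose_pCons mult_monom pcompose_1 flip: one_pCons)
      then show ?thesis by (simp add: pcompose_diff pcompose_1 nd)
    qed
    then show ?thesis by (simp add: BG pcompose_mult)
  qed
  \<comment> \<open>Inverting \<open>d2\<close> modulo \<open>m\<close> gives a \<open>d2\<close>-th
    root \<open>y\<close> of \<open>z\<close> that again has order \<open>m\<close>.\<close>
  obtain e where e: "[d2 * e = 1] (mod m)" using cong_solve_coprime_nat[OF d12(2)] by auto
  define y where "y = z ^ e"
  have ydz: "y ^ d2 = z"
    using prim_pow_cong[OF pos(3) z, of "d2 * e" 1] e by (simp add: y_def mult.commute flip: power_mult)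
  have y: "y \<in> prim m"
  proof -
    have "y ^ m = 1" using z by (simp add: y_def prim_def) (metis mult.commute power_mult power_one)
    moreover have "m dvd j" if "y ^ j = 1" for j
    proof -
      have "z ^ j = 1" using that by (metis ydz mult.commute power_mult power_one)
      then show ?thesis using prim_pow_eq_1[OF z] by blast
    qed
    ultimately show ?thesis by (simp add: prim_def)
  qed
  let ?f' = "PP (orb (q ^ d1) y)"
  have so': "stable (q ^ d1) (orb (q ^ d1) y)" by (rule stable_orb[OF Q1 m(2) y])
  \<comment> \<open>Hence the cofactor of the minimal polynomial of \<open>y\<close> over degree
    \<open>d1\<close> is a multiple of \<open>pcompose G (monom 1 d2)\<close>, which acts as
    \<open>G\<close> does over \<open>q ^ d\<close> and so kills \<open>v\<close>.\<close>
  have "?f' dvd pcompose ?f (monom 1 d2)"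
  proof (rule PP_dvd[OF stable_finite[OF so']])
    fix x assume "x \<in> orb (q ^ d1) y"
    then have "x ^ d2 \<in> orb (q ^ d1) z" using pow_in_orb_pow ydz by blast
    then show "poly (pcompose ?f (monom 1 d2)) x = 0"
      by (simp add: poly_pcompose poly_monom poly_PP_eq_0_iff stable_finite[OF so])
  qed
  then obtain S where S: "pcompose ?f (monom 1 d2) = S * ?f'" by (metis dvdE mult.commute)
  have "?B d1 div ?f' = S * pcompose G (monom 1 d2)"
    by (simp add: B1 S PP_nonzero mult.left_commute[of _ S] flip: mult.assoc)
  moreover have "frobp (q ^ d1) (pcompose G (monom 1 d2)) = pcompose G (monom 1 d2)"
    using frobp_pcompose[OF Q1] fG by simp
  ultimately have "act (q ^ d1) (?B d1 div ?f') v = act (q ^ d1) S (act (q ^ d1) (pcompose G (monom 1 d2)) v)"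
    using act_mult[OF Q1] by simp
  also have "act (q ^ d1) (pcompose G (monom 1 d2)) v = 0"
    using zero orbs by (simp add: act_pcompose_monom G_def d12(1) flip: power_mult)
  finally have "act (q ^ d1) (PP (prim m - orb (q ^ d1) y)) (component (m * d1) v) = 0"
    using act_component[OF d1n' mM d12(3) y, of v] act_zero[OF Q1] by simp
  moreover interpret regular_pair q "m * d1" by (rule regular_pair_divisor[OF k])
  have "admissible d1"
    unfolding admissible_def using pos d12(3) by (auto simp: prime_dvd_mult_iff)
  then have "gen (q ^ d1) m (component (m * d1) v)"
    using cg[OF k] pos unfolding compgen_def by force
  ultimately show False using y by (auto simp: gen_def)
qed

text \<open>The components of the semisimple part can be prescribed independently, by
  \<open>crt_count\<close>. Each admissible semisimple part has
  \<open>q ^ ((p ^ a - 1) * n')\<close> preimages, and \<open>n'\<close> is the sum of the totients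
  of its divisors.\<close>

lemma card_completely_normal:
  "card {v. v ^ (q ^ n) = v \<and> (\<forall>d. d dvd n \<longrightarrow> normal_over (q ^ d) (n div d) v)} =
    (\<Prod>k\<in>{k. k dvd n'}. card {w. compgen q k w} * q ^ ((p ^ a - 1) * totient k))"
proof -
  let ?I = "{k. k dvd n'}"
  have fin: "finite ?I" using n'_pos by simp
  have UN: "(\<Union>k\<in>?I. prim k) = mu n'" using mu_eq_UN[OF n'_pos] by simp
  have Cs: "{w. compgen q k w} \<subseteq> K q (prim k)" if "k \<in> ?I" for k
  proof
    interpret regular_pair q k by (rule regular_pair_divisor) (use that in simp)
    have "admissible 1" by (simp add: admissible_def)
    fix w assume "w \<in> {w. compgen q k w}"
    then have "gen (q ^ 1) (k div 1) w" using \<open>admissible 1\<close> unfolding compgen_def by blast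
    then show "w \<in> K q (prim k)" by (simp add: gen_def)
  qed
  define D where "D = {w \<in> K q (mu n'). \<forall>k\<in>?I. act q (PP (mu n' - prim k)) w \<in> {w. compgen q k w}}"
  have "card D = (\<Prod>k\<in>?I. card {w. compgen q k w})"
    unfolding D_def UN[symmetric]
  proof (rule crt_count[OF q fin])
    show "stable q (prim k)" if "k \<in> ?I" for k using that np_dvd stable_prim[OF q] by simp
    show "prim k \<inter> prim j = {}" if "k \<noteq> j" for k j using prim_disjoint[OF that] .
  qed (use Cs in auto)
  have finD: "finite D"
    unfolding D_def by (rule finite_subset[OF _ card_K(1)[OF q stable_mu[OF n']]]) auto
  have "{v. v ^ (q ^ n) = v \<and> (\<forall>d. d dvd n \<longrightarrow> normal_over (q ^ d) (n div d) v)} =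
      {v. v ^ (q ^ n) = v \<and> (\<forall>k. k dvd n' \<longrightarrow> compgen q k (component k v))}"
    using normal_imp_compgen compgen_imp_normal by blast
  also have "\<dots> = {v. act q (PP (mu n') ^ (p ^ a - 1)) v \<in> D}"
    unfolding D_def component_def semisimple_part_in_K[symmetric] semisimple_part_def by auto
  also have "card \<dots> = card D * q ^ degree (PP (mu n') ^ (p ^ a - 1))"
  proof (rule card_act_vimage[OF q _ finD])
    have "0 \<notin> mu n'" using n'_pos by (simp add: mu_def zero_power)
    then have "poly (PP (mu n') ^ (p ^ a - 1)) 0 \<noteq> 0"
      using card_mu(1)[OF n'] by (simp add: poly_PP_eq_0_iff poly_power)
    then show "coeff (PP (mu n') ^ (p ^ a - 1)) 0 \<noteq> 0" by (simp add: poly_0_coeff_0)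
  qed
  also have "degree (PP (mu n') ^ (p ^ a - 1)) = (p ^ a - 1) * n'"
    using card_mu[OF n'] by (simp add: degree_power_eq PP_nonzero degree_PP)
  also have "\<dots> = (\<Sum>k\<in>?I. (p ^ a - 1) * totient k)"
    by (simp add: totient_divisor_sum flip: sum_distrib_left)
  also have "q ^ \<dots> = (\<Prod>k\<in>?I. q ^ ((p ^ a - 1) * totient k))" by (rule power_sum)
  finally show ?thesis
    using \<open>card D = _\<close> by (simp add: prod.distrib)
qed

end

end

section \<open>Transfer to the finite field\<close>

lemma frob_funpow: "(frob q ^^ i) v = v ^ (q ^ i)"
  by (induction i) (simp_all add: frob_def mult.commute flip: power_mult)

lemma CHAR_finite_field:
  assumes "prime p" "card (UNIV :: 'a :: finite_field set) = p ^ m"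
  shows "CHAR('a) = p"
proof -
  have "prime CHAR('a)" by (simp add: CHAR_pos prime_CHAR_semidom)
  moreover have "CHAR('a) dvd p ^ m"
    using CHAR_dvd_CARD[where 'a = 'a] assms by simp
  ultimately show ?thesis
    using assms(1) prime_dvd_power primes_dvd_imp_eq by blast
qed

context char_p
begin

lemma card_fixed_points:
  assumes "pw q" "n > 0"
  shows "finite {x :: 'l. x ^ (q ^ n) = x}" "card {x :: 'l. x ^ (q ^ n) = x} = q ^ n"
proof -
  have eq: "{x :: 'l. x ^ (q ^ n) = x} = ker q (monom 1 n - 1)"
    by (auto simp: ker_def act_binomial)
  have c: "coeff (monom 1 n - 1 :: 'l poly) 0 \<noteq> 0" using assms(2) by simp
  show "finite {x :: 'l. x ^ (q ^ n) = x}" "card {x :: 'l. x ^ (q ^ n) = x} = q ^ n"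
    unfolding eq using card_ker[OF assms(1) c] degree_binomial(1)[OF assms(2), where 'a = 'l] by auto
qed

end

lemma range_to_ac:
  assumes "char_p TYPE('a :: finite_field alg_closure) p" "char_p.pw p q" "n > 0"
    and card: "card (UNIV :: 'a set) = q ^ n"
  shows "range (to_ac :: 'a \<Rightarrow> _) = {x. x ^ (q ^ n) = x}"
proof -
  interpret char_p p "TYPE('a alg_closure)" by fact
  show ?thesis
  proof (rule card_subset_eq)
    show "range (to_ac :: 'a \<Rightarrow> _) \<subseteq> {x. x ^ (q ^ n) = x}"
      using finite_field_power_card_eq_same[where 'a = 'a] card by (auto simp flip: to_ac_power)
    show "card (range (to_ac :: 'a \<Rightarrow> _)) = card {x :: 'a alg_closure. x ^ (q ^ n) = x}"
      using card card_fixed_points[OF assms(2,3)] by (simp add: card_image inj_to_ac)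
  qed (rule card_fixed_points[OF assms(2,3)])
qed

text \<open>Independence over the subfield is \<open>normal_over\<close> read through coefficients.
  The coefficients met in the closure are fixed by \<open>q ^ n\<close>, hence come from the given
  field.\<close>

lemma is_basis_over_iff_normal_over:
  fixes v :: "'a :: finite_field"
  assumes cp: "char_p TYPE('a alg_closure) p" and q: "char_p.pw p q" and n: "n > 0"
    and card: "card (UNIV :: 'a set) = q ^ n" and d: "d dvd n"
  shows "is_basis_over (gf (q ^ d)) (n div d) (\<lambda>j. (frob q ^^ (d * j)) v) \<longleftrightarrow>
    char_p.normal_over (q ^ d) (n div d) (to_ac v)"
proof -
  interpret char_p p "TYPE('a alg_closure)" by fact
  define N where "N = n div d"
  have pos: "d > 0" "N > 0" using d n by (auto simp: N_def intro: gr0I)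
  have nd: "n = d * N" using d by (simp add: N_def)
  have Q: "pw (q ^ d)" using q pos pw_power by blast
  let ?Q = "q ^ d"
  define b where "b j = v ^ (?Q ^ j)" for j
  have b: "(\<lambda>j. (frob q ^^ (d * j)) v) = b" by (simp add: frob_funpow b_def power_mult fun_eq_iff)
  have gf: "to_ac x ^ ?Q = to_ac x \<longleftrightarrow> x \<in> gf ?Q" for x :: 'a
    by (simp add: gf_def flip: to_ac_power)
  have indep_iff: "(\<forall>c. (\<forall>j<N. c j \<in> gf ?Q) \<and> (\<Sum>j<N. c j * b j) = 0 \<longrightarrow> (\<forall>j<N. c j = 0)) \<longleftrightarrow>
      normal_over ?Q N (to_ac v)" (is "?I \<longleftrightarrow> _")
  proof
    assume I: ?I
    show "normal_over ?Q N (to_ac v)" unfolding normal_over_def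
    proof (intro allI impI)
      fix P :: "'a alg_closure poly" assume P: "frobp ?Q P = P" "degree P < N" "act ?Q P (to_ac v) = 0"
      define c where "c j = of_ac (coeff P j)" for j
      have "coeff P j ^ (?Q ^ N) = coeff P j" for j
      proof -
        have "frobp (?Q ^ N) P = P" using frobp_fixed_power[OF Q pos(2) P(1)] .
        then show ?thesis using frobp_iff[OF pw_power[OF Q pos(2)]] by blast
      qed
      then have "coeff P j \<in> range (to_ac :: 'a \<Rightarrow> _)" for j
        using range_to_ac[OF cp q n card] by (simp add: nd power_mult)
      then have tc: "to_ac (c j) = coeff P j" for j by (simp add: c_def to_ac_of_ac)
      have "c j \<in> gf ?Q" for j using P(1) frobp_iff[OF Q] gf tc by metis
      moreover have "to_ac (\<Sum>j<N. c j * b j) = act ?Q P (to_ac v)"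
        using P(2) act_upto[of P "N - 1" ?Q "to_ac v"] pos(2)
        by (simp add: to_ac_sum tc b_def lessThan_Suc_atMost[symmetric])
      then have "(\<Sum>j<N. c j * b j) = 0" using P(3) by (metis to_ac_eq_0_iff)
      ultimately have "\<forall>j<N. c j = 0" using I by blast
      then have "coeff P j = 0" for j
        using tc[of j] P(2) coeff_eq_0[of P j] by (cases "j < N") auto
      then show "P = 0" by (simp add: poly_eq_iff)
    qed
  next
    assume nrm: "normal_over ?Q N (to_ac v)"
    show ?I
    proof (intro allI impI; elim conjE)
      fix c j assume c: "\<forall>j<N. c j \<in> gf ?Q" "(\<Sum>j<N. c j * b j) = 0" and j: "j < N"
      define P where "P = (\<Sum>i<N. monom (to_ac (c i)) i)"
      have cP: "coeff P i = (if i < N then to_ac (c i) else 0)" for i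
        by (simp add: P_def coeff_sum if_distrib cong: if_cong)
      have dP: "degree P < N" using pos(2) cP by (intro degree_lessI) auto
      have "frobp ?Q P = P" using c(1) gf by (auto simp: frobp_iff[OF Q] cP zero_pw[OF Q])
      moreover have "act ?Q P (to_ac v) = to_ac (\<Sum>j<N. c j * b j)"
        using dP act_upto[of P "N - 1" ?Q "to_ac v"] pos(2)
        by (simp add: to_ac_sum cP b_def lessThan_Suc_atMost[symmetric])
      ultimately have "P = 0" using nrm dP c(2) unfolding normal_over_def by simp
      then show "c j = 0" using cP[of j] j by simp
    qed
  qed
  \<comment> \<open>Independence makes the map from coefficient tuples injective. There are
    \<open>(q ^ d) ^ N = q ^ n\<close> tuples, as many as field elements, so it is onto.\<close>
  have span: "\<exists>c. (\<forall>j<N. c j \<in> gf ?Q) \<and> x = (\<Sum>j<N. c j * b j)" if I: ?I for x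
  proof -
    let ?D = "\<Pi>\<^sub>E j\<in>{..<N}. gf ?Q :: 'a set"
    define f where "f c = (\<Sum>j<N. c j * b j)" for c
    have sub: "y - z \<in> gf ?Q" if "y \<in> gf ?Q" "z \<in> gf ?Q" for y z :: 'a
      using that diff_pw[OF Q, of "to_ac y" "to_ac z"] by (simp flip: gf)
    have "inj_on f ?D"
    proof (rule inj_onI)
      fix c c' assume c: "c \<in> ?D" "c' \<in> ?D" "f c = f c'"
      have "(\<Sum>j<N. (c j - c' j) * b j) = 0"
        using c(3) by (simp add: f_def left_diff_distrib sum_subtractf)
      moreover have "\<forall>j<N. c j - c' j \<in> gf ?Q" using c sub by (auto simp: PiE_iff)
      ultimately have eq: "\<forall>j<N. c j - c' j = 0"
        using spec[OF I, of "\<lambda>j. c j - c' j"] by blast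
      show "c = c'"
      proof (rule PiE_ext[OF c(1,2)])
        fix j assume "j \<in> {..<N}"
        then have "c j - c' j = 0" using eq by blast
        then show "c j = c' j" by simp
      qed
    qed
    then have "card (f ` ?D) = card (UNIV :: 'a set)"
      using card_gf[OF pw_gt1[OF q] card pos(1) d] card
      by (simp add: card_image card_PiE nd power_mult)
    then have "f ` ?D = UNIV" by (intro card_subset_eq) auto
    then obtain c where "c \<in> ?D" "x = f c" by (metis UNIV_I imageE)
    then show ?thesis by (auto simp: f_def PiE_iff)
  qed
  show ?thesis
    unfolding b N_def[symmetric] is_basis_over_def indep_iff[symmetric] using span by blast
qed

theorem theorem13p1:
  fixes p q n n' a :: nat
  assumes "prime p"
    and "\<exists>e>0. q = p ^ e"
    and "n \<ge> 1"
    and "n = p ^ a * n'"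
    and "\<not> p dvd n'"
    and regular: "gcd (ord (rad n') q) n = 1"
    and "card (UNIV :: 'a :: finite_field set) = q ^ n"
  shows "int (card {v :: 'a. completely_normal q n v}) =
    (\<Prod>k\<in>nonexc_divisors q n'.
        (int q ^ (ord k q div tau q k) - 1) ^ (tau q k * totient k div ord k q)
        * int q ^ ((p ^ a - 1) * totient k)) *
    (\<Prod>k\<in>exc_divisors q n'.
        (int q ^ (2 * ord k q div tau q k) - 4 * int q ^ (ord k q div tau q k) + 3)
          ^ (tau q k * totient k div (2 * ord k q))
        * int q ^ ((p ^ a - 1) * totient k))"
proof -
  have n: "n > 0" using assms(3) by simp
  have n'0: "n' > 0" using assms(5) by (cases n') auto
  obtain e where e: "e > 0" "q = p ^ e" using assms(2) by blast
  have "CHAR('a) = p"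
    using assms(1,7) e(2) CHAR_finite_field[of p "e * n"] by (simp add: power_mult)
  then have cp: "char_p TYPE('a alg_closure) p"
    using assms(1) by unfold_locales simp_all
  interpret char_p p "TYPE('a alg_closure)" by (rule cp)
  have q: "pw q" unfolding pw_def using e by blast
  have reg: "coprime (ord (rad n') q) n" using regular by (simp only: coprime_iff_gcd_eq_1)
  let ?f = "\<lambda>k. int (card {w :: 'a alg_closure. compgen q k w} * q ^ ((p ^ a - 1) * totient k))"
  have cn: "completely_normal q n v \<longleftrightarrow> (\<forall>d. d dvd n \<longrightarrow> normal_over (q ^ d) (n div d) (to_ac v))" for v :: 'a
    unfolding completely_normal_def using is_basis_over_iff_normal_over[OF cp q n assms(7)] by blast
  have "to_ac ` {v :: 'a. completely_normal q n v} =
      {x. x ^ (q ^ n) = x \<and> (\<forall>d. d dvd n \<longrightarrow> normal_over (q ^ d) (n div d) x)}"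
    using range_to_ac[OF cp q n assms(7)] by (auto simp: cn)
  then have "card {v :: 'a. completely_normal q n v} =
      card {x :: 'a alg_closure. x ^ (q ^ n) = x \<and> (\<forall>d. d dvd n \<longrightarrow> normal_over (q ^ d) (n div d) x)}"
    by (metis card_image inj_on_subset inj_to_ac subset_UNIV)
  then have "int (card {v :: 'a. completely_normal q n v}) = (\<Prod>k\<in>{k. k dvd n'}. ?f k)"
    unfolding card_completely_normal[OF q assms(4,5) reg] by simp
  also have "{k. k dvd n'} = nonexc_divisors q n' \<union> exc_divisors q n'"
    by (auto simp: nonexc_divisors_def exc_divisors_def)
  also have "(\<Prod>k\<in>\<dots>. ?f k) = (\<Prod>k\<in>nonexc_divisors q n'. ?f k) * (\<Prod>k\<in>exc_divisors q n'. ?f k)"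
    using n'0 by (intro prod.union_disjoint) (auto simp: nonexc_divisors_def exc_divisors_def)
  also have "(\<Prod>k\<in>nonexc_divisors q n'. ?f k) = (\<Prod>k\<in>nonexc_divisors q n'.
        (int q ^ (ord k q div tau q k) - 1) ^ (tau q k * totient k div ord k q)
        * int q ^ ((p ^ a - 1) * totient k))"
  proof (intro prod.cong refl)
    fix k assume "k \<in> nonexc_divisors q n'"
    then have k: "k dvd n'" "\<not> exceptional q k" by (auto simp: nonexc_divisors_def)
    have "\<not> p dvd k" using assms(5) k(1) dvd_trans by blast
    \<comment> \<open>This makes the natural-number subtraction in the count agree with the integer
      one in the claim.\<close>
    moreover have "q ^ (ord k q div tau q k) \<ge> 1" using pw_gt0[OF q] by simp
    ultimately show "?f k = (int q ^ (ord k q div tau q k) - 1) ^ (tau q k * totient k div ord k q)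
        * int q ^ ((p ^ a - 1) * totient k)"
      using card_compgen_nonexceptional[OF q _ regular_pair_divisor[OF q assms(4,5) reg k(1)] k(2)]
      by (simp add: of_nat_diff)
  qed
  also have "(\<Prod>k\<in>exc_divisors q n'. ?f k) = (\<Prod>k\<in>exc_divisors q n'.
        (int q ^ (2 * ord k q div tau q k) - 4 * int q ^ (ord k q div tau q k) + 3)
          ^ (tau q k * totient k div (2 * ord k q))
        * int q ^ ((p ^ a - 1) * totient k))"
  proof (intro prod.cong refl)
    fix k assume "k \<in> exc_divisors q n'"
    then have k: "k dvd n'" "exceptional q k" by (auto simp: exc_divisors_def)
    have "\<not> p dvd k" using assms(5) k(1) dvd_trans by blast
    then show "?f k = (int q ^ (2 * ord k q div tau q k) - 4 * int q ^ (ord k q div tau q k) + 3)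
          ^ (tau q k * totient k div (2 * ord k q)) * int q ^ ((p ^ a - 1) * totient k)"
      using card_compgen_exceptional[OF q _ regular_pair_divisor[OF q assms(4,5) reg k(1)] k(2)] by simp
  qed
  finally show ?thesis .
qed

end
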